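(* Let $\mathcal{G}$ be an étale groupoid with compact Hausdorff space of units. Consider the standard embedding $C(\mathcal{G}^{(0)})\subseteq C^*_{\max}(\mathcal{G})$. Then there is a unique structure $(\alpha_\gamma)_{\gamma\in\Gamma(\mathcal{G})}$ of a unital $\mathcal{G}$-$C^*$-algebra on $C^*_{\max}(\mathcal{G})$ satisfying $$\alpha_\gamma(f)=f\circ c_{\gamma^*}$$ for all $\gamma\in\Gamma(\mathcal{G})$, all open bisections $U\subseteq\mathcal{G}$ satisfying $s(U),r(U)\subseteq\operatorname{supp}\gamma$ and all $f\in C_c(U)$, where $c_\gamma:h\mapsto\gamma h\gamma^*$ denotes conjugation with $\gamma$. Further, if $\pi:C^*_{\max}(\mathcal{G})\to A$ is a unital $*$-homomorphism that is injective on $C(\mathcal{G}^{(0)})$, there is the structure of a unital $\mathcal{G}$-$C^*$-algebra on $A$ so that $\pi$ is $\mathcal{G}$-equivariant. If $\pi$ is surjective, this structure is unique.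
   Context: Groupoids. $r,s$ denote range and source, $gh$ is defined iff $r(h)=s(g)$; étale means $r,s$ are local homeomorphisms ($\mathcal{G}$ need not be Hausdorff). $\Gamma(\mathcal{G})$ is the inverse semigroup of open bisections (open $\gamma\subseteq\mathcal{G}$ on which $s$ and $r$ are homeomorphisms onto their images), with setwise product and $\gamma^*=\gamma^{-1}$. For $\gamma\in\Gamma(\mathcal{G})$ put $\operatorname{supp}\gamma=s(\gamma)$, $\operatorname{im}\gamma=r(\gamma)$ and $\psi_\gamma=r|_\gamma\circ(s|_\gamma)^{-1}:\operatorname{supp}\gamma\to\operatorname{im}\gamma$. For $h\in\mathcal{G}$ with $s(h),r(h)\in\operatorname{supp}\gamma$, $\gamma h\gamma^*$ denotes the element $g_1hg_2^{-1}$, where $g_1,g_2\in\gamma$ with $s(g_1)=r(h)$, $s(g_2)=s(h)$; thus $f\circ c_{\gamma^*}\in C_c(\gamma U\gamma^* )$ for $f\in C_c(U)$. $\mathcal{C}(\mathcal{G})\subseteq\ell^\infty(\mathcal{G})$ is the linear span of the spaces $C_c(U)$ (extended by zero), $U$ open bisections, a $*$-algebra under convolution; $C^*_{\max}(\mathcal{G})$ is its universal enveloping $C^*$-algebra. $\mathcal{G}$-$C^*$-algebras. For a unital inclusion $C(\mathcal{G}^{(0)})\subseteq A$ and open $U\subseteq\mathcal{G}^{(0)}$ put $A_U=\overline{C_0(U)AC_0(U)}$. A unital $\mathcal{G}$-$C^*$-algebra is a unital $C^*$-algebra $A$ with an injective unital $*$-homomorphism $\iota:C(\mathcal{G}^{(0)})\to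 A$ and $*$-isomorphisms $\alpha_\gamma:A_{\operatorname{supp}\gamma}\to A_{\operatorname{im}\gamma}$, $\gamma\in\Gamma(\mathcal{G})$, such that $\alpha_\gamma(\iota(f))=\iota(f\circ\psi_{\gamma^*})$ for $f\in C_0(\operatorname{supp}\gamma)$ and $\alpha_{\gamma_1}\circ\alpha_{\gamma_2}=\alpha_{\gamma_1\gamma_2}$ on $A_{\psi_{\gamma_2^*}(\operatorname{supp}\gamma_1\cap\operatorname{im}\gamma_2)}$. A unital completely positive map $\varphi:(A,\iota_A,\alpha)\to(B,\iota_B,\beta)$ is $\mathcal{G}$-equivariant if $\varphi\circ\iota_A=\iota_B$ and $\varphi\circ\alpha_\gamma=\beta_\gamma\circ\varphi$ on $A_{\operatorname{supp}\gamma}$ for all $\gamma\in\Gamma(\mathcal{G})$. *)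

theory Defs
  imports "HOL-Analysis.Analysis"
begin

section \<open>Unital C*-algebras\<close>

text \<open>
  The class is built on \<^class>\<open>monoid_mult\<close> rather than on \<^class>\<open>real_normed_algebra_1\<close>, because
  the latter excludes the zero algebra (the C*-algebra of the empty groupoid).
\<close>

class cstar_algebra = banach + real_normed_algebra + monoid_mult +
  fixes scaleC :: "complex \<Rightarrow> 'a \<Rightarrow> 'a" (infixr \<open>*\<^sub>C\<close> 75)
    and star :: "'a \<Rightarrow> 'a"
  assumes scaleC_add_right: "c *\<^sub>C (x + y) = c *\<^sub>C x + c *\<^sub>C y"
    and scaleC_add_left: "(c + d) *\<^sub>C x = c *\<^sub>C x + d *\<^sub>C x"
    and scaleC_scaleC: "c *\<^sub>C (d *\<^sub>C x) = (c * d) *\<^sub>C x"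
    and scaleC_of_real: "complex_of_real t *\<^sub>C x = t *\<^sub>R x"
    and mult_scaleC_left: "(c *\<^sub>C x) * y = c *\<^sub>C (x * y)"
    and mult_scaleC_right: "x * (c *\<^sub>C y) = c *\<^sub>C (x * y)"
    and norm_scaleC: "norm (c *\<^sub>C x) = cmod c * norm x"
    and star_add: "star (x + y) = star x + star y"
    and star_scaleC: "star (c *\<^sub>C x) = cnj c *\<^sub>C star x"
    and star_mult: "star (x * y) = star y * star x"
    and star_star: "star (star x) = x"
    and cstar_identity: "norm (star x * x) = (norm x)\<^sup>2"

text \<open>
  *-homomorphisms into a C*-algebra, defined on a set \<open>S\<close> that carries the given *-algebra
  operations.  No continuity is required.
\<close>

definition star_hom_on ::
  "'d set \<Rightarrow> ('d \<Rightarrow> 'd \<Rightarrow> 'd) \<Rightarrow> (complex \<Rightarrow> 'd \<Rightarrow> 'd) \<Rightarrow> ('d \<Rightarrow> 'd \<Rightarrow> 'd) \<Rightarrow> ('d \<Rightarrow> 'd) \<Rightarrow>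
   ('d \<Rightarrow> 'a::cstar_algebra) \<Rightarrow> bool"
  where "star_hom_on S add scl mlt st \<phi> \<longleftrightarrow>
    (\<forall>x\<in>S. \<forall>y\<in>S. \<phi> (add x y) = \<phi> x + \<phi> y) \<and>
    (\<forall>c. \<forall>x\<in>S. \<phi> (scl c x) = c *\<^sub>C \<phi> x) \<and>
    (\<forall>x\<in>S. \<forall>y\<in>S. \<phi> (mlt x y) = \<phi> x * \<phi> y) \<and>
    (\<forall>x\<in>S. \<phi> (st x) = star (\<phi> x))"

definition unital_star_hom :: "('a::cstar_algebra \<Rightarrow> 'b::cstar_algebra) \<Rightarrow> bool"
  where "unital_star_hom \<phi> \<longleftrightarrow> star_hom_on UNIV (+) scaleC (*) star \<phi> \<and> \<phi> 1 = 1"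

definition star_iso_betw :: "'a::cstar_algebra set \<Rightarrow> 'b::cstar_algebra set \<Rightarrow> ('a \<Rightarrow> 'b) \<Rightarrow> bool"
  where "star_iso_betw S T \<phi> \<longleftrightarrow> star_hom_on S (+) scaleC (*) star \<phi> \<and> bij_betw \<phi> S T"


section \<open>Etale groupoids and their open bisections\<close>

text \<open>
  The arrows of \<open>G\<close> are the points of the topology \<open>gtop G\<close>; the values of the operations on other
  points, and of \<open>gcomp G g h\<close> when \<open>src G g \<noteq> rng G h\<close>, are irrelevant.  Units are identity
  arrows, so \<open>src\<close> and \<open>rng\<close> take values in the arrows.
\<close>

record 'g groupoid =
  gtop :: "'g topology"
  src :: "'g \<Rightarrow> 'g"
  rng :: "'g \<Rightarrow> 'g"
  gcomp :: "'g \<Rightarrow> 'g \<Rightarrow> 'g"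
  ginv :: "'g \<Rightarrow> 'g"

abbreviation arrows :: "'g groupoid \<Rightarrow> 'g set"
  where "arrows G \<equiv> topspace (gtop G)"

definition units :: "'g groupoid \<Rightarrow> 'g set"
  where "units G = src G ` arrows G"

abbreviation unit_space :: "'g groupoid \<Rightarrow> 'g topology"
  where "unit_space G \<equiv> subtopology (gtop G) (units G)"

definition composable :: "'g groupoid \<Rightarrow> ('g \<times> 'g) set"
  where "composable G = {(g, h). g \<in> arrows G \<and> h \<in> arrows G \<and> rng G h = src G g}"

definition local_homeomorphism :: "'a topology \<Rightarrow> 'b topology \<Rightarrow> ('a \<Rightarrow> 'b) \<Rightarrow> bool"
  where "local_homeomorphism X Y f \<longleftrightarrow>
    (\<forall>x\<in>topspace X. \<exists>U. openin X U \<and> x \<in> U \<and> openin Y (f ` U) \<and>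
       homeomorphic_map (subtopology X U) (subtopology Y (f ` U)) f)"

locale etale_groupoid =
  fixes G :: "'g groupoid"
  assumes src_closed: "g \<in> arrows G \<Longrightarrow> src G g \<in> arrows G"
    and rng_closed: "g \<in> arrows G \<Longrightarrow> rng G g \<in> arrows G"
    and src_src: "g \<in> arrows G \<Longrightarrow> src G (src G g) = src G g"
    and rng_src: "g \<in> arrows G \<Longrightarrow> rng G (src G g) = src G g"
    and src_rng: "g \<in> arrows G \<Longrightarrow> src G (rng G g) = rng G g"
    and rng_rng: "g \<in> arrows G \<Longrightarrow> rng G (rng G g) = rng G g"
    and comp_closed: "(g, h) \<in> composable G \<Longrightarrow> gcomp G g h \<in> arrows G"
    and src_comp: "(g, h) \<in> composable G \<Longrightarrow> src G (gcomp G g h) = src G h"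
    and rng_comp: "(g, h) \<in> composable G \<Longrightarrow> rng G (gcomp G g h) = rng G g"
    and comp_assoc: "\<lbrakk>(g, h) \<in> composable G; (h, k) \<in> composable G\<rbrakk> \<Longrightarrow>
           gcomp G (gcomp G g h) k = gcomp G g (gcomp G h k)"
    and comp_src: "g \<in> arrows G \<Longrightarrow> gcomp G g (src G g) = g"
    and comp_rng: "g \<in> arrows G \<Longrightarrow> gcomp G (rng G g) g = g"
    and ginv_closed: "g \<in> arrows G \<Longrightarrow> ginv G g \<in> arrows G"
    and src_ginv: "g \<in> arrows G \<Longrightarrow> src G (ginv G g) = rng G g"
    and rng_ginv: "g \<in> arrows G \<Longrightarrow> rng G (ginv G g) = src G g"
    and comp_ginv_left: "g \<in> arrows G \<Longrightarrow> gcomp G (ginv G g) g = src G g"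
    and comp_ginv_right: "g \<in> arrows G \<Longrightarrow> gcomp G g (ginv G g) = rng G g"
    and continuous_comp: "continuous_map
           (subtopology (prod_topology (gtop G) (gtop G)) (composable G)) (gtop G)
           (\<lambda>(g, h). gcomp G g h)"
    and continuous_ginv: "continuous_map (gtop G) (gtop G) (ginv G)"
    and src_local_homeomorphism: "local_homeomorphism (gtop G) (unit_space G) (src G)"
    and rng_local_homeomorphism: "local_homeomorphism (gtop G) (unit_space G) (rng G)"

abbreviation supp :: "'g groupoid \<Rightarrow> 'g set \<Rightarrow> 'g set"
  where "supp G \<gamma> \<equiv> src G ` \<gamma>"

abbreviation im :: "'g groupoid \<Rightarrow> 'g set \<Rightarrow> 'g set"
  where "im G \<gamma> \<equiv> rng G ` \<gamma>"

definition bisections :: "'g groupoid \<Rightarrow> 'g set set"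
  where "bisections G = {\<gamma>. openin (gtop G) \<gamma> \<and>
    homeomorphic_map (subtopology (gtop G) \<gamma>) (subtopology (unit_space G) (supp G \<gamma>)) (src G) \<and>
    homeomorphic_map (subtopology (gtop G) \<gamma>) (subtopology (unit_space G) (im G \<gamma>)) (rng G)}"

definition set_comp :: "'g groupoid \<Rightarrow> 'g set \<Rightarrow> 'g set \<Rightarrow> 'g set"
  where "set_comp G \<gamma> \<delta> = {gcomp G g h | g h. g \<in> \<gamma> \<and> h \<in> \<delta> \<and> rng G h = src G g}"

definition set_inv :: "'g groupoid \<Rightarrow> 'g set \<Rightarrow> 'g set"
  where "set_inv G \<gamma> = ginv G ` \<gamma>"

definition psi :: "'g groupoid \<Rightarrow> 'g set \<Rightarrow> 'g \<Rightarrow> 'g"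
  where "psi G \<gamma> x = rng G (inv_into \<gamma> (src G) x)"

definition conj_by :: "'g groupoid \<Rightarrow> 'g set \<Rightarrow> 'g \<Rightarrow> 'g"
  where "conj_by G \<gamma> h =
    gcomp G (gcomp G (inv_into \<gamma> (src G) (rng G h)) h) (ginv G (inv_into \<gamma> (src G) (src G h)))"


section \<open>Function spaces on a groupoid\<close>

text \<open>All functions are extended by zero to the whole type.\<close>

definition Cc :: "'g groupoid \<Rightarrow> 'g set \<Rightarrow> ('g \<Rightarrow> complex) set"
  where "Cc G U = {f. (\<forall>x. x \<notin> U \<longrightarrow> f x = 0) \<and>
    continuous_map (subtopology (gtop G) U) euclidean f \<and>
    compactin (subtopology (gtop G) U) (subtopology (gtop G) U closure_of {x \<in> U. f x \<noteq> 0})}"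

definition C_groupoid :: "'g groupoid \<Rightarrow> ('g \<Rightarrow> complex) set"
  where "C_groupoid G = {\<lambda>x. \<Sum>i<n. c i * F i x | (n::nat) c F. \<forall>i<n. \<exists>U\<in>bisections G. F i \<in> Cc G U}"

definition C_unit :: "'g groupoid \<Rightarrow> ('g \<Rightarrow> complex) set"
  where "C_unit G = {f. (\<forall>x. x \<notin> units G \<longrightarrow> f x = 0) \<and> continuous_map (unit_space G) euclidean f}"

text \<open>
  The unit space being compact and Hausdorff, \<open>C\<^sub>0(U)\<close> for an open set \<open>U\<close> of units is the ideal
  of those continuous functions on the unit space that vanish off \<open>U\<close>.
\<close>

definition C0 :: "'g groupoid \<Rightarrow> 'g set \<Rightarrow> ('g \<Rightarrow> complex) set"
  where "C0 G U = {f \<in> C_unit G. \<forall>x. x \<notin> U \<longrightarrow> f x = 0}"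

text \<open>
  For \<open>f\<close> and \<open>f'\<close> in \<open>C_groupoid G\<close> the sum has finitely many terms: a bisection contains at most
  one arrow with a given range.
\<close>

definition convolution :: "'g groupoid \<Rightarrow> ('g \<Rightarrow> complex) \<Rightarrow> ('g \<Rightarrow> complex) \<Rightarrow> 'g \<Rightarrow> complex"
  where "convolution G f f' = (\<lambda>x. if x \<in> arrows G
    then (\<Sum>(g, h) | (g, h) \<in> composable G \<and> gcomp G g h = x \<and> f g \<noteq> 0 \<and> f' h \<noteq> 0. f g * f' h)
    else 0)"

definition involution :: "'g groupoid \<Rightarrow> ('g \<Rightarrow> complex) \<Rightarrow> 'g \<Rightarrow> complex"
  where "involution G f = (\<lambda>x. if x \<in> arrows G then cnj (f (ginv G x)) else 0)"

text \<open>The function \<open>f \<circ> \<psi>\<^bsub>\<gamma>*\<^esub>\<close> on \<open>im \<gamma>\<close>, extended by zero.\<close>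

definition psi_push :: "'g groupoid \<Rightarrow> 'g set \<Rightarrow> ('g \<Rightarrow> complex) \<Rightarrow> 'g \<Rightarrow> complex"
  where "psi_push G \<gamma> f = (\<lambda>x. if x \<in> im G \<gamma> then f (psi G (set_inv G \<gamma>) x) else 0)"

text \<open>The function \<open>f \<circ> c\<^bsub>\<gamma>*\<^esub>\<close> on \<open>\<gamma> U \<gamma>*\<close>, extended by zero.\<close>

definition conj_push :: "'g groupoid \<Rightarrow> 'g set \<Rightarrow> 'g set \<Rightarrow> ('g \<Rightarrow> complex) \<Rightarrow> 'g \<Rightarrow> complex"
  where "conj_push G \<gamma> U f =
    (\<lambda>x. if x \<in> set_comp G (set_comp G \<gamma> U) (set_inv G \<gamma>)
         then f (conj_by G (set_inv G \<gamma>) x) else 0)"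


section \<open>The maximal groupoid C*-algebra\<close>

definition cstar_seminorm :: "'g groupoid \<Rightarrow> (('g \<Rightarrow> complex) \<Rightarrow> real) \<Rightarrow> bool"
  where "cstar_seminorm G p \<longleftrightarrow>
    (\<forall>f\<in>C_groupoid G. 0 \<le> p f) \<and>
    (\<forall>f\<in>C_groupoid G. \<forall>f'\<in>C_groupoid G. p (\<lambda>x. f x + f' x) \<le> p f + p f') \<and>
    (\<forall>c. \<forall>f\<in>C_groupoid G. p (\<lambda>x. c * f x) = cmod c * p f) \<and>
    (\<forall>f\<in>C_groupoid G. \<forall>f'\<in>C_groupoid G. p (convolution G f f') \<le> p f * p f') \<and>
    (\<forall>f\<in>C_groupoid G. p (convolution G (involution G f) f) = (p f)\<^sup>2)"

text \<open>
  \<open>cstar_max G j\<close> says that the type \<open>'c\<close>, with the canonical map \<open>j\<close>, is the universal enveloping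
  C*-algebra of the *-algebra \<open>C_groupoid G\<close>, i.e. its separated completion for the largest
  C*-seminorm (\<open>norm \<circ> j\<close> is itself a C*-seminorm).  HOL cannot quantify over all target
  types of *-homomorphisms; C*-seminorms take their place: a *-homomorphism \<open>\<phi>\<close> into a C*-algebra
  gives the C*-seminorm \<open>norm \<circ> \<phi>\<close>, and the separated completion of a C*-seminorm is a
  C*-algebra.  Like any universal object, it is determined up to isomorphism only.
\<close>

definition cstar_max :: "'g groupoid \<Rightarrow> (('g \<Rightarrow> complex) \<Rightarrow> 'c::cstar_algebra) \<Rightarrow> bool"
  where "cstar_max G j \<longleftrightarrow>
    star_hom_on (C_groupoid G) (\<lambda>f f' x. f x + f' x) (\<lambda>c f x. c * f x)
      (convolution G) (involution G) j \<and>
    closure (j ` C_groupoid G) = UNIV \<and>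
    (\<forall>p. cstar_seminorm G p \<longrightarrow> (\<forall>f\<in>C_groupoid G. p f \<le> norm (j f)))"


section \<open>Unital G-C*-algebras\<close>

text \<open>
  The set of products is closed under multiplication by complex scalars, so its real span is
  its complex span.
\<close>

definition corner ::
  "'g groupoid \<Rightarrow> (('g \<Rightarrow> complex) \<Rightarrow> 'a::cstar_algebra) \<Rightarrow> 'g set \<Rightarrow> 'a set"
  where "corner G \<iota> U = closure (span {\<iota> f * a * \<iota> f' | f a f'. f \<in> C0 G U \<and> f' \<in> C0 G U})"

definition unit_embedding :: "'g groupoid \<Rightarrow> (('g \<Rightarrow> complex) \<Rightarrow> 'a::cstar_algebra) \<Rightarrow> bool"
  where "unit_embedding G \<iota> \<longleftrightarrow>
    star_hom_on (C_unit G) (\<lambda>f f' x. f x + f' x) (\<lambda>c f x. c * f x)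
      (\<lambda>f f' x. f x * f' x) (\<lambda>f x. cnj (f x)) \<iota> \<and>
    \<iota> (indicator (units G)) = 1 \<and>
    inj_on \<iota> (C_unit G)"

definition G_cstar_algebra ::
  "'g groupoid \<Rightarrow> (('g \<Rightarrow> complex) \<Rightarrow> 'a::cstar_algebra) \<Rightarrow> ('g set \<Rightarrow> 'a \<Rightarrow> 'a) \<Rightarrow> bool"
  where "G_cstar_algebra G \<iota> \<alpha> \<longleftrightarrow>
    unit_embedding G \<iota> \<and>
    (\<forall>\<gamma>\<in>bisections G.
       star_iso_betw (corner G \<iota> (supp G \<gamma>)) (corner G \<iota> (im G \<gamma>)) (\<alpha> \<gamma>)) \<and>
    (\<forall>\<gamma>\<in>bisections G. \<forall>f\<in>C0 G (supp G \<gamma>). \<alpha> \<gamma> (\<iota> f) = \<iota> (psi_push G \<gamma> f)) \<and>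
    (\<forall>\<gamma>\<^sub>1\<in>bisections G. \<forall>\<gamma>\<^sub>2\<in>bisections G.
       \<forall>a\<in>corner G \<iota> (psi G (set_inv G \<gamma>\<^sub>2) ` (supp G \<gamma>\<^sub>1 \<inter> im G \<gamma>\<^sub>2)).
         \<alpha> \<gamma>\<^sub>1 (\<alpha> \<gamma>\<^sub>2 a) = \<alpha> (set_comp G \<gamma>\<^sub>1 \<gamma>\<^sub>2) a)"

text \<open>
  Equivariance of a unital completely positive map; it is only used for unital *-homomorphisms,
  which are completely positive.
\<close>

definition equivariant ::
  "'g groupoid \<Rightarrow> (('g \<Rightarrow> complex) \<Rightarrow> 'a::cstar_algebra) \<Rightarrow> ('g set \<Rightarrow> 'a \<Rightarrow> 'a) \<Rightarrow>
   (('g \<Rightarrow> complex) \<Rightarrow> 'b::cstar_algebra) \<Rightarrow> ('g set \<Rightarrow> 'b \<Rightarrow> 'b) \<Rightarrow> ('a \<Rightarrow> 'b) \<Rightarrow> bool"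
  where "equivariant G \<iota> \<alpha> \<kappa> \<beta> \<phi> \<longleftrightarrow>
    (\<forall>f\<in>C_unit G. \<phi> (\<iota> f) = \<kappa> f) \<and>
    (\<forall>\<gamma>\<in>bisections G. \<forall>a\<in>corner G \<iota> (supp G \<gamma>). \<phi> (\<alpha> \<gamma> a) = \<beta> \<gamma> (\<phi> a))"

text \<open>
  Equality of structures: values outside \<open>C_unit G\<close>, outside the domains of the partial maps
  \<open>\<alpha> \<gamma>\<close>, or at sets that are not open bisections, carry no information.
\<close>

definition same_structure ::
  "'g groupoid \<Rightarrow> (('g \<Rightarrow> complex) \<Rightarrow> 'a::cstar_algebra) \<Rightarrow> ('g set \<Rightarrow> 'a \<Rightarrow> 'a) \<Rightarrow>
   (('g \<Rightarrow> complex) \<Rightarrow> 'a) \<Rightarrow> ('g set \<Rightarrow> 'a \<Rightarrow> 'a) \<Rightarrow> bool"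
  where "same_structure G \<iota> \<alpha> \<kappa> \<beta> \<longleftrightarrow>
    (\<forall>f\<in>C_unit G. \<iota> f = \<kappa> f) \<and>
    (\<forall>\<gamma>\<in>bisections G. \<forall>a\<in>corner G \<iota> (supp G \<gamma>). \<alpha> \<gamma> a = \<beta> \<gamma> a)"

text \<open>
  The standard embedding of \<open>C_unit G\<close> into the maximal C*-algebra is the restriction of \<open>j\<close>.
\<close>

definition conjugation_structure ::
  "'g groupoid \<Rightarrow> (('g \<Rightarrow> complex) \<Rightarrow> 'c::cstar_algebra) \<Rightarrow> ('g set \<Rightarrow> 'c \<Rightarrow> 'c) \<Rightarrow> bool"
  where "conjugation_structure G j \<alpha> \<longleftrightarrow>
    G_cstar_algebra G j \<alpha> \<and>
    (\<forall>\<gamma>\<in>bisections G. \<forall>U\<in>bisections G. supp G U \<subseteq> supp G \<gamma> \<and> im G U \<subseteq> supp G \<gamma> \<longrightarrow>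
       (\<forall>f\<in>Cc G U. \<alpha> \<gamma> (j f) = j (conj_push G \<gamma> U f)))"

end

theory Submission
  imports Defs
begin

text \<open>
  Let \<open>\<rho>\<close> be a unital *-representation of the convolution algebra, such as \<open>j\<close> or \<open>\<pi> \<circ> j\<close>.  A function \<open>e\<close>
  with compact support in \<open>supp \<gamma>\<close> lifts along the source map to a function \<open>x\<^sub>e\<close> on \<open>\<gamma>\<close>, and
  \<open>\<alpha>\<^bsub>\<gamma>\<^esub> a\<close> is the limit of \<open>\<rho> x\<^sub>e * a * (\<rho> x\<^sub>e)*\<close> as \<open>e\<close> increases to the unit of \<open>C\<^sub>0 (supp \<gamma>)\<close>.  The
  expression is eventually constant for \<open>a\<close> in a dense part of the corner, where all identities are
  identities between functions, and it is contractive in \<open>a\<close>.  Uniqueness and equivariance hold on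
  a dense subspace of each corner and extend to the corner because *-homomorphisms are contractive.
  The universal property of \<open>j\<close> is needed only for its injectivity on the functions on the unit space,
  which the representation on the \<open>\<ell>\<^sup>2\<close>-space of the set of units detects.
\<close>

section \<open>Contractivity of *-homomorphisms\<close>

text \<open>Two obstacles shape the proof. Arrow spaces need not be Hausdorff, so elements of
  \<open>C_groupoid G\<close> need not be continuous; but each generator lives on one bisection and
  is the lift of a function on the compact Hausdorff unit space, and all topology is done there.
  Moreover, supp \<gamma> need not be compact: the constant 1 then has no lift in
  \<open>Cc G \<gamma>\<close>, and no single element is at hand that implements the conjugation.
  The substitutes satisfy x_e* x_e = e^2, which gives both the bound on x_e and multiplicativity in
  the limit. As supp \<gamma> need not be sigma-compact, the limit runs along a filter instead of a
  sequence. The composition law rests on one identity: the lift to \<gamma> of e' pushed along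
  \<delta>, times the lift of e to \<delta>, is the lift of e' e to the product \<gamma> \<delta>;
  with e' e = e this is x_e for the product. Contractivity is needed on corners, which may lack a
  unit. It is derived from the C*-identity and one fixed point, without spectral theory. On the
  target of \<pi>, equivariance forces the embedding to be \<pi> after j, and for surjective \<pi>
  the generators f b f' of a corner lift to the corner upstairs.\<close>

lemma scaleC_one [simp]: "1 *\<^sub>C (x::'a::cstar_algebra) = x"
  using scaleC_of_real[of 1 x] by simp

lemma scaleC_zero_left [simp]: "0 *\<^sub>C (x::'a::cstar_algebra) = 0"
  using scaleC_of_real[of 0 x] by simp

lemma scaleC_zero_right [simp]: "c *\<^sub>C (0::'a::cstar_algebra) = 0"
  using norm_scaleC[of c "0::'a"] by simp

lemma scaleC_minus_left: "(- c) *\<^sub>C (x::'a::cstar_algebra) = - (c *\<^sub>C x)"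
  using scaleC_add_left[of c "- c" x] by (simp add: eq_neg_iff_add_eq_0 add.commute)

lemma scaleC_minus_right: "c *\<^sub>C (- x::'a::cstar_algebra) = - (c *\<^sub>C x)"
  using scaleC_add_right[of c x "- x"] by (simp add: eq_neg_iff_add_eq_0 add.commute)

lemma scaleC_diff_right: "c *\<^sub>C (x - y::'a::cstar_algebra) = c *\<^sub>C x - c *\<^sub>C y"
  using scaleC_add_right[of c x "- y"] by (simp add: scaleC_minus_right)

lemma star_zero [simp]: "star (0::'a::cstar_algebra) = 0"
  using star_scaleC[of 0 "0::'a"] by simp

lemma star_minus: "star (- x::'a::cstar_algebra) = - star x"
  using star_scaleC[of "-1" x] by (simp add: scaleC_minus_left)

lemma star_diff: "star (x - y::'a::cstar_algebra) = star x - star y"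
  using star_add[of x "- y"] by (simp add: star_minus)

lemma star_scaleR: "star (t *\<^sub>R x::'a::cstar_algebra) = t *\<^sub>R star x"
  using star_scaleC[of "complex_of_real t" x] by (simp add: scaleC_of_real)

lemma star_one [simp]: "star (1::'a::cstar_algebra) = 1"
  using star_mult[of "star (1::'a)" 1] by (simp add: star_star)

text \<open>The C*-identity gives norm y ^ 2 <= norm (star y) * norm y; cancel, then use the result
  for both \<open>x\<close> and \<open>star x\<close>.\<close>

lemma norm_star [simp]: "norm (star x::'a::cstar_algebra) = norm x"
proof -
  have le: "norm y \<le> norm (star y)" for y :: 'a
  proof (cases "norm y = 0")
    case False
    have "norm y * norm y \<le> norm (star y) * norm y"
      using cstar_identity[of y] norm_mult_ineq[of "star y" y] by (simp add: power2_eq_square)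
    then show ?thesis using False by (simp add: mult_le_cancel_right)
  qed simp
  show ?thesis using le[of x] le[of "star x"] by (simp add: star_star)
qed

text \<open>By the C*-identity the norm of 1 equals its own square, so it is 0 or 1; the value 0
  occurs in the zero algebra.\<close>

lemma norm_one_le: "norm (1::'a::cstar_algebra) \<le> 1"
proof -
  have "norm (1::'a) = (norm (1::'a))\<^sup>2" using cstar_identity[of "1::'a"] by simp
  then have "norm (1::'a) * (norm (1::'a) - 1) = 0" by (simp add: power2_eq_square algebra_simps)
  then show ?thesis by auto
qed

lemma bounded_linear_star: "bounded_linear (star :: 'a::cstar_algebra \<Rightarrow> 'a)"
  by (rule bounded_linear_intro[where K = 1]) (auto simp: star_add star_scaleR)

lemma scaleC_scaleR: "c *\<^sub>C (t *\<^sub>R x) = t *\<^sub>R (c *\<^sub>C (x::'a::cstar_algebra))"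
  by (metis scaleC_of_real scaleC_scaleC mult.commute)

lemma bounded_linear_scaleC: "bounded_linear (scaleC c :: 'a::cstar_algebra \<Rightarrow> 'a)"
  by (rule bounded_linear_intro[where K = "cmod c"])
     (auto simp: scaleC_add_right scaleC_scaleR norm_scaleC mult.commute)

lemmas tendsto_star = bounded_linear.tendsto[OF bounded_linear_star]
lemmas tendsto_scaleC = bounded_linear.tendsto[OF bounded_linear_scaleC]

text \<open>No unit is demanded, since corners of open sets of units are non-unital in
  general.\<close>

definition closed_star_subalgebra :: "'a::cstar_algebra set \<Rightarrow> bool"
  where "closed_star_subalgebra S \<longleftrightarrow> closed S \<and> 0 \<in> S \<and> (\<forall>x\<in>S. \<forall>y\<in>S. x + y \<in> S \<and> x * y \<in> S) \<and>
    (\<forall>c. \<forall>x\<in>S. c *\<^sub>C x \<in> S) \<and> (\<forall>x\<in>S. star x \<in> S)"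

lemma closed_star_subalgebra_scaleR:
  "closed_star_subalgebra S \<Longrightarrow> x \<in> S \<Longrightarrow> t *\<^sub>R x \<in> S"
  by (metis closed_star_subalgebra_def scaleC_of_real)

lemma closed_star_subalgebra_diff:
  assumes "closed_star_subalgebra S" "x \<in> S" "y \<in> S" shows "x - y \<in> S"
  using assms closed_star_subalgebra_scaleR[of S y "-1"]
  by (metis closed_star_subalgebra_def scaleR_minus1_left uminus_add_conv_diff add.commute)

text \<open>The fixed point is \<open>k = 1 - sqrt (1 - h\<^sup>2)\<close>.\<close>

lemma closed_star_subalgebra_sqrt:
  fixes h :: "'a::cstar_algebra"
  assumes S: "closed_star_subalgebra S" and h: "h \<in> S" "star h = h" "norm h < 1"
  obtains k where "k \<in> S" "star k = k" "h * k = k * h" "h * h + k * k = k + k"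
proof -
  \<comment> \<open>A fixed point of \<open>T\<close> solves h h + k k = k + k. Self-adjointness and
    commutation with \<open>h\<close> are built into the complete set \<open>X\<close>, so the fixed
    point has them; the radius \<open>norm h\<close> makes \<open>norm h\<close> < 1 a contraction
    constant.\<close>
  define X where "X = S \<inter> {k. star k = k} \<inter> {k. h * k = k * h} \<inter> {k. norm k \<le> norm h}"
  define T where "T k = (1/2) *\<^sub>R (h * h + k * k)" for k
  have cont: "continuous_on UNIV (star :: 'a \<Rightarrow> 'a)"
    by (rule bounded_linear.continuous_on[OF bounded_linear_star continuous_on_id])
  have "closed X"
    unfolding X_def using S cont
    by (intro closed_Int closed_Collect_eq closed_Collect_le continuous_intros)
       (auto simp: closed_star_subalgebra_def)
  then have "complete X" by (simp add: complete_eq_closed)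
  moreover have "0 \<in> X" using S by (simp add: X_def closed_star_subalgebra_def)
  then have "X \<noteq> {}" by blast
  moreover have "T ` X \<subseteq> X"
  proof (rule image_subsetI)
    fix k assume k: "k \<in> X"
    have "norm (T k) \<le> (1/2) * (norm h * norm h + norm k * norm k)"
      unfolding T_def norm_scaleR
      using norm_triangle_mono[OF norm_mult_ineq[of h h] norm_mult_ineq[of k k]] by simp
    also have "\<dots> \<le> (1/2) * (norm h * 1 + norm h * 1)"
      using k h by (intro mult_left_mono add_mono mult_mono) (auto simp: X_def)
    finally have "norm (T k) \<le> norm h" by simp
    moreover have "T k \<in> S"
      using k h S unfolding T_def X_def
      by (intro closed_star_subalgebra_scaleR[OF S]) (auto simp: closed_star_subalgebra_def)
    moreover have "h * (k * k) = k * k * h"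
      using k unfolding X_def by (metis (mono_tags, lifting) IntD1 IntD2 mem_Collect_eq mult.assoc)
    then have "h * T k = T k * h" by (simp add: T_def algebra_simps)
    moreover have "star (T k) = T k"
      using k h by (auto simp: T_def X_def star_scaleR star_add star_mult)
    ultimately show "T k \<in> X" by (simp add: X_def)
  qed
  moreover have "dist (T x) (T y) \<le> norm h * dist x y" if xy: "x \<in> X" "y \<in> X" for x y
  proof -
    have "T x - T y = (1/2) *\<^sub>R (x * (x - y) + (x - y) * y)"
      by (simp add: T_def algebra_simps)
    then have "norm (T x - T y) \<le> (1/2) * (norm x * norm (x - y) + norm (x - y) * norm y)"
      using norm_triangle_mono[OF norm_mult_ineq[of x "x - y"] norm_mult_ineq[of "x - y" y]] by simp
    also have "\<dots> \<le> (1/2) * (norm h * norm (x - y) + norm (x - y) * norm h)"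
      using xy by (intro mult_left_mono add_mono mult_mono) (auto simp: X_def)
    finally show "dist (T x) (T y) \<le> norm h * dist x y" by (simp add: dist_norm)
  qed
  ultimately obtain k where k: "k \<in> X" "T k = k"
    using Banach_fix[of X "norm h" T] h(3) by auto
  have "k + k = 2 *\<^sub>R T k" using k(2) by (simp add: scaleR_2)
  then have "h * h + k * k = k + k" by (simp add: T_def)
  then show ?thesis using that k(1) by (auto simp: X_def)
qed

text \<open>\<open>h + i t\<close> is unitary and \<open>h\<close> is its real part.\<close>

lemma norm_le_1_of_sum_squares:
  fixes h t :: "'a::cstar_algebra"
  assumes "star h = h" "star t = t" "h * t = t * h" "h * h + t * t = 1"
  shows "norm h \<le> 1"
proof -
  define u where "u = h + \<i> *\<^sub>C t"
  have su: "star u = h - \<i> *\<^sub>C t"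
    using assms by (simp add: u_def star_add star_scaleC scaleC_minus_left)
  have "star u * u = h * h + t * t"
    unfolding su using assms(3)
    by (simp add: u_def algebra_simps mult_scaleC_left mult_scaleC_right scaleC_scaleC scaleC_minus_left
        scaleC_add_right scaleC_diff_right)
  then have "(norm u)\<^sup>2 \<le> 1\<^sup>2"
    using assms(4) cstar_identity[of u] norm_one_le[where ?'a='a] by simp
  then have "norm u \<le> 1" by (rule power2_le_imp_le) simp
  moreover have "u + star u = 2 *\<^sub>R h"
    unfolding su by (simp add: u_def scaleR_2)
  then have "h = (1/2) *\<^sub>R (u + star u)" by simp
  then have "norm h \<le> (1/2) * (norm u + norm (star u))"
    by (metis norm_scaleR norm_triangle_ineq abs_of_nonneg mult_left_mono zero_le_divide_1_iff zero_le_numeral)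
  ultimately show ?thesis by simp
qed

text \<open>The C*-identity reduces the claim to the self-adjoint element \<open>star x * x\<close>.
  A self-adjoint \<open>h\<close> of norm below 1 has a companion \<open>k\<close> in
  \<open>S\<close>, and the equation between them survives under \<open>\<phi>\<close> as a sum of
  two commuting squares equal to 1.\<close>

lemma star_hom_contractive:
  fixes \<phi> :: "'a::cstar_algebra \<Rightarrow> 'b::cstar_algebra"
  assumes S: "closed_star_subalgebra S" and \<phi>: "star_hom_on S (+) scaleC (*) star \<phi>" and x: "x \<in> S"
  shows "norm (\<phi> x) \<le> norm x"
proof -
  have add: "\<phi> (x + y) = \<phi> x + \<phi> y" and mult: "\<phi> (x * y) = \<phi> x * \<phi> y"
    if "x \<in> S" "y \<in> S" for x y using \<phi> that by (auto simp: star_hom_on_def)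
  have st: "\<phi> (star x) = star (\<phi> x)" and scl: "\<phi> (c *\<^sub>C x) = c *\<^sub>C \<phi> x" if "x \<in> S" for x c
    using \<phi> that by (auto simp: star_hom_on_def)
  have sclR: "\<phi> (t *\<^sub>R x) = t *\<^sub>R \<phi> x" if "x \<in> S" for x t
    by (metis scl scaleC_of_real that)
  have one: "norm (\<phi> h) \<le> 1" if h: "h \<in> S" "star h = h" "norm h < 1" for h
  proof -
    obtain k where k: "k \<in> S" "star k = k" "h * k = k * h" "h * h + k * k = k + k"
      using closed_star_subalgebra_sqrt[OF S h] .
    have "h * h \<in> S" "k * k \<in> S" using h k S by (auto simp: closed_star_subalgebra_def)
    then have "\<phi> h * \<phi> h + \<phi> k * \<phi> k = \<phi> (h * h + k * k)"
      using h(1) k(1) by (simp only: mult add)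
    also have "\<dots> = \<phi> k + \<phi> k" using k by (simp add: add)
    \<comment> \<open>\<open>S\<close> may lack a unit, so \<open>1 - k\<close> need not lie in it.
      This is why the square root is encoded by \<open>k\<close>; 1 is subtracted only in the target
      algebra.\<close>
    finally have sq: "\<phi> h * \<phi> h + (1 - \<phi> k) * (1 - \<phi> k) = 1" by (simp add: algebra_simps)
    have "\<phi> h * \<phi> k = \<phi> k * \<phi> h" using h k by (metis mult)
    then have "\<phi> h * (1 - \<phi> k) = (1 - \<phi> k) * \<phi> h" by (simp add: algebra_simps)
    moreover have "star (\<phi> h) = \<phi> h" using st[of h] h by simp
    moreover have "star (1 - \<phi> k) = 1 - \<phi> k" using st[of k] k by (simp add: star_diff)
    ultimately show ?thesis using sq by (blast intro: norm_le_1_of_sum_squares)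
  qed
  have selfadj: "norm (\<phi> h) \<le> norm h" if h: "h \<in> S" "star h = h" for h
  proof (rule dense_ge)
    \<comment> \<open>Scaling by \<open>1/r\<close> for every \<open>r\<close> above the norm yields
      the strict bound that \<open>one\<close> needs and covers h = 0 as well.\<close>
    fix r assume r: "norm h < r"
    then have r0: "r > 0" using norm_ge_zero[of h] by linarith
    have "norm (\<phi> ((1/r) *\<^sub>R h)) \<le> 1"
      using h r r0 by (intro one) (auto simp: star_scaleR closed_star_subalgebra_scaleR[OF S])
    then show "norm (\<phi> h) \<le> r" using r0 h by (simp add: sclR divide_simps)
  qed
  have "(norm (\<phi> x))\<^sup>2 = norm (\<phi> (star x * x))"
    using x S by (simp add: mult st cstar_identity closed_star_subalgebra_def)
  also have "\<dots> \<le> norm (star x * x)"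
    using x S by (intro selfadj) (auto simp: star_mult star_star closed_star_subalgebra_def)
  finally have "(norm (\<phi> x))\<^sup>2 \<le> (norm x)\<^sup>2" by (simp add: cstar_identity)
  then show ?thesis by (rule power2_le_imp_le) simp
qed

section \<open>Etale groupoids and bisections\<close>

lemma local_homeomorphism_imp_continuous_map:
  assumes "local_homeomorphism X Y f" shows "continuous_map X Y f"
proof (rule pasting_lemma[where I = "{U. openin X U \<and> continuous_map (subtopology X U) Y f}"
      and T = id and f = "\<lambda>_. f"])
  fix x assume "x \<in> topspace X"
  then obtain U where "openin X U" "x \<in> U"
    "homeomorphic_map (subtopology X U) (subtopology Y (f ` U)) f"
    using assms by (auto simp: local_homeomorphism_def)
  then show "\<exists>V. V \<in> {U. openin X U \<and> continuous_map (subtopology X U) Y f} \<and> x \<in> id V \<and> f x = f x"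
    using homeomorphic_imp_continuous_map continuous_map_into_fulltopology by fastforce
qed auto

lemma local_homeomorphism_imp_open_map:
  assumes "local_homeomorphism X Y f" shows "open_map X Y f"
  unfolding open_map_def
proof (intro allI impI)
  fix W assume W: "openin X W"
  show "openin Y (f ` W)"
  proof (subst openin_subopen, intro ballI)
    fix y assume "y \<in> f ` W"
    then obtain x where x: "x \<in> W" "y = f x" by blast
    then obtain U where U: "openin X U" "x \<in> U" "openin Y (f ` U)"
      "homeomorphic_map (subtopology X U) (subtopology Y (f ` U)) f"
      using assms openin_subset[OF W] unfolding local_homeomorphism_def by blast
    have "openin (subtopology X U) (W \<inter> U)" using W by (auto simp: openin_subtopology)
    then have "openin (subtopology Y (f ` U)) (f ` (W \<inter> U))"
      using homeomorphic_imp_open_map[OF U(4)] by (simp add: open_map_def)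
    then have "openin Y (f ` (W \<inter> U))" using U(3) openin_trans_full by blast
    then show "\<exists>T. openin Y T \<and> y \<in> T \<and> T \<subseteq> f ` W" using x U by blast
  qed
qed

lemma continuous_map_euclidean_compose2:
  assumes "continuous_map X euclidean f" "continuous_map X euclidean g"
    and "continuous_on UNIV (\<lambda>p. h (fst p) (snd p))"
  shows "continuous_map X euclidean (\<lambda>x. h (f x) (g x))"
proof -
  have "continuous_map X euclidean (\<lambda>x. (f x, g x))"
    using continuous_map_pairedI[OF assms(1,2)] by simp
  then have "continuous_map X euclidean ((\<lambda>p. h (fst p) (snd p)) \<circ> (\<lambda>x. (f x, g x)))"
    by (rule continuous_map_compose) (use assms(3) in simp)
  then show ?thesis by (simp add: o_def)
qed

text \<open>An open set missing 0 has its preimage inside \<open>V\<close>. An open set containing 0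
  contains a ball, and its preimage is the part in \<open>V\<close> together with the complement of
  a closed superlevel set. Those superlevel sets will be compact in every application.\<close>

lemma continuous_map_zero_extension:
  fixes f :: "'a \<Rightarrow> 'b::real_normed_vector"
  assumes V: "openin X V" and cont: "continuous_map (subtopology X V) euclidean f"
    and zero: "\<And>x. x \<notin> V \<Longrightarrow> f x = 0"
    and closed: "\<And>\<epsilon>. \<epsilon> > 0 \<Longrightarrow> closedin X {x \<in> topspace X. \<epsilon> \<le> norm (f x)}"
  shows "continuous_map X euclidean f"
  unfolding continuous_map
proof (intro conjI allI impI)
  fix W :: "'b set" assume W: "openin euclidean W"
  have "openin (subtopology X V) {x \<in> topspace (subtopology X V). f x \<in> W}"
    using cont W by (rule openin_continuous_map_preimage)
  then have "openin X {x \<in> topspace (subtopology X V). f x \<in> W}"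
    using V openin_trans_full by blast
  moreover have "topspace (subtopology X V) = V"
    using openin_subset[OF V] by (auto simp: topspace_subtopology)
  ultimately have o: "openin X {x \<in> V. f x \<in> W}" by (simp only:)
  show "openin X {x \<in> topspace X. f x \<in> W}"
  proof (cases "0 \<in> W")
    case False
    then have "{x \<in> topspace X. f x \<in> W} = {x \<in> V. f x \<in> W}"
      using zero openin_subset[OF V] by (metis (no_types, lifting) subsetD)
    then show ?thesis using o by simp
  next
    case True
    then obtain \<epsilon> where \<epsilon>: "\<epsilon> > 0" "ball 0 \<epsilon> \<subseteq> W" using W openE by auto
    have "{x \<in> topspace X. f x \<in> W}
        = {x \<in> V. f x \<in> W} \<union> (topspace X - {x \<in> topspace X. \<epsilon> \<le> norm (f x)})" (is "_ = ?R")
    proof (intro equalityI subsetI)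
      fix x assume "x \<in> {x \<in> topspace X. f x \<in> W}"
      then show "x \<in> ?R" using zero[of x] \<epsilon>(1) by (cases "x \<in> V") auto
    next
      fix x assume "x \<in> ?R"
      then show "x \<in> {x \<in> topspace X. f x \<in> W}"
        using \<epsilon>(2) openin_subset[OF V] by (auto simp: subset_iff)
    qed
    then show ?thesis using o closed[OF \<epsilon>(1)] by (simp add: openin_diff openin_Un)
  qed
qed auto

section \<open>Cancellation laws, the open unit space and bisections\<close>

context etale_groupoid begin

lemma composable_iff [simp]:
  "(g, h) \<in> composable G \<longleftrightarrow> g \<in> arrows G \<and> h \<in> arrows G \<and> rng G h = src G g"
  by (auto simp: composable_def)

lemma comp_closed' [simp]:
  "g \<in> arrows G \<Longrightarrow> h \<in> arrows G \<Longrightarrow> rng G h = src G g \<Longrightarrow> gcomp G g h \<in> arrows G"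
  by (simp add: comp_closed)

lemma src_comp' [simp]:
  "g \<in> arrows G \<Longrightarrow> h \<in> arrows G \<Longrightarrow> rng G h = src G g \<Longrightarrow> src G (gcomp G g h) = src G h"
  by (simp add: src_comp)

lemma rng_comp' [simp]:
  "g \<in> arrows G \<Longrightarrow> h \<in> arrows G \<Longrightarrow> rng G h = src G g \<Longrightarrow> rng G (gcomp G g h) = rng G g"
  by (simp add: rng_comp)

declare src_closed [simp] rng_closed [simp] ginv_closed [simp] src_ginv [simp] rng_ginv [simp]
  src_src [simp] rng_src [simp] src_rng [simp] rng_rng [simp] comp_src [simp] comp_rng [simp]

lemma units_subset_arrows: "units G \<subseteq> arrows G"
  by (auto simp: units_def)

lemma unitsD:
  assumes "x \<in> units G" shows "x \<in> arrows G" "src G x = x" "rng G x = x"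
  using assms by (auto simp: units_def)

lemma src_in_units [simp]: "g \<in> arrows G \<Longrightarrow> src G g \<in> units G"
  by (simp add: units_def)

lemma rng_in_units [simp]: "g \<in> arrows G \<Longrightarrow> rng G g \<in> units G"
  unfolding units_def using src_rng rng_closed by (metis imageI)

lemma ginv_ginv [simp]:
  assumes g: "g \<in> arrows G" shows "ginv G (ginv G g) = g"
proof -
  have "ginv G (ginv G g) = gcomp G (ginv G (ginv G g)) (gcomp G (ginv G g) g)"
    using g comp_src[of "ginv G (ginv G g)"] by (simp add: comp_ginv_left)
  also have "\<dots> = gcomp G (gcomp G (ginv G (ginv G g)) (ginv G g)) g"
    using g by (simp add: comp_assoc)
  also have "\<dots> = g" using g by (simp add: comp_ginv_left)
  finally show ?thesis .
qed

lemma comp_cancel_left [simp]: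
  assumes "g \<in> arrows G" "h \<in> arrows G" "rng G h = src G g"
  shows "gcomp G (ginv G g) (gcomp G g h) = h"
proof -
  have "gcomp G (ginv G g) (gcomp G g h) = gcomp G (gcomp G (ginv G g) g) h"
    using assms by (simp add: comp_assoc)
  also have "\<dots> = h" using assms comp_rng[of h] by (simp add: comp_ginv_left)
  finally show ?thesis .
qed

lemma comp_cancel_right [simp]:
  assumes "g \<in> arrows G" "h \<in> arrows G" "rng G h = src G g"
  shows "gcomp G (gcomp G g h) (ginv G h) = g"
  using assms comp_src[of g] by (simp add: comp_assoc comp_ginv_right)

lemma comp_ginv_cancel_left:
  assumes "g \<in> arrows G" "h \<in> arrows G" "rng G h = rng G g"
  shows "gcomp G g (gcomp G (ginv G g) h) = h"
  using comp_cancel_left[of "ginv G g" h] assms by simp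

lemma comp_ginv_cancel_right:
  assumes "g \<in> arrows G" "h \<in> arrows G" "src G g = src G h"
  shows "gcomp G (gcomp G g (ginv G h)) h = g"
  using comp_cancel_right[of g "ginv G h"] assms by simp

lemma continuous_src: "continuous_map (gtop G) (unit_space G) (src G)"
  by (rule local_homeomorphism_imp_continuous_map[OF src_local_homeomorphism])

lemma continuous_rng: "continuous_map (gtop G) (unit_space G) (rng G)"
  by (rule local_homeomorphism_imp_continuous_map[OF rng_local_homeomorphism])

lemma open_src: "open_map (gtop G) (unit_space G) (src G)"
  by (rule local_homeomorphism_imp_open_map[OF src_local_homeomorphism])

lemma open_rng: "open_map (gtop G) (unit_space G) (rng G)"
  by (rule local_homeomorphism_imp_open_map[OF rng_local_homeomorphism])

lemma topspace_unit_space [simp]: "topspace (unit_space G) = units G"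
  using units_subset_arrows by auto

lemma arrows_Int_units [simp]: "arrows G \<inter> units G = units G"
  using units_subset_arrows by auto

text \<open>Take a neighbourhood \<open>U\<close> of a unit on which \<open>src\<close> is
  injective. If both \<open>g\<close> and \<open>src G g\<close> lie in \<open>U\<close>, they have
  the same source and therefore coincide, so \<open>g\<close> is a unit.\<close>

lemma open_units: "openin (gtop G) (units G)"
proof (subst openin_subopen, intro ballI)
  fix x assume x: "x \<in> units G"
  then obtain U where U: "openin (gtop G) U" "x \<in> U"
    "homeomorphic_map (subtopology (gtop G) U) (subtopology (unit_space G) (src G ` U)) (src G)"
    using src_local_homeomorphism unitsD(1)[OF x] unfolding local_homeomorphism_def by blast
  have U_arr: "U \<subseteq> arrows G" using U(1) openin_subset by auto
  have inj: "inj_on (src G) U"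
    using homeomorphic_imp_injective_map[OF U(3)] U_arr by (simp add: Int_absorb1)
  have "openin (gtop G) {g \<in> arrows G. src G g \<in> U}"
    using continuous_map_into_fulltopology[OF continuous_src] U(1)
    by (rule openin_continuous_map_preimage)
  then have "openin (gtop G) (U \<inter> {g \<in> arrows G. src G g \<in> U})" using U(1) by (simp add: openin_Int)
  moreover have "U \<inter> {g \<in> arrows G. src G g \<in> U} \<subseteq> units G"
  proof
    fix g assume g: "g \<in> U \<inter> {g \<in> arrows G. src G g \<in> U}"
    then have "src G g = g" using inj_onD[OF inj, of "src G g" g] by simp
    then show "g \<in> units G" using g src_in_units[of g] by simp
  qed
  moreover have "x \<in> U \<inter> {g \<in> arrows G. src G g \<in> U}" using x U(2) unitsD[OF x] by simp
  ultimately show "\<exists>T. openin (gtop G) T \<and> x \<in> T \<and> T \<subseteq> units G" by blast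
qed

lemma openin_unit_space: "openin (unit_space G) V \<longleftrightarrow> openin (gtop G) V \<and> V \<subseteq> units G"
  using open_units by (rule openin_open_subtopology)

text \<open>Source and range are continuous and open everywhere, so on an open set injectivity alone
  makes them homeomorphisms onto their images.\<close>

lemma bisections_iff:
  "\<gamma> \<in> bisections G \<longleftrightarrow> openin (gtop G) \<gamma> \<and> inj_on (src G) \<gamma> \<and> inj_on (rng G) \<gamma>"
proof
  assume g: "\<gamma> \<in> bisections G"
  then have "\<gamma> \<subseteq> arrows G" by (auto simp: bisections_def openin_subset)
  then show "openin (gtop G) \<gamma> \<and> inj_on (src G) \<gamma> \<and> inj_on (rng G) \<gamma>"
    using g homeomorphic_imp_injective_map unfolding bisections_def
    by (fastforce simp: Int_absorb1)
next
  assume g: "openin (gtop G) \<gamma> \<and> inj_on (src G) \<gamma> \<and> inj_on (rng G) \<gamma>"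
  then have g_arr: "\<gamma> \<subseteq> arrows G" by (auto simp: openin_subset)
  have *: "homeomorphic_map (subtopology (gtop G) \<gamma>) (subtopology (unit_space G) (f ` \<gamma>)) f"
    if "continuous_map (gtop G) (unit_space G) f" "open_map (gtop G) (unit_space G) f" "inj_on f \<gamma>"
      "f ` \<gamma> \<subseteq> units G" for f
  proof (rule bijective_open_imp_homeomorphic_map)
    have t: "topspace (subtopology (gtop G) \<gamma>) = \<gamma>" using g_arr by auto
    show "continuous_map (subtopology (gtop G) \<gamma>) (subtopology (unit_space G) (f ` \<gamma>)) f"
      by (rule continuous_map_into_subtopology[OF continuous_map_from_subtopology[OF that(1)]])
         (use t in auto)
    show "open_map (subtopology (gtop G) \<gamma>) (subtopology (unit_space G) (f ` \<gamma>)) f"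
      by (rule open_map_into_subtopology[OF open_map_from_subtopology[OF that(2)]]) (use g t in auto)
    show "f ` topspace (subtopology (gtop G) \<gamma>) = topspace (subtopology (unit_space G) (f ` \<gamma>))"
      unfolding t using that(4) units_subset_arrows by auto
    show "inj_on f (topspace (subtopology (gtop G) \<gamma>))" unfolding t by (rule that(3))
  qed
  have "src G ` \<gamma> \<subseteq> units G" "rng G ` \<gamma> \<subseteq> units G" using g_arr by auto
  then show "\<gamma> \<in> bisections G"
    using g *[OF continuous_src open_src] *[OF continuous_rng open_rng] by (simp add: bisections_def)
qed

lemma bisectionD:
  assumes "\<gamma> \<in> bisections G"
  shows "openin (gtop G) \<gamma>" "\<gamma> \<subseteq> arrows G" "inj_on (src G) \<gamma>" "inj_on (rng G) \<gamma>"
    "openin (unit_space G) (supp G \<gamma>)" "openin (unit_space G) (im G \<gamma>)"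
    "supp G \<gamma> \<subseteq> units G" "im G \<gamma> \<subseteq> units G"
proof -
  show *: "openin (gtop G) \<gamma>" "inj_on (src G) \<gamma>" "inj_on (rng G) \<gamma>"
    using assms by (auto simp: bisections_iff)
  then show arr: "\<gamma> \<subseteq> arrows G" by (simp add: openin_subset)
  show "openin (unit_space G) (supp G \<gamma>)" "openin (unit_space G) (im G \<gamma>)"
    using * open_src open_rng by (auto simp: open_map_def)
  show "supp G \<gamma> \<subseteq> units G" "im G \<gamma> \<subseteq> units G" using arr by auto
qed

lemma bisection_src_inv: "\<gamma> \<in> bisections G \<Longrightarrow> g \<in> \<gamma> \<Longrightarrow> inv_into \<gamma> (src G) (src G g) = g"
  by (simp add: bisectionD(3))

lemma bisection_rng_inv: "\<gamma> \<in> bisections G \<Longrightarrow> g \<in> \<gamma> \<Longrightarrow> inv_into \<gamma> (rng G) (rng G g) = g"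
  by (simp add: bisectionD(4))

lemma src_eq_in_bisection: "\<gamma> \<in> bisections G \<Longrightarrow> g \<in> \<gamma> \<Longrightarrow> h \<in> \<gamma> \<Longrightarrow> src G g = src G h \<Longrightarrow> g = h"
  using bisectionD(3) inj_onD by metis

lemma rng_eq_in_bisection: "\<gamma> \<in> bisections G \<Longrightarrow> g \<in> \<gamma> \<Longrightarrow> h \<in> \<gamma> \<Longrightarrow> rng G g = rng G h \<Longrightarrow> g = h"
  using bisectionD(4) inj_onD by metis

text \<open>Open sets of units are bisections acting trivially; in this way functions on the units
  fall under the results for \<open>Cc G U\<close>.\<close>

lemma open_units_bisection:
  assumes "openin (unit_space G) V"
  shows "V \<in> bisections G" "supp G V = V" "im G V = V"
proof -
  have V: "openin (gtop G) V" "V \<subseteq> units G" using assms by (auto simp: openin_unit_space)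
  have *: "x \<in> V \<Longrightarrow> src G x = x \<and> rng G x = x" for x using V(2) unitsD by blast
  then show "supp G V = V" "im G V = V" by force+
  show "V \<in> bisections G" using V(1) * by (auto simp: bisections_iff intro!: inj_onI)
qed

text \<open>The preimage of \<open>W\<close> under the inverse of \<open>f\<close> on
  \<open>\<gamma>\<close> is the image of \<gamma> \<inter> W under \<open>f\<close>, which is
  open.\<close>

lemma continuous_inv_into_open_map:
  assumes cont: "open_map (gtop G) (unit_space G) f" and \<gamma>: "openin (gtop G) \<gamma>" "inj_on f \<gamma>" "f ` \<gamma> \<subseteq> units G"
  shows "continuous_map (subtopology (unit_space G) (f ` \<gamma>)) (gtop G) (inv_into \<gamma> f)"
  unfolding continuous_map
proof (intro conjI allI impI)
  show "inv_into \<gamma> f ` topspace (subtopology (unit_space G) (f ` \<gamma>)) \<subseteq> arrows G"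
    using openin_subset[OF \<gamma>(1)] inv_into_into[of _ f \<gamma>] by auto
  fix W assume W: "openin (gtop G) W"
  have "openin (unit_space G) (f ` (\<gamma> \<inter> W))"
    using cont W \<gamma>(1) by (simp add: open_map_def openin_Int)
  then have "openin (subtopology (unit_space G) (f ` \<gamma>)) (f ` (\<gamma> \<inter> W))"
    by (auto simp: openin_subtopology)
  moreover have "{x \<in> topspace (subtopology (unit_space G) (f ` \<gamma>)). inv_into \<gamma> f x \<in> W} = f ` (\<gamma> \<inter> W)"
    using \<gamma>(2,3) units_subset_arrows by (auto simp: image_iff)
  ultimately show "openin (subtopology (unit_space G) (f ` \<gamma>))
      {x \<in> topspace (subtopology (unit_space G) (f ` \<gamma>)). inv_into \<gamma> f x \<in> W}" by simp
qed

lemma continuous_src_inv: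
  "\<gamma> \<in> bisections G \<Longrightarrow>
    continuous_map (subtopology (unit_space G) (supp G \<gamma>)) (gtop G) (inv_into \<gamma> (src G))"
  by (intro continuous_inv_into_open_map open_src bisectionD)

lemma continuous_rng_inv:
  "\<gamma> \<in> bisections G \<Longrightarrow>
    continuous_map (subtopology (unit_space G) (im G \<gamma>)) (gtop G) (inv_into \<gamma> (rng G))"
  by (intro continuous_inv_into_open_map open_rng bisectionD)

section \<open>Inverses and products of bisections\<close>

lemma set_inv_bisection:
  assumes "\<gamma> \<in> bisections G"
  shows "set_inv G \<gamma> \<in> bisections G" "supp G (set_inv G \<gamma>) = im G \<gamma>" "im G (set_inv G \<gamma>) = supp G \<gamma>"
proof -
  note \<gamma> = bisectionD[OF assms]
  have "set_inv G \<gamma> = {g \<in> arrows G. ginv G g \<in> \<gamma>}"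
    using \<gamma>(2) by (force simp: set_inv_def image_iff)
  then have "openin (gtop G) (set_inv G \<gamma>)"
    using openin_continuous_map_preimage[OF continuous_ginv \<gamma>(1)] by simp
  moreover have "inj_on (src G) (set_inv G \<gamma>)" "inj_on (rng G) (set_inv G \<gamma>)"
    unfolding set_inv_def using \<gamma>(2-4) by (auto simp: subset_iff intro!: inj_onI dest: inj_onD)
  ultimately show "set_inv G \<gamma> \<in> bisections G" by (simp add: bisections_iff)
  show "supp G (set_inv G \<gamma>) = im G \<gamma>" "im G (set_inv G \<gamma>) = supp G \<gamma>"
    using \<gamma>(2) by (force simp: set_inv_def image_iff)+
qed

lemma set_compI:
  "g \<in> \<gamma> \<Longrightarrow> h \<in> \<delta> \<Longrightarrow> rng G h = src G g \<Longrightarrow> gcomp G g h \<in> set_comp G \<gamma> \<delta>"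
  by (auto simp: set_comp_def)

lemma set_compE:
  assumes "\<gamma> \<in> bisections G" "\<delta> \<in> bisections G" "x \<in> set_comp G \<gamma> \<delta>"
  obtains g h where "x = gcomp G g h" "g \<in> \<gamma>" "h \<in> \<delta>" "rng G h = src G g" "g \<in> arrows G" "h \<in> arrows G"
    "src G x = src G h" "rng G x = rng G g" "x \<in> arrows G"
  using assms bisectionD(2)[OF assms(1)] bisectionD(2)[OF assms(2)]
  by (fastforce simp: set_comp_def subset_iff)

text \<open>\<open>x\<close> lies in \<open>\<gamma> \<delta>\<close> iff \<open>u\<inverse> x\<close> lies in \<open>\<delta>\<close>, where \<open>u\<close> is the arrow of \<open>\<gamma>\<close> with the range of \<open>x\<close>.\<close>

lemma open_set_comp:
  assumes g: "\<gamma> \<in> bisections G" and d: "\<delta> \<in> bisections G"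
  shows "openin (gtop G) (set_comp G \<gamma> \<delta>)"
proof -
  define D where "D = {x \<in> arrows G. rng G x \<in> im G \<gamma>}"
  define u where "u x = inv_into \<gamma> (rng G) (rng G x)" for x
  have D: "openin (gtop G) D"
    unfolding D_def by (rule openin_continuous_map_preimage[OF continuous_rng bisectionD(6)[OF g]])
  have tD: "topspace (subtopology (gtop G) D) = D" by (auto simp: D_def)
  have u: "u x \<in> \<gamma>" "rng G (u x) = rng G x" "u x \<in> arrows G" if "x \<in> D" for x
    using that bisection_rng_inv[OF g] bisectionD(2)[OF g] by (auto simp: D_def u_def)
  have "continuous_map (subtopology (gtop G) D) (gtop G) (inv_into \<gamma> (rng G) \<circ> rng G)"
    using continuous_rng unfolding D_def
    by (intro continuous_map_compose[OF _ continuous_rng_inv[OF g]] continuous_map_into_subtopology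
        continuous_map_from_subtopology[OF continuous_rng]) auto
  then have "continuous_map (subtopology (gtop G) D) (gtop G) u" by (simp add: u_def[abs_def] o_def)
  then have cinv: "continuous_map (subtopology (gtop G) D) (gtop G) (\<lambda>x. ginv G (u x))"
    using continuous_map_compose[OF _ continuous_ginv] by (fastforce simp: o_def)
  have "continuous_map (subtopology (gtop G) D)
      (subtopology (prod_topology (gtop G) (gtop G)) (composable G)) (\<lambda>x. (ginv G (u x), x))"
    using u cinv by (intro continuous_map_into_subtopology continuous_map_pairedI) (auto simp: D_def)
  then have "continuous_map (subtopology (gtop G) D) (gtop G)
      ((\<lambda>(g, h). gcomp G g h) \<circ> (\<lambda>x. (ginv G (u x), x)))"
    by (rule continuous_map_compose[OF _ continuous_comp])
  then have c: "continuous_map (subtopology (gtop G) D) (gtop G) (\<lambda>x. gcomp G (ginv G (u x)) x)"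
    by (simp add: o_def)
  have "openin (subtopology (gtop G) D) {x \<in> topspace (subtopology (gtop G) D). gcomp G (ginv G (u x)) x \<in> \<delta>}"
    by (rule openin_continuous_map_preimage[OF c bisectionD(1)[OF d]])
  then have "openin (gtop G) {x \<in> D. gcomp G (ginv G (u x)) x \<in> \<delta>}"
    using D openin_trans_full unfolding tD by blast
  moreover have "{x \<in> D. gcomp G (ginv G (u x)) x \<in> \<delta>} = set_comp G \<gamma> \<delta>"
  proof (intro equalityI subsetI)
    fix x assume "x \<in> {x \<in> D. gcomp G (ginv G (u x)) x \<in> \<delta>}"
    then have x: "x \<in> D" "gcomp G (ginv G (u x)) x \<in> \<delta>" "x \<in> arrows G" by (auto simp: D_def)
    have "gcomp G (u x) (gcomp G (ginv G (u x)) x) = x"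
      using u[OF x(1)] x by (simp add: comp_ginv_cancel_left)
    then show "x \<in> set_comp G \<gamma> \<delta>"
      using set_compI[OF u(1)[OF x(1)] x(2)] u[OF x(1)] x by simp
  next
    fix x assume "x \<in> set_comp G \<gamma> \<delta>"
    then obtain g' h where *: "x = gcomp G g' h" "g' \<in> \<gamma>" "h \<in> \<delta>" "rng G h = src G g'"
      "g' \<in> arrows G" "h \<in> arrows G" "rng G x = rng G g'" "x \<in> arrows G"
      using set_compE[OF g d] by metis
    then have "u x = g'" using bisection_rng_inv[OF g] by (simp add: u_def)
    then show "x \<in> {x \<in> D. gcomp G (ginv G (u x)) x \<in> \<delta>}" using * by (auto simp: D_def)
  qed
  ultimately show ?thesis by simp
qed

text \<open>The source of a product g h determines h in \<open>\<delta>\<close>, and then g in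
  \<open>\<gamma>\<close> through src g = rng h; ranges work in the opposite order.\<close>

lemma set_comp_bisection:
  assumes g: "\<gamma> \<in> bisections G" and d: "\<delta> \<in> bisections G"
  shows "set_comp G \<gamma> \<delta> \<in> bisections G"
proof -
  have "inj_on (src G) (set_comp G \<gamma> \<delta>)"
  proof (rule inj_onI)
    fix x y assume "x \<in> set_comp G \<gamma> \<delta>" "y \<in> set_comp G \<gamma> \<delta>" "src G x = src G y"
    then show "x = y"
      by (elim set_compE[OF g d]) (metis src_eq_in_bisection[OF g] src_eq_in_bisection[OF d])
  qed
  moreover have "inj_on (rng G) (set_comp G \<gamma> \<delta>)"
  proof (rule inj_onI)
    fix x y assume "x \<in> set_comp G \<gamma> \<delta>" "y \<in> set_comp G \<gamma> \<delta>" "rng G x = rng G y"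
    then show "x = y"
      by (elim set_compE[OF g d]) (metis rng_eq_in_bisection[OF g] rng_eq_in_bisection[OF d])
  qed
  ultimately show ?thesis using open_set_comp[OF g d] by (simp add: bisections_iff)
qed

lemma psi_set_inv:
  assumes "\<gamma> \<in> bisections G" "g \<in> \<gamma>" shows "psi G (set_inv G \<gamma>) (rng G g) = src G g"
proof -
  have arr: "g \<in> arrows G" using assms bisectionD(2) by blast
  have "ginv G g \<in> set_inv G \<gamma>" using assms(2) by (simp add: set_inv_def)
  then have "inv_into (set_inv G \<gamma>) (src G) (src G (ginv G g)) = ginv G g"
    using assms(1) set_inv_bisection(1) bisection_src_inv by blast
  then show ?thesis using arr by (simp add: psi_def)
qed

text \<open>Identifies the domain written out in the composition axiom of a G-C*-algebra with the
  support of the product bisection.\<close>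

lemma supp_set_comp:
  assumes g: "\<gamma> \<in> bisections G" and d: "\<delta> \<in> bisections G"
  shows "supp G (set_comp G \<gamma> \<delta>) = psi G (set_inv G \<delta>) ` (supp G \<gamma> \<inter> im G \<delta>)"
proof (intro equalityI subsetI)
  fix x assume "x \<in> supp G (set_comp G \<gamma> \<delta>)"
  then obtain g' h where "g' \<in> \<gamma>" "h \<in> \<delta>" "rng G h = src G g'" "x = src G h"
    by (auto elim!: set_compE[OF g d])
  then show "x \<in> psi G (set_inv G \<delta>) ` (supp G \<gamma> \<inter> im G \<delta>)"
    using psi_set_inv[OF d, of h] by (metis Int_iff imageI)
next
  fix x assume "x \<in> psi G (set_inv G \<delta>) ` (supp G \<gamma> \<inter> im G \<delta>)"
  then obtain g' h where *: "g' \<in> \<gamma>" "h \<in> \<delta>" "rng G h = src G g'" "x = psi G (set_inv G \<delta>) (rng G h)"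
    by force
  then have "x = src G h" using psi_set_inv[OF d *(2)] by simp
  moreover have "src G (gcomp G g' h) = src G h"
    using * bisectionD(2)[OF g] bisectionD(2)[OF d] by (intro src_comp') auto
  ultimately show "x \<in> supp G (set_comp G \<gamma> \<delta>)" using set_compI[OF *(1-3)] by (metis imageI)
qed

lemma supp_set_comp_subset:
  assumes "\<gamma> \<in> bisections G" "\<delta> \<in> bisections G" shows "supp G (set_comp G \<gamma> \<delta>) \<subseteq> supp G \<delta>"
  by (auto elim!: set_compE[OF assms])

lemma im_set_comp_subset:
  assumes "\<gamma> \<in> bisections G" "\<delta> \<in> bisections G" shows "im G (set_comp G \<gamma> \<delta>) \<subseteq> im G \<gamma>"
  by (auto elim!: set_compE[OF assms])

text \<open>Arrows of \<open>\<gamma>\<close> with equal ranges coincide, so every product that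
  occurs is of the form ginv g times g, a unit.\<close>

lemma set_comp_set_inv_left:
  assumes g: "\<gamma> \<in> bisections G" shows "set_comp G (set_inv G \<gamma>) \<gamma> = supp G \<gamma>"
proof (intro equalityI subsetI)
  fix x assume "x \<in> set_comp G (set_inv G \<gamma>) \<gamma>"
  then obtain g' h where *: "x = gcomp G (ginv G g') h" "g' \<in> \<gamma>" "h \<in> \<gamma>" "rng G h = rng G g'"
    using bisectionD(2)[OF g] by (auto simp: set_comp_def set_inv_def subset_iff)
  then have "g' = h" using rng_eq_in_bisection[OF g] by metis
  then show "x \<in> supp G \<gamma>" using * bisectionD(2)[OF g] by (auto simp: comp_ginv_left subset_iff)
next
  fix x assume "x \<in> supp G \<gamma>"
  then obtain h where h: "h \<in> \<gamma>" "x = src G h" "h \<in> arrows G" using bisectionD(2)[OF g] by auto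
  then show "x \<in> set_comp G (set_inv G \<gamma>) \<gamma>"
    using set_compI[of "ginv G h" "set_inv G \<gamma>" h \<gamma>] by (simp add: comp_ginv_left set_inv_def)
qed

lemma set_inv_set_inv: "\<gamma> \<in> bisections G \<Longrightarrow> set_inv G (set_inv G \<gamma>) = \<gamma>"
  using bisectionD(2)[of \<gamma>] by (force simp: set_inv_def image_image subset_iff image_iff)

lemma set_comp_set_inv_right:
  assumes g: "\<gamma> \<in> bisections G" shows "set_comp G \<gamma> (set_inv G \<gamma>) = im G \<gamma>"
  using set_comp_set_inv_left[OF set_inv_bisection(1)[OF g]] set_inv_set_inv[OF g]
    set_inv_bisection(2)[OF g] by simp

lemma set_comp_units_left:
  assumes g: "\<gamma> \<in> bisections G" and V: "openin (unit_space G) V"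
  shows "set_comp G V \<gamma> = {h \<in> \<gamma>. rng G h \<in> V}"
proof (intro equalityI subsetI)
  have Vu: "V \<subseteq> units G" using V(1) by (simp add: openin_unit_space)
  {
    fix x assume "x \<in> set_comp G V \<gamma>"
    then obtain v h where *: "x = gcomp G v h" "v \<in> V" "h \<in> \<gamma>" "rng G h = src G v"
      by (auto simp: set_comp_def)
    then have "rng G h = v" using Vu unitsD(2) by auto
    then show "x \<in> {h \<in> \<gamma>. rng G h \<in> V}" using * bisectionD(2)[OF g] comp_rng[of h] by auto
  next
    fix x assume "x \<in> {h \<in> \<gamma>. rng G h \<in> V}"
    then show "x \<in> set_comp G V \<gamma>"
      using set_compI[of "rng G x" V x \<gamma>] bisectionD(2)[OF g] by (auto simp: subset_iff)
  }
qed

lemma set_comp_units_right: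
  assumes g: "\<gamma> \<in> bisections G" and V: "openin (unit_space G) V"
  shows "set_comp G \<gamma> V = {h \<in> \<gamma>. src G h \<in> V}"
proof (intro equalityI subsetI)
  have Vu: "V \<subseteq> units G" using V(1) by (simp add: openin_unit_space)
  {
    fix x assume "x \<in> set_comp G \<gamma> V"
    then obtain v h where *: "x = gcomp G h v" "v \<in> V" "h \<in> \<gamma>" "rng G v = src G h"
      by (auto simp: set_comp_def)
    then have "src G h = v" using Vu unitsD(3) by auto
    then show "x \<in> {h \<in> \<gamma>. src G h \<in> V}" using * bisectionD(2)[OF g] comp_src[of h] by auto
  next
    fix x assume "x \<in> {h \<in> \<gamma>. src G h \<in> V}"
    then show "x \<in> set_comp G \<gamma> V"
      using set_compI[of x \<gamma> "src G x" V] bisectionD(2)[OF g] by (auto simp: subset_iff)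
  }
qed

end

section \<open>Function spaces\<close>

text \<open>By \<open>Cc_eq_src_lift\<close> these lifts exhaust \<open>Cc G \<gamma>\<close> as
  \<open>k\<close> runs through \<open>Cc G (supp G \<gamma>)\<close>. Convolution and involution
  thus become operations on functions on the units.\<close>

definition src_lift :: "'g groupoid \<Rightarrow> 'g set \<Rightarrow> ('g \<Rightarrow> complex) \<Rightarrow> 'g \<Rightarrow> complex"
  where "src_lift G \<gamma> k = (\<lambda>g. if g \<in> \<gamma> then k (src G g) else 0)"

text \<open>\<open>K\<close> is the set where the value 1 is prescribed, so a larger
  \<open>K\<close> gives fewer cutoffs and \<open>cutoffs G V {}\<close> contains all of
  them.\<close>

definition cutoffs :: "'g groupoid \<Rightarrow> 'g set \<Rightarrow> 'g set \<Rightarrow> ('g \<Rightarrow> complex) set"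
  where "cutoffs G V K = {e \<in> Cc G V. (\<forall>x. e x \<in> complex_of_real ` {0..1}) \<and> (\<forall>x\<in>K. e x = 1)}"

locale compact_etale_groupoid = etale_groupoid G for G :: "'g groupoid" +
  assumes compact_units: "compact_space (unit_space G)"
    and Hausdorff_units: "Hausdorff_space (unit_space G)"
begin

section \<open>Continuous functions on the compact unit space\<close>

lemma C_unit_compose2:
  assumes "f \<in> C_unit G" "f' \<in> C_unit G" "continuous_on UNIV (\<lambda>p. h (fst p) (snd p))"
  shows "(\<lambda>x. if x \<in> units G then h (f x) (f' x) else 0) \<in> C_unit G"
proof -
  have "continuous_map (unit_space G) euclidean (\<lambda>x. h (f x) (f' x))"
    by (rule continuous_map_euclidean_compose2) (use assms in \<open>auto simp: C_unit_def\<close>)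
  then have "continuous_map (unit_space G) euclidean (\<lambda>x. if x \<in> units G then h (f x) (f' x) else 0)"
    by (rule continuous_map_eq) simp
  then show ?thesis by (simp add: C_unit_def)
qed

text \<open>The case distinction restores the extension by zero when \<open>h 0\<close> is nonzero,
  as for the square root of 1 - t^2.\<close>

lemma C_unit_compose:
  assumes "f \<in> C_unit G" "continuous_on UNIV h"
  shows "(\<lambda>x. if x \<in> units G then h (f x) else 0) \<in> C_unit G"
proof (rule C_unit_compose2[OF assms(1) assms(1), of "\<lambda>x _. h x"])
  show "continuous_on UNIV (\<lambda>p :: complex \<times> complex. h (fst p))"
    using continuous_on_compose2[OF assms(2) continuous_on_fst[OF continuous_on_id]] by simp
qed

lemma C_unit_zero: "f \<in> C_unit G \<Longrightarrow> x \<notin> units G \<Longrightarrow> f x = 0"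
  by (simp add: C_unit_def)

lemma C_unit_add: "f \<in> C_unit G \<Longrightarrow> f' \<in> C_unit G \<Longrightarrow> (\<lambda>x. f x + f' x) \<in> C_unit G"
  using C_unit_compose2[of f f' "(+)"]
  by (rule back_subst[where P = "\<lambda>f. f \<in> C_unit G"])
     (auto intro!: continuous_intros simp: C_unit_zero fun_eq_iff)

lemma C_unit_mult: "f \<in> C_unit G \<Longrightarrow> f' \<in> C_unit G \<Longrightarrow> (\<lambda>x. f x * f' x) \<in> C_unit G"
  using C_unit_compose2[of f f' "(*)"]
  by (rule back_subst[where P = "\<lambda>f. f \<in> C_unit G"])
     (auto intro!: continuous_intros simp: C_unit_zero fun_eq_iff)

lemma C_unit_scale: "f \<in> C_unit G \<Longrightarrow> (\<lambda>x. c * f x) \<in> C_unit G"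
  using C_unit_compose[of f "\<lambda>z. c * z"]
  by (rule back_subst[where P = "\<lambda>f. f \<in> C_unit G"])
     (auto intro!: continuous_intros simp: C_unit_zero fun_eq_iff)

lemma C_unit_diff: "f \<in> C_unit G \<Longrightarrow> f' \<in> C_unit G \<Longrightarrow> (\<lambda>x. f x - f' x) \<in> C_unit G"
  using C_unit_add[of f "\<lambda>x. - 1 * f' x"] C_unit_scale[of f' "-1"] by simp

lemma C_unit_cnj: "f \<in> C_unit G \<Longrightarrow> (\<lambda>x. cnj (f x)) \<in> C_unit G"
  using C_unit_compose[of f cnj]
  by (rule back_subst[where P = "\<lambda>f. f \<in> C_unit G"])
     (auto intro!: continuous_intros simp: C_unit_zero fun_eq_iff)

lemma C_unit_indicator: "indicator (units G) \<in> C_unit G"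
proof -
  have "continuous_map (unit_space G) euclidean (\<lambda>x. 1 :: complex)" by simp
  then have "continuous_map (unit_space G) euclidean (indicator (units G) :: 'g \<Rightarrow> complex)"
    by (rule continuous_map_eq) simp
  then show ?thesis by (simp add: C_unit_def)
qed

lemma compactin_units: "compactin (unit_space G) (units G)"
  using compact_units unfolding compact_space_def topspace_unit_space .

lemma C_unit_bounded:
  assumes "f \<in> C_unit G"
  obtains M where "\<And>x. norm (f x) \<le> M" "M > 0"
proof -
  have "compactin euclidean (f ` units G)"
    using assms image_compactin[OF compactin_units, of euclidean f] by (simp add: C_unit_def)
  then have "bounded (f ` units G)" by (simp add: compact_imp_bounded)
  then obtain M where M: "M > 0" "\<And>x. x \<in> units G \<Longrightarrow> norm (f x) \<le> M" by (auto simp: bounded_pos)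
  show ?thesis
  proof (rule that)
    show "norm (f x) \<le> M" for x using M C_unit_zero[OF assms, of x] by (cases "x \<in> units G") auto
  qed (rule M(1))
qed

section \<open>Compactly supported functions on bisections\<close>

lemma compactin_unit_space:
  "compactin (unit_space G) K \<longleftrightarrow> compactin (gtop G) K \<and> K \<subseteq> units G"
  by (rule compactin_subtopology)

lemma topspace_bisection: "\<gamma> \<in> bisections G \<Longrightarrow> topspace (subtopology (gtop G) \<gamma>) = \<gamma>"
  using bisectionD(2) by auto

text \<open>The source map injects a bisection continuously into the Hausdorff unit space, even if
  the whole arrow space is not Hausdorff.\<close>

lemma Hausdorff_bisection:
  assumes "\<gamma> \<in> bisections G" shows "Hausdorff_space (subtopology (gtop G) \<gamma>)"
  by (rule Hausdorff_space_injective_preimage[OF Hausdorff_units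
        continuous_map_from_subtopology[OF continuous_src]])
     (use assms bisectionD(3) topspace_bisection in auto)

text \<open>A compact \<open>K\<close> is closed in \<open>\<gamma>\<close> because bisections are
  Hausdorff, so it contains the support taken relative to \<open>\<gamma>\<close>. Any such
  \<open>K\<close> may then replace the closure in the definition.\<close>

lemma Cc_iff:
  assumes \<gamma>: "\<gamma> \<in> bisections G"
  shows "f \<in> Cc G \<gamma> \<longleftrightarrow> (\<forall>x. x \<notin> \<gamma> \<longrightarrow> f x = 0) \<and>
    continuous_map (subtopology (gtop G) \<gamma>) euclidean f \<and>
    (\<exists>K. compactin (gtop G) K \<and> K \<subseteq> \<gamma> \<and> (\<forall>x. x \<notin> K \<longrightarrow> f x = 0))"
proof -
  have "compactin (subtopology (gtop G) \<gamma>) (subtopology (gtop G) \<gamma> closure_of {x \<in> \<gamma>. f x \<noteq> 0}) \<longleftrightarrow>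
    (\<exists>K. compactin (gtop G) K \<and> K \<subseteq> \<gamma> \<and> (\<forall>x. x \<notin> K \<longrightarrow> f x = 0))" (is "?L \<longleftrightarrow> ?R")
    if zero: "\<forall>x. x \<notin> \<gamma> \<longrightarrow> f x = 0"
  proof
    assume ?L
    moreover have "{x \<in> \<gamma>. f x \<noteq> 0} \<subseteq> subtopology (gtop G) \<gamma> closure_of {x \<in> \<gamma>. f x \<noteq> 0}"
      by (rule closure_of_subset) (use topspace_bisection[OF \<gamma>] in auto)
    ultimately show ?R using zero by (auto simp: compactin_subtopology)
  next
    assume ?R
    then obtain K where K: "compactin (gtop G) K" "K \<subseteq> \<gamma>" "\<forall>x. x \<notin> K \<longrightarrow> f x = 0" by blast
    then have c: "compactin (subtopology (gtop G) \<gamma>) K" by (simp add: compactin_subtopology)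
    then have "closedin (subtopology (gtop G) \<gamma>) K"
      using compactin_imp_closedin Hausdorff_bisection[OF \<gamma>] by blast
    then have "subtopology (gtop G) \<gamma> closure_of {x \<in> \<gamma>. f x \<noteq> 0} \<subseteq> K"
      using K(3) by (intro closure_of_minimal) auto
    then show ?L using c closed_compactin closedin_closure_of by blast
  qed
  then show ?thesis unfolding Cc_def by blast
qed

lemma subtopology_unit_space: "V \<subseteq> units G \<Longrightarrow> subtopology (unit_space G) V = subtopology (gtop G) V"
  by (simp add: subtopology_subtopology inf_absorb2)

text \<open>A compact \<open>K\<close> is closed in the Hausdorff unit space, so the superlevel sets
  of \<open>f\<close> are closed there and extension by zero keeps continuity. The corresponding
  statement may fail for bisections in a non-Hausdorff arrow space.\<close>

lemma Cc_units_iff: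
  assumes V: "openin (unit_space G) V"
  shows "f \<in> Cc G V \<longleftrightarrow> f \<in> C_unit G \<and>
    (\<exists>K. compactin (unit_space G) K \<and> K \<subseteq> V \<and> (\<forall>x. x \<notin> K \<longrightarrow> f x = 0))"
proof
  have Vu: "V \<subseteq> units G" using V by (simp add: openin_unit_space)
  note bis = open_units_bisection(1)[OF V]
  {
    assume "f \<in> Cc G V"
    then obtain K where f: "\<forall>x. x \<notin> V \<longrightarrow> f x = 0" "continuous_map (subtopology (unit_space G) V) euclidean f"
      and K: "compactin (unit_space G) K" "K \<subseteq> V" "\<forall>x. x \<notin> K \<longrightarrow> f x = 0"
      using Vu unfolding Cc_iff[OF bis] subtopology_unit_space[OF Vu] compactin_unit_space by blast
    have clK: "closedin (unit_space G) K"
      using compactin_imp_closedin[OF Hausdorff_units K(1)] .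
    have "continuous_map (unit_space G) euclidean f"
    proof (rule continuous_map_zero_extension[OF V f(2)])
      fix \<epsilon> :: real assume \<epsilon>: "\<epsilon> > 0"
      have "continuous_map (subtopology (unit_space G) K) euclidean f"
        using f(2) K(2) continuous_map_from_subtopology_mono by blast
      moreover have "closed {z :: complex. \<epsilon> \<le> norm z}"
        by (intro closed_Collect_le continuous_intros)
      ultimately have "closedin (subtopology (unit_space G) K)
          {x \<in> topspace (subtopology (unit_space G) K). f x \<in> {z. \<epsilon> \<le> norm z}}"
        using closedin_continuous_map_preimage by fastforce
      moreover have "{x \<in> topspace (subtopology (unit_space G) K). f x \<in> {z. \<epsilon> \<le> norm z}}
          = {x \<in> topspace (unit_space G). \<epsilon> \<le> norm (f x)}"
        using K \<epsilon> units_subset_arrows Vu by fastforce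
      ultimately show "closedin (unit_space G) {x \<in> topspace (unit_space G). \<epsilon> \<le> norm (f x)}"
        using clK closedin_trans_full by fastforce
    qed (use f in auto)
    then show "f \<in> C_unit G \<and> (\<exists>K. compactin (unit_space G) K \<and> K \<subseteq> V \<and> (\<forall>x. x \<notin> K \<longrightarrow> f x = 0))"
      using K f(1) Vu by (auto simp: C_unit_def)
  next
    assume "f \<in> C_unit G \<and> (\<exists>K. compactin (unit_space G) K \<and> K \<subseteq> V \<and> (\<forall>x. x \<notin> K \<longrightarrow> f x = 0))"
    then show "f \<in> Cc G V"
      unfolding Cc_iff[OF bis] compactin_unit_space C_unit_def
      using Vu subtopology_unit_space[OF Vu] continuous_map_from_subtopology[of "unit_space G" euclidean f V]
      by auto
  }
qed

lemma Cc_subset_C0: "openin (unit_space G) V \<Longrightarrow> Cc G V \<subseteq> C0 G V"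
  by (fastforce simp: Cc_units_iff C0_def)

lemma Cc_mult_C_unit:
  assumes "openin (unit_space G) V" "f \<in> Cc G V" "f' \<in> C_unit G"
  shows "(\<lambda>x. f x * f' x) \<in> Cc G V"
  using assms by (auto simp: Cc_units_iff C_unit_mult)

lemma Cc_mult:
  assumes "openin (unit_space G) V" "openin (unit_space G) W" "f \<in> Cc G V" "f' \<in> Cc G W"
  shows "(\<lambda>x. f x * f' x) \<in> Cc G (V \<inter> W)"
proof -
  obtain K L where K: "compactin (unit_space G) K" "K \<subseteq> V" "\<forall>x. x \<notin> K \<longrightarrow> f x = 0"
    and L: "compactin (unit_space G) L" "L \<subseteq> W" "\<forall>x. x \<notin> L \<longrightarrow> f' x = 0"
    using assms by (auto simp: Cc_units_iff)
  have "compactin (unit_space G) (K \<inter> L)"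
    using compact_Int_closedin[OF K(1)] compactin_imp_closedin[OF Hausdorff_units L(1)] by blast
  then show ?thesis
    using assms K L C_unit_mult[of f f'] unfolding Cc_units_iff[OF openin_Int[OF assms(1,2)]]
    by (auto simp: Cc_units_iff intro!: exI[of _ "K \<inter> L"])
qed

lemma Cc_mono:
  assumes "openin (unit_space G) V" "openin (unit_space G) W" "V \<subseteq> W" shows "Cc G V \<subseteq> Cc G W"
  using assms(3) unfolding subset_iff Cc_units_iff[OF assms(1)] Cc_units_iff[OF assms(2)] by blast

lemma C0_mono: "V \<subseteq> W \<Longrightarrow> C0 G V \<subseteq> C0 G W"
  by (auto simp: C0_def)

lemma C_unit_subset_Cc: "C_unit G \<subseteq> Cc G (units G)"
proof -
  have *: "openin (unit_space G) (units G)" using openin_topspace[of "unit_space G"] by simp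
  show ?thesis using compactin_units C_unit_zero unfolding subset_iff Cc_units_iff[OF *] by blast
qed

text \<open>These are the compact sets on which cutoffs are later required to be 1: off them
  \<open>f\<close> is smaller than \<open>\<epsilon>\<close>.\<close>

lemma compactin_superlevel:
  assumes "f \<in> C0 G V" "\<epsilon> > 0"
  shows "compactin (unit_space G) {x. \<epsilon> \<le> norm (f x)}" "{x. \<epsilon> \<le> norm (f x)} \<subseteq> V"
proof -
  have "closed {z :: complex. \<epsilon> \<le> norm z}"
    by (intro closed_Collect_le continuous_intros)
  then have "closedin (unit_space G) {x \<in> topspace (unit_space G). f x \<in> {z. \<epsilon> \<le> norm z}}"
    using assms by (intro closedin_continuous_map_preimage[of _ euclidean]) (auto simp: C0_def C_unit_def)
  moreover have "{x \<in> topspace (unit_space G). f x \<in> {z. \<epsilon> \<le> norm z}} = {x. \<epsilon> \<le> norm (f x)}"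
    using assms by (auto simp: C0_def C_unit_def dest!: leD intro: ccontr)
  ultimately show "compactin (unit_space G) {x. \<epsilon> \<le> norm (f x)}"
    using closedin_compact_space[OF compact_units] by simp
  show "{x. \<epsilon> \<le> norm (f x)} \<subseteq> V" using assms by (auto simp: C0_def)
qed

section \<open>Lifts along the source and pushforwards along psi\<close>

lemma src_lift_apply: "g \<in> \<gamma> \<Longrightarrow> src_lift G \<gamma> k g = k (src G g)"
  by (simp add: src_lift_def)

lemma src_lift_Cc:
  assumes \<gamma>: "\<gamma> \<in> bisections G" and k: "k \<in> Cc G (supp G \<gamma>)"
  shows "src_lift G \<gamma> k \<in> Cc G \<gamma>"
proof -
  note open_supp = bisectionD(5)[OF \<gamma>]
  obtain K where K: "compactin (unit_space G) K" "K \<subseteq> supp G \<gamma>" "\<forall>x. x \<notin> K \<longrightarrow> k x = 0"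
    and cont: "continuous_map (unit_space G) euclidean k"
    using k unfolding Cc_units_iff[OF open_supp] C_unit_def by blast
  have "continuous_map (subtopology (gtop G) \<gamma>) euclidean (k \<circ> src G)"
    by (rule continuous_map_compose[OF continuous_map_from_subtopology[OF continuous_src] cont])
  then have "continuous_map (subtopology (gtop G) \<gamma>) euclidean (src_lift G \<gamma> k)"
    by (rule continuous_map_eq) (simp add: src_lift_def)
  moreover have "compactin (subtopology (unit_space G) (supp G \<gamma>)) K"
    using K by (simp add: compactin_subtopology)
  then have "compactin (gtop G) (inv_into \<gamma> (src G) ` K)"
    by (rule image_compactin[OF _ continuous_src_inv[OF \<gamma>]])
  moreover have "inv_into \<gamma> (src G) ` K \<subseteq> \<gamma>"
    using K(2) inv_into_into[of _ "src G" \<gamma>] by blast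
  moreover have "src_lift G \<gamma> k x = 0" if "x \<notin> inv_into \<gamma> (src G) ` K" for x
    using that K(3) bisection_src_inv[OF \<gamma>, of x] by (force simp: src_lift_def)
  moreover have "src_lift G \<gamma> k x = 0" if "x \<notin> \<gamma>" for x using that by (simp add: src_lift_def)
  ultimately show ?thesis unfolding Cc_iff[OF \<gamma>] by blast
qed

text \<open>Compose \<open>f\<close> with the continuous inverse of the source map on
  \<open>\<gamma>\<close>; the image under \<open>src\<close> of a compact set carrying
  \<open>f\<close> carries the result.\<close>

lemma Cc_eq_src_lift:
  assumes \<gamma>: "\<gamma> \<in> bisections G" and f: "f \<in> Cc G \<gamma>"
  obtains k where "k \<in> Cc G (supp G \<gamma>)" "f = src_lift G \<gamma> k"
proof -
  note su = bisectionD(7)[OF \<gamma>] and bis = open_units_bisection(1)[OF bisectionD(5)[OF \<gamma>]]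
  obtain K where K: "compactin (gtop G) K" "K \<subseteq> \<gamma>" "\<forall>x. x \<notin> K \<longrightarrow> f x = 0"
    and zero: "\<forall>x. x \<notin> \<gamma> \<longrightarrow> f x = 0"
    and cont: "continuous_map (subtopology (gtop G) \<gamma>) euclidean f"
    using f unfolding Cc_iff[OF \<gamma>] by blast
  define k where "k x = (if x \<in> supp G \<gamma> then f (inv_into \<gamma> (src G) x) else 0)" for x
  have eq: "f = src_lift G \<gamma> k"
    using zero bisection_src_inv[OF \<gamma>] by (auto simp: src_lift_def k_def fun_eq_iff)
  have "continuous_map (subtopology (unit_space G) (supp G \<gamma>)) (subtopology (gtop G) \<gamma>) (inv_into \<gamma> (src G))"
    by (rule continuous_map_into_subtopology[OF continuous_src_inv[OF \<gamma>]])
       (auto intro!: inv_into_into)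
  then have "continuous_map (subtopology (unit_space G) (supp G \<gamma>)) euclidean (f \<circ> inv_into \<gamma> (src G))"
    by (rule continuous_map_compose[OF _ cont])
  then have "continuous_map (subtopology (unit_space G) (supp G \<gamma>)) euclidean k"
    by (rule continuous_map_eq) (auto simp: k_def)
  then have "continuous_map (subtopology (gtop G) (supp G \<gamma>)) euclidean k"
    using subtopology_unit_space[OF su] by simp
  moreover have "compactin (gtop G) (src G ` K)"
    using image_compactin[OF K(1) continuous_src] by (simp add: compactin_subtopology)
  moreover have "k x = 0" if "x \<notin> src G ` K" for x
  proof (cases "x \<in> supp G \<gamma>")
    case True
    then have "inv_into \<gamma> (src G) x \<notin> K" using that f_inv_into_f[OF True] by (metis imageI)
    then show ?thesis using K(3) by (simp add: k_def)
  qed (simp add: k_def)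
  moreover have "k x = 0" if "x \<notin> supp G \<gamma>" for x using that by (simp add: k_def)
  moreover have "src G ` K \<subseteq> supp G \<gamma>" using K(2) by (rule image_mono)
  ultimately have "k \<in> Cc G (supp G \<gamma>)" unfolding Cc_iff[OF bis] by blast
  then show ?thesis using that eq by blast
qed

lemma psi_push_apply:
  "\<gamma> \<in> bisections G \<Longrightarrow> g \<in> \<gamma> \<Longrightarrow> psi_push G \<gamma> f (rng G g) = f (src G g)"
  by (simp add: psi_push_def psi_set_inv)

lemma psi_push_inv_apply:
  assumes "\<gamma> \<in> bisections G" "g \<in> \<gamma>" shows "psi_push G (set_inv G \<gamma>) f (src G g) = f (rng G g)"
proof -
  have "g \<in> arrows G" "ginv G g \<in> set_inv G \<gamma>" using assms bisectionD(2) by (auto simp: set_inv_def)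
  then show ?thesis using psi_push_apply[OF set_inv_bisection(1)[OF assms(1)], of "ginv G g" f] by simp
qed

lemma psi_push_outside: "x \<notin> im G \<gamma> \<Longrightarrow> psi_push G \<gamma> f x = 0"
  by (simp add: psi_push_def)

lemma psi_push_eq: "\<gamma> \<in> bisections G \<Longrightarrow> x \<in> im G \<gamma> \<Longrightarrow> psi_push G \<gamma> f x = f (src G (inv_into \<gamma> (rng G) x))"
  by (auto simp: psi_push_apply bisection_rng_inv)

lemma psi_push_support:
  assumes \<gamma>: "\<gamma> \<in> bisections G" and K: "compactin (unit_space G) K" "K \<subseteq> supp G \<gamma>"
  shows "compactin (unit_space G) (rng G ` inv_into \<gamma> (src G) ` K)" "rng G ` inv_into \<gamma> (src G) ` K \<subseteq> im G \<gamma>"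
proof -
  have "compactin (subtopology (unit_space G) (supp G \<gamma>)) K"
    using K by (simp add: compactin_subtopology)
  then have "compactin (gtop G) (inv_into \<gamma> (src G) ` K)"
    by (rule image_compactin[OF _ continuous_src_inv[OF \<gamma>]])
  then show "compactin (unit_space G) (rng G ` inv_into \<gamma> (src G) ` K)"
    by (rule image_compactin[OF _ continuous_rng])
  show "rng G ` inv_into \<gamma> (src G) ` K \<subseteq> im G \<gamma>"
    using K(2) inv_into_into[of _ "src G" \<gamma>] by blast
qed

text \<open>The point is continuity at the boundary of \<open>im G \<gamma>\<close>: the superlevel
  sets of the pushforward are the images of the compact superlevel sets of \<open>f\<close>, so they
  are closed.\<close>

lemma psi_push_C0:
  assumes \<gamma>: "\<gamma> \<in> bisections G" and f: "f \<in> C0 G (supp G \<gamma>)"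
  shows "psi_push G \<gamma> f \<in> C0 G (im G \<gamma>)"
proof -
  have "continuous_map (subtopology (unit_space G) (im G \<gamma>)) euclidean ((f \<circ> src G) \<circ> inv_into \<gamma> (rng G))"
    using f by (intro continuous_map_compose[OF continuous_rng_inv[OF \<gamma>]]
        continuous_map_compose[OF continuous_src]) (auto simp: C0_def C_unit_def)
  then have cont: "continuous_map (subtopology (unit_space G) (im G \<gamma>)) euclidean (psi_push G \<gamma> f)"
    by (rule continuous_map_eq) (auto simp: psi_push_eq[OF \<gamma>])
  have "continuous_map (unit_space G) euclidean (psi_push G \<gamma> f)"
  proof (rule continuous_map_zero_extension[OF bisectionD(6)[OF \<gamma>] cont])
    fix \<epsilon> :: real assume \<epsilon>: "\<epsilon> > 0"
    note K = compactin_superlevel[OF f \<epsilon>]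
    have "{x \<in> topspace (unit_space G). \<epsilon> \<le> norm (psi_push G \<gamma> f x)}
        = rng G ` inv_into \<gamma> (src G) ` {x. \<epsilon> \<le> norm (f x)}" (is "?L = ?R")
    proof (intro equalityI subsetI)
      fix x assume "x \<in> ?L"
      then have "x \<in> im G \<gamma>" "\<epsilon> \<le> norm (psi_push G \<gamma> f x)" using \<epsilon> by (auto simp: psi_push_def split: if_splits)
      then obtain g where g: "g \<in> \<gamma>" "x = rng G g" "\<epsilon> \<le> norm (f (src G g))"
        by (auto simp: psi_push_apply[OF \<gamma>])
      then show "x \<in> ?R" using bisection_src_inv[OF \<gamma> g(1)]
        by (auto simp: image_iff intro!: exI[of _ "src G g"])
    next
      fix x assume "x \<in> ?R"
      then obtain g where "g \<in> \<gamma>" "x = rng G g" "\<epsilon> \<le> norm (f (src G g))"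
        using K(2) bisection_src_inv[OF \<gamma>] by force
      then show "x \<in> ?L" using bisectionD(8)[OF \<gamma>] by (auto simp: psi_push_apply[OF \<gamma>])
    qed
    then show "closedin (unit_space G) {x \<in> topspace (unit_space G). \<epsilon> \<le> norm (psi_push G \<gamma> f x)}"
      using compactin_imp_closedin[OF Hausdorff_units psi_push_support(1)[OF \<gamma> K]] by simp
  qed (simp add: psi_push_outside)
  then show ?thesis
    using bisectionD(8)[OF \<gamma>] psi_push_outside[of _ \<gamma> f] unfolding C0_def C_unit_def by blast
qed

text \<open>\<open>V\<close> is left free because the composition of two bisections needs pushed
  functions supported in the source of the next bisection.\<close>

lemma psi_push_Cc_into:
  assumes \<gamma>: "\<gamma> \<in> bisections G" and W: "openin (unit_space G) W" "W \<subseteq> supp G \<gamma>"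
    and V: "openin (unit_space G) V" "\<And>g. g \<in> \<gamma> \<Longrightarrow> src G g \<in> W \<Longrightarrow> rng G g \<in> V"
    and f: "f \<in> Cc G W"
  shows "psi_push G \<gamma> f \<in> Cc G V"
proof -
  obtain K where K: "compactin (unit_space G) K" "K \<subseteq> W" "\<forall>x. x \<notin> K \<longrightarrow> f x = 0"
    using f unfolding Cc_units_iff[OF W(1)] by blast
  let ?K = "rng G ` inv_into \<gamma> (src G) ` K"
  have Ks: "K \<subseteq> supp G \<gamma>" using K(2) W(2) by blast
  have "?K \<subseteq> V"
  proof clarify
    fix x assume x: "x \<in> K"
    then have "inv_into \<gamma> (src G) x \<in> \<gamma>" "src G (inv_into \<gamma> (src G) x) = x"
      using Ks by (auto intro: inv_into_into f_inv_into_f)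
    then show "rng G (inv_into \<gamma> (src G) x) \<in> V" using V(2) x K(2) by auto
  qed
  moreover have "psi_push G \<gamma> f x = 0" if "x \<notin> ?K" for x
  proof (cases "x \<in> im G \<gamma>")
    case True
    then obtain g where g: "g \<in> \<gamma>" "x = rng G g" by blast
    then have "src G g \<notin> K" using that bisection_src_inv[OF \<gamma> g(1)] by force
    then show ?thesis using g K(3) by (simp add: psi_push_apply[OF \<gamma>])
  qed (simp add: psi_push_outside)
  moreover have "psi_push G \<gamma> f \<in> C_unit G"
    using psi_push_C0[OF \<gamma> subsetD[OF C0_mono[OF W(2)] subsetD[OF Cc_subset_C0[OF W(1)] f]]]
    by (simp add: C0_def)
  ultimately show ?thesis
    unfolding Cc_units_iff[OF V(1)] using psi_push_support(1)[OF \<gamma> K(1) Ks] by blast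
qed

lemma psi_push_Cc:
  assumes \<gamma>: "\<gamma> \<in> bisections G" and f: "f \<in> Cc G (supp G \<gamma>)"
  shows "psi_push G \<gamma> f \<in> Cc G (im G \<gamma>)"
  by (rule psi_push_Cc_into[OF \<gamma> bisectionD(5)[OF \<gamma>] subset_refl bisectionD(6)[OF \<gamma>] _ f]) blast

lemma ex_cutoff:
  assumes V: "openin (unit_space G) V" and K: "compactin (unit_space G) K" "K \<subseteq> V"
  shows "cutoffs G V K \<noteq> {}"
proof -
  have "normal_space (unit_space G)"
    using compact_Hausdorff_or_regular_imp_normal_space compact_units Hausdorff_units by blast
  moreover have "closedin (unit_space G) (units G - V)"
    using V closedin_diff[of "unit_space G" "units G" V] by (metis closedin_topspace topspace_unit_space)
  moreover have "closedin (unit_space G) K" using compactin_imp_closedin[OF Hausdorff_units K(1)] .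
  moreover have "disjnt (units G - V) K" using K(2) by (auto simp: disjnt_def)
  ultimately obtain f where f: "continuous_map (unit_space G) (top_of_set {0..1::real}) f"
    "f ` (units G - V) \<subseteq> {0}" "f ` K \<subseteq> {1}"
    using Urysohn_lemma[of "unit_space G" "units G - V" K 0 1] by auto
  have f01: "f x \<in> {0..1}" if "x \<in> units G" for x
    using f(1) that by (auto simp: continuous_map_in_subtopology)
  \<comment> \<open>A Urysohn function vanishes off \<open>V\<close>, but its support may touch the
    boundary. Truncating at height 1/2 and rescaling keeps the value 1 on \<open>K\<close> and
    confines the support to the compact set where f >= 1/2.\<close>
  define e where "e x = (if x \<in> units G then complex_of_real (max 0 (2 * f x - 1)) else 0)" for x
  have cf: "continuous_map (unit_space G) euclideanreal f"
    using f(1) by (simp add: continuous_map_in_subtopology)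
  have "continuous_map (unit_space G) euclidean ((\<lambda>t. complex_of_real (max 0 (2 * t - 1))) \<circ> f)"
    by (rule continuous_map_compose[OF cf]) (auto intro!: continuous_intros)
  then have "continuous_map (unit_space G) euclidean e"
    by (rule continuous_map_eq) (simp add: e_def)
  then have e: "e \<in> C_unit G" by (simp add: C_unit_def e_def)
  define L where "L = {x \<in> topspace (unit_space G). f x \<in> {1/2..}}"
  have "closedin (unit_space G) L"
    unfolding L_def by (rule closedin_continuous_map_preimage[OF cf]) simp
  then have "compactin (unit_space G) L" using closedin_compact_space[OF compact_units] by blast
  moreover have "L \<subseteq> V" using f(2) by (force simp: L_def)
  moreover have "e x = 0" if "x \<notin> L" for x using that by (auto simp: e_def L_def)
  ultimately have "e \<in> Cc G V" unfolding Cc_units_iff[OF V] using e by blast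
  moreover have "e x \<in> complex_of_real ` {0..1}" for x
    using f01[of x] by (auto simp: e_def max_def intro!: image_eqI[of _ _ "0::real"])
  moreover have "e x = 1" if "x \<in> K" for x
    using that f(3) K(1) by (auto simp: e_def compactin_unit_space)
  ultimately have "e \<in> cutoffs G V K" by (auto simp: cutoffs_def)
  then show ?thesis by blast
qed

lemma cutoff_norm:
  assumes "e \<in> cutoffs G V K"
  shows "norm (e x) \<le> 1" "norm (1 - e x) \<le> 1" "cnj (e x) = e x"
proof -
  obtain t where t: "e x = complex_of_real t" "0 \<le> t" "t \<le> 1"
    using assms by (force simp: cutoffs_def)
  then show "norm (e x) \<le> 1" "cnj (e x) = e x" by simp_all
  have "1 - e x = complex_of_real (1 - t)" by (simp add: t)
  then show "norm (1 - e x) \<le> 1" using t by (simp only: norm_of_real)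
qed

section \<open>The convolution algebra\<close>

lemma Cc_scale: "f \<in> Cc G U \<Longrightarrow> U \<in> bisections G \<Longrightarrow> (\<lambda>x. c * f x) \<in> Cc G U"
proof -
  assume U: "U \<in> bisections G" and f: "f \<in> Cc G U"
  obtain k where k: "k \<in> Cc G (supp G U)" "f = src_lift G U k" using Cc_eq_src_lift[OF U f] .
  note o = bisectionD(5)[OF U]
  have "(\<lambda>x. c * k x) \<in> Cc G (supp G U)"
    using k(1) C_unit_scale[of k c] unfolding Cc_units_iff[OF o] by auto
  moreover have "(\<lambda>x. c * f x) = src_lift G U (\<lambda>x. c * k x)" by (auto simp: k(2) src_lift_def)
  ultimately show ?thesis using src_lift_Cc[OF U] by simp
qed

lemma C_groupoid_zero: "(\<lambda>x. 0) \<in> C_groupoid G"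
  unfolding C_groupoid_def by (auto intro!: exI[of _ 0])

lemma C_groupoid_add_Cc:
  assumes "f \<in> C_groupoid G" "U \<in> bisections G" "F \<in> Cc G U"
  shows "(\<lambda>x. f x + F x) \<in> C_groupoid G"
proof -
  obtain n c H where H: "f = (\<lambda>x. \<Sum>i<n. c i * H i x)" "\<forall>i<n::nat. \<exists>U\<in>bisections G. H i \<in> Cc G U"
    using assms(1) by (auto simp: C_groupoid_def)
  have "(\<lambda>x. f x + F x) = (\<lambda>x. \<Sum>i<Suc n. (c(n := 1)) i * (H(n := F)) i x)"
    by (auto simp: H(1) intro!: sum.cong)
  moreover have "\<forall>i<Suc n. \<exists>U\<in>bisections G. (H(n := F)) i \<in> Cc G U"
    using H(2) assms by (auto simp: less_Suc_eq)
  ultimately show ?thesis unfolding C_groupoid_def by blast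
qed

lemma Cc_subset_C_groupoid: "U \<in> bisections G \<Longrightarrow> Cc G U \<subseteq> C_groupoid G"
  using C_groupoid_add_Cc[OF C_groupoid_zero] by fastforce

lemma units_bisection: "units G \<in> bisections G"
  by (rule open_units_bisection) (use openin_topspace[of "unit_space G"] in simp)

lemma open_unit_space: "openin (unit_space G) (units G)"
  using openin_topspace[of "unit_space G"] by simp

lemma C_unit_subset_C_groupoid: "C_unit G \<subseteq> C_groupoid G"
  using C_unit_subset_Cc Cc_subset_C_groupoid[OF units_bisection] by blast

text \<open>Coefficients are absorbed into the functions by \<open>Cc_scale\<close>, so linear
  combinations become plain sums of functions on single bisections.\<close>

lemma C_groupoid_induct [consumes 1, case_names zero add]:
  assumes f: "f \<in> C_groupoid G" and zero: "P (\<lambda>x. 0)"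
    and add: "\<And>f U F. f \<in> C_groupoid G \<Longrightarrow> P f \<Longrightarrow> U \<in> bisections G \<Longrightarrow> F \<in> Cc G U \<Longrightarrow> P (\<lambda>x. f x + F x)"
  shows "P f"
proof -
  have "(\<lambda>x. \<Sum>i<n. c i * H i x) \<in> C_groupoid G \<and> P (\<lambda>x. \<Sum>i<n. c i * H i x)"
    if "\<forall>i<n::nat. \<exists>U\<in>bisections G. H i \<in> Cc G U" for n c and H :: "nat \<Rightarrow> 'g \<Rightarrow> complex"
    using that
  proof (induction n)
    case 0
    then show ?case using zero C_groupoid_zero by simp
  next
    case (Suc n)
    then obtain U where U: "U \<in> bisections G" "H n \<in> Cc G U" by auto
    then show ?case using Suc add C_groupoid_add_Cc Cc_scale[OF U(2,1)] by simp
  qed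
  then show ?thesis using f unfolding C_groupoid_def by blast
qed

text \<open>The sum defining the convolution has at most one term.\<close>

lemma convolution_src_lift:
  assumes g: "\<gamma> \<in> bisections G" and d: "\<delta> \<in> bisections G"
  shows "convolution G (src_lift G \<gamma> a) (src_lift G \<delta> b)
    = src_lift G (set_comp G \<gamma> \<delta>) (\<lambda>x. psi_push G (set_inv G \<delta>) a x * b x)"
proof
  fix x
  let ?S = "{(k, h). (k, h) \<in> composable G \<and> gcomp G k h = x \<and> src_lift G \<gamma> a k \<noteq> 0 \<and> src_lift G \<delta> b h \<noteq> 0}"
  show "convolution G (src_lift G \<gamma> a) (src_lift G \<delta> b) x
    = src_lift G (set_comp G \<gamma> \<delta>) (\<lambda>x. psi_push G (set_inv G \<delta>) a x * b x) x"
  proof (cases "x \<in> set_comp G \<gamma> \<delta>")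
    case False
    then have S: "?S = {}" by (auto simp: src_lift_def set_comp_def split: if_splits)
    have "convolution G (src_lift G \<gamma> a) (src_lift G \<delta> b) x = 0"
      unfolding convolution_def by (simp only: S sum.empty if_cancel)
    then show ?thesis using False by (simp add: src_lift_def)
  next
    case True
    then obtain k h where x: "x = gcomp G k h" "k \<in> \<gamma>" "h \<in> \<delta>" "rng G h = src G k"
      "k \<in> arrows G" "h \<in> arrows G" "src G x = src G h" "rng G x = rng G k" "x \<in> arrows G"
      using set_compE[OF g d] by metis
    have sub: "?S \<subseteq> {(k, h)}"
    proof clarify
      fix k' h' assume "(k', h') \<in> composable G" "x = gcomp G k' h'" "src_lift G \<gamma> a k' \<noteq> 0" "src_lift G \<delta> b h' \<noteq> 0"
      then have *: "k' \<in> \<gamma>" "h' \<in> \<delta>" "rng G k' = rng G k" "src G h' = src G h"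
        using x by (auto simp: src_lift_def split: if_splits)
      then show "k' = k \<and> h' = h"
        using rng_eq_in_bisection[OF g] src_eq_in_bisection[OF d] x by metis
    qed
    have "convolution G (src_lift G \<gamma> a) (src_lift G \<delta> b) x
        = (\<Sum>(k, h)\<in>?S. src_lift G \<gamma> a k * src_lift G \<delta> b h)"
      using x by (simp add: convolution_def)
    also have "\<dots> = (\<Sum>(k, h)\<in>{(k, h)}. src_lift G \<gamma> a k * src_lift G \<delta> b h)"
      using sub x by (intro sum.mono_neutral_left) auto
    also have "\<dots> = a (src G k) * b (src G h)" using x by (simp add: src_lift_apply)
    finally show ?thesis using True x by (simp add: src_lift_apply psi_push_inv_apply[OF d])
  qed
qed

text \<open>The source of \<open>ginv G g\<close> is the range of \<open>g\<close>, so the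
  coefficient function has to be pushed from the support to the image of
  \<open>\<gamma>\<close>.\<close>

lemma involution_src_lift:
  assumes g: "\<gamma> \<in> bisections G"
  shows "involution G (src_lift G \<gamma> a) = src_lift G (set_inv G \<gamma>) (psi_push G \<gamma> (\<lambda>x. cnj (a x)))"
proof
  fix x
  show "involution G (src_lift G \<gamma> a) x = src_lift G (set_inv G \<gamma>) (psi_push G \<gamma> (\<lambda>x. cnj (a x))) x"
  proof (cases "x \<in> set_inv G \<gamma>")
    case True
    then obtain g' where "g' \<in> \<gamma>" "x = ginv G g'" "g' \<in> arrows G"
      using bisectionD(2)[OF g] by (auto simp: set_inv_def)
    then show ?thesis using True by (simp add: involution_def src_lift_apply psi_push_apply[OF g])
  next
    case False
    then have "x \<in> arrows G \<Longrightarrow> ginv G x \<notin> \<gamma>" by (metis ginv_ginv image_eqI set_inv_def)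
    then show ?thesis using False by (simp add: involution_def src_lift_def)
  qed
qed

lemma src_lift_units:
  assumes V: "openin (unit_space G) V" and f: "\<And>x. x \<notin> V \<Longrightarrow> f x = 0" shows "src_lift G V f = f"
proof
  fix x
  have "V \<subseteq> units G" using V by (simp add: openin_unit_space)
  then show "src_lift G V f x = f x" using f[of x] unitsD[of x] by (auto simp: src_lift_def)
qed

lemma C_unit_src_lift: "f \<in> C_unit G \<Longrightarrow> src_lift G (units G) f = f"
  by (rule src_lift_units[OF open_unit_space]) (simp add: C_unit_zero)

lemma src_lift_cong:
  "(\<And>g. g \<in> \<gamma> \<Longrightarrow> a (src G g) = b (src G g)) \<Longrightarrow> src_lift G \<gamma> a = src_lift G \<gamma> b"
  by (auto simp: src_lift_def)

lemma convolution_C_unit_left: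
  assumes f: "f \<in> C_unit G" and g: "\<gamma> \<in> bisections G"
  shows "convolution G f (src_lift G \<gamma> b) = src_lift G \<gamma> (\<lambda>x. psi_push G (set_inv G \<gamma>) f x * b x)"
proof -
  have "set_comp G (units G) \<gamma> = \<gamma>"
    using bisectionD(2)[OF g] unfolding set_comp_units_left[OF g open_unit_space] by auto
  then show ?thesis
    using convolution_src_lift[OF units_bisection g, of f b] by (simp add: C_unit_src_lift[OF f])
qed

lemma convolution_C_unit_right:
  assumes f: "f \<in> C_unit G" and g: "\<gamma> \<in> bisections G"
  shows "convolution G (src_lift G \<gamma> b) f = src_lift G \<gamma> (\<lambda>x. b x * f x)"
proof -
  have "set_comp G \<gamma> (units G) = \<gamma>"
    using bisectionD(2)[OF g] unfolding set_comp_units_right[OF g open_unit_space] by auto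
  then have "convolution G (src_lift G \<gamma> b) f
      = src_lift G \<gamma> (\<lambda>x. psi_push G (set_inv G (units G)) b x * f x)"
    using convolution_src_lift[OF g units_bisection, of b f] by (simp add: C_unit_src_lift[OF f])
  also have "\<dots> = src_lift G \<gamma> (\<lambda>x. b x * f x)"
  proof (rule src_lift_cong)
    fix h assume "h \<in> \<gamma>"
    then have "src G h \<in> units G" using bisectionD(2)[OF g] by auto
    then have "psi_push G (set_inv G (units G)) b (src G h) = b (src G h)"
      using psi_push_inv_apply[OF units_bisection, of "src G h" b] unitsD by simp
    then show "psi_push G (set_inv G (units G)) b (src G h) * f (src G h) = b (src G h) * f (src G h)"
      by simp
  qed
  finally show ?thesis .
qed

lemma convolution_C_unit:
  assumes "f \<in> C_unit G" "f' \<in> C_unit G" shows "convolution G f f' = (\<lambda>x. f x * f' x)"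
  using convolution_C_unit_right[OF assms(2) units_bisection, of f] C_unit_src_lift[OF assms(1)]
    C_unit_src_lift[OF C_unit_mult[OF assms]] by simp

lemma involution_C_unit:
  assumes "f \<in> C_unit G" shows "involution G f = (\<lambda>x. cnj (f x))"
proof
  fix x
  show "involution G f x = cnj (f x)"
  proof (cases "x \<in> units G")
    case True
    then have "ginv G x = x" using comp_src[of "ginv G x"] comp_ginv_left[of x] by (simp add: unitsD)
    then show ?thesis using True by (simp add: involution_def unitsD)
  next
    case False
    then have "x \<in> arrows G \<Longrightarrow> ginv G x \<notin> units G"
      using src_ginv[of x] unitsD[of "ginv G x"] comp_ginv_right[of x] comp_src[of x]
      by (metis rng_ginv rng_in_units ginv_ginv comp_ginv_left comp_rng comp_src src_ginv)
    then show ?thesis using False by (auto simp: involution_def C_unit_zero[OF assms])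
  qed
qed

text \<open>Support control for the product formula. Restrict \<open>\<delta>\<close> to the arrows
  whose range lies in the support of \<open>\<gamma>\<close>. The function is the pullback along
  this smaller bisection of \<open>a\<close> times the pushed \<open>b\<close>, which has compact
  support in the intersection of supp \<gamma> and im \<delta>.\<close>

lemma psi_push_pull_Cc:
  assumes g: "\<gamma> \<in> bisections G" and d: "\<delta> \<in> bisections G"
    and a: "a \<in> Cc G (supp G \<gamma>)" and b: "b \<in> Cc G (supp G \<delta>)"
  shows "(\<lambda>x. psi_push G (set_inv G \<delta>) a x * b x) \<in> Cc G (supp G (set_comp G \<gamma> \<delta>))"
proof -
  let ?V = "supp G \<gamma>"
  define \<delta>' where "\<delta>' = set_comp G ?V \<delta>"
  note V = bisectionD(5)[OF g]
  have \<delta>': "\<delta>' \<in> bisections G"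
    unfolding \<delta>'_def by (rule set_comp_bisection[OF open_units_bisection(1)[OF V] d])
  have eq: "\<delta>' = {h \<in> \<delta>. rng G h \<in> ?V}" unfolding \<delta>'_def by (rule set_comp_units_left[OF d V])
  have s: "supp G \<delta>' = supp G (set_comp G \<gamma> \<delta>)"
    unfolding \<delta>'_def
    using supp_set_comp[OF open_units_bisection(1)[OF V] d] supp_set_comp[OF g d]
      open_units_bisection(2)[OF V] by simp
  have "(\<lambda>x. a x * psi_push G \<delta> b x) \<in> Cc G (?V \<inter> im G \<delta>)"
    by (rule Cc_mult[OF V bisectionD(6)[OF d] a psi_push_Cc[OF d b]])
  moreover have "W \<inter> im G \<delta> = rng G ` {h \<in> \<delta>. rng G h \<in> W}" for W by auto
  then have "?V \<inter> im G \<delta> = supp G (set_inv G \<delta>')"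
    unfolding set_inv_bisection(2)[OF \<delta>'] by (subst eq)
  ultimately have mem: "psi_push G (set_inv G \<delta>') (\<lambda>x. a x * psi_push G \<delta> b x) \<in> Cc G (supp G \<delta>')"
    using psi_push_Cc[OF set_inv_bisection(1)[OF \<delta>']] set_inv_bisection(3)[OF \<delta>'] by simp
  have pt: "psi_push G (set_inv G \<delta>') (\<lambda>x. a x * psi_push G \<delta> b x) x
      = psi_push G (set_inv G \<delta>) a x * b x" for x
  proof (cases "x \<in> supp G \<delta>'")
    case True
    then obtain h where h: "h \<in> \<delta>'" "x = src G h" by blast
    then have "h \<in> \<delta>" by (simp add: eq)
    then show ?thesis
      using psi_push_inv_apply[OF \<delta>' h(1)] psi_push_inv_apply[OF d] psi_push_apply[OF d] h by simp
  next
    case False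
    then have "psi_push G (set_inv G \<delta>') (\<lambda>x. a x * psi_push G \<delta> b x) x = 0"
      using psi_push_outside set_inv_bisection(3)[OF \<delta>'] by metis
    moreover have "psi_push G (set_inv G \<delta>) a x * b x = 0"
    proof (cases "x \<in> supp G \<delta>")
      case True
      then obtain h where h: "h \<in> \<delta>" "x = src G h" by blast
      then have "rng G h \<notin> ?V" using False by (auto simp: eq)
      then have "a (rng G h) = 0" using a by (simp add: Cc_def)
      then show ?thesis using psi_push_inv_apply[OF d h(1)] h by simp
    next
      case False
      then show ?thesis using b by (simp add: Cc_def)
    qed
    ultimately show ?thesis by simp
  qed
  have "psi_push G (set_inv G \<delta>') (\<lambda>x. a x * psi_push G \<delta> b x)
      = (\<lambda>x. psi_push G (set_inv G \<delta>) a x * b x)"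
    using pt by (rule ext)
  then show ?thesis using mem s by simp
qed

lemma convolution_Cc:
  assumes g: "\<gamma> \<in> bisections G" and d: "\<delta> \<in> bisections G" and f: "f \<in> Cc G \<gamma>" and f': "f' \<in> Cc G \<delta>"
  shows "convolution G f f' \<in> Cc G (set_comp G \<gamma> \<delta>)"
proof -
  obtain a where a: "a \<in> Cc G (supp G \<gamma>)" "f = src_lift G \<gamma> a" using Cc_eq_src_lift[OF g f] .
  obtain b where b: "b \<in> Cc G (supp G \<delta>)" "f' = src_lift G \<delta> b" using Cc_eq_src_lift[OF d f'] .
  show ?thesis
    unfolding a b convolution_src_lift[OF g d]
    by (rule src_lift_Cc[OF set_comp_bisection[OF g d] psi_push_pull_Cc[OF g d a(1) b(1)]])
qed

lemma involution_Cc: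
  assumes g: "\<gamma> \<in> bisections G" and f: "f \<in> Cc G \<gamma>"
  shows "involution G f \<in> Cc G (set_inv G \<gamma>)"
proof -
  obtain a where a: "a \<in> Cc G (supp G \<gamma>)" "f = src_lift G \<gamma> a" using Cc_eq_src_lift[OF g f] .
  have "(\<lambda>x. cnj (a x)) \<in> Cc G (supp G \<gamma>)"
    using a(1) unfolding Cc_units_iff[OF bisectionD(5)[OF g]] by (auto simp: C_unit_cnj)
  then show ?thesis
    unfolding a involution_src_lift[OF g]
    using src_lift_Cc[OF set_inv_bisection(1)[OF g]] psi_push_Cc[OF g] set_inv_bisection(2)[OF g] by simp
qed

text \<open>Conjugation by the inverse bisection undoes conjugation by \<open>\<gamma>\<close>: the
  arrows it selects at the two ends are \<open>ginv G g\<close> and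
  \<open>ginv G g'\<close>.\<close>

lemma conj_by_apply:
  assumes \<gamma>: "\<gamma> \<in> bisections G" and g: "g \<in> \<gamma>" "g' \<in> \<gamma>" and h: "h \<in> arrows G" "rng G h = src G g" "src G h = src G g'"
  shows "conj_by G (set_inv G \<gamma>) (gcomp G (gcomp G g h) (ginv G g')) = h"
proof -
  note \<gamma>' = set_inv_bisection(1)[OF \<gamma>]
  have arr: "g \<in> arrows G" "g' \<in> arrows G" using g bisectionD(2)[OF \<gamma>] by auto
  let ?x = "gcomp G (gcomp G g h) (ginv G g')"
  have x: "rng G ?x = rng G g" "src G ?x = rng G g'" using arr h by simp_all
  have i: "inv_into (set_inv G \<gamma>) (src G) (rng G k) = ginv G k" if "k \<in> \<gamma>" for k
    using bisection_src_inv[OF \<gamma>', of "ginv G k"] that bisectionD(2)[OF \<gamma>] by (auto simp: set_inv_def)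
  have "gcomp G (ginv G g) ?x = gcomp G (ginv G g) (gcomp G g (gcomp G h (ginv G g')))"
    using arr h by (simp add: comp_assoc)
  also have "\<dots> = gcomp G h (ginv G g')" using arr h by simp
  finally show ?thesis
    using arr h comp_ginv_cancel_right[of h g'] by (simp add: conj_by_def x i g)
qed

text \<open>At g h ginv g' the left-hand side is e (rng h) b (src h) cnj (e (src h)), and both
  cutoff factors are 1 wherever \<open>b\<close> contributes. So x_e implements the prescribed
  conjugation exactly, without a limit.\<close>

lemma convolution_conj_push:
  assumes \<gamma>: "\<gamma> \<in> bisections G" and U: "U \<in> bisections G" and sub: "supp G U \<subseteq> supp G \<gamma>" "im G U \<subseteq> supp G \<gamma>"
    and e: "\<And>h. h \<in> U \<Longrightarrow> b (src G h) \<noteq> 0 \<Longrightarrow> e (src G h) = 1 \<and> e (rng G h) = 1"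
  shows "convolution G (convolution G (src_lift G \<gamma> e) (src_lift G U b)) (involution G (src_lift G \<gamma> e))
    = conj_push G \<gamma> U (src_lift G U b)"
proof
  note \<gamma>' = set_inv_bisection(1)[OF \<gamma>] and \<gamma>U = set_comp_bisection[OF \<gamma> U]
  fix x
  let ?W = "set_comp G (set_comp G \<gamma> U) (set_inv G \<gamma>)"
  have eq: "convolution G (convolution G (src_lift G \<gamma> e) (src_lift G U b)) (involution G (src_lift G \<gamma> e))
     = src_lift G ?W (\<lambda>x. psi_push G \<gamma> (\<lambda>x. psi_push G (set_inv G U) e x * b x) x * psi_push G \<gamma> (\<lambda>x. cnj (e x)) x)"
    by (simp add: convolution_src_lift[OF \<gamma> U] involution_src_lift[OF \<gamma>] convolution_src_lift[OF \<gamma>U \<gamma>']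
        set_inv_set_inv[OF \<gamma>])
  show "convolution G (convolution G (src_lift G \<gamma> e) (src_lift G U b)) (involution G (src_lift G \<gamma> e)) x
    = conj_push G \<gamma> U (src_lift G U b) x"
  proof (cases "x \<in> ?W")
    case False
    then show ?thesis unfolding eq by (simp add: src_lift_def conj_push_def)
  next
    case True
    then obtain y k where y: "x = gcomp G y k" "y \<in> set_comp G \<gamma> U" "k \<in> set_inv G \<gamma>" "rng G k = src G y"
      "y \<in> arrows G" "k \<in> arrows G" "src G x = src G k"
      using set_compE[OF \<gamma>U \<gamma>'] by metis
    obtain g h where g: "y = gcomp G g h" "g \<in> \<gamma>" "h \<in> U" "rng G h = src G g" "h \<in> arrows G" "src G y = src G h"
      using set_compE[OF \<gamma> U y(2)] by metis
    obtain g' where g': "k = ginv G g'" "g' \<in> \<gamma>" "g' \<in> arrows G"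
      using y(3) bisectionD(2)[OF \<gamma>] by (auto simp: set_inv_def)
    have s: "src G h = src G g'" "src G x = rng G g'" using y g g' by auto
    have "conj_by G (set_inv G \<gamma>) x = h"
      using conj_by_apply[OF \<gamma> g(2) g'(2) g(5,4) s(1)] y(1) g(1) g'(1) by simp
    then have "conj_push G \<gamma> U (src_lift G U b) x = b (src G h)"
      using True g(3) by (simp add: conj_push_def src_lift_apply)
    moreover have "src_lift G ?W (\<lambda>x. psi_push G \<gamma> (\<lambda>x. psi_push G (set_inv G U) e x * b x) x * psi_push G \<gamma> (\<lambda>x. cnj (e x)) x) x
      = (e (rng G h) * b (src G h)) * cnj (e (src G h))"
      using True s(2) g'(2) psi_push_inv_apply[OF U g(3)]
      by (simp add: src_lift_apply psi_push_apply[OF \<gamma>] s(1)[symmetric])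
    ultimately show ?thesis unfolding eq using e[OF g(3)] by (cases "b (src G h) = 0") auto
  qed
qed

end

section \<open>Injectivity on the functions on the unit space\<close>

definition fin_supp :: "('g \<Rightarrow> complex) \<Rightarrow> bool"
  where "fin_supp \<xi> \<longleftrightarrow> finite {x. \<xi> x \<noteq> 0}"

definition l2 :: "('g \<Rightarrow> complex) \<Rightarrow> real"
  where "l2 \<xi> = L2_set (\<lambda>x. cmod (\<xi> x)) {x. \<xi> x \<noteq> 0}"

text \<open>Conjugate linear in the second argument; summing over the support of
  \<open>\<eta>\<close> alone suffices since other terms vanish.\<close>

definition pairing :: "('g \<Rightarrow> complex) \<Rightarrow> ('g \<Rightarrow> complex) \<Rightarrow> complex"
  where "pairing \<xi> \<eta> = (\<Sum>x | \<eta> x \<noteq> 0. \<xi> x * cnj (\<eta> x))"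

lemma l2_nonneg: "0 \<le> l2 \<xi>" by (simp add: l2_def L2_set_nonneg)

lemma l2_eq:
  assumes "finite A" "{x. \<xi> x \<noteq> 0} \<subseteq> A" shows "l2 \<xi> = L2_set (\<lambda>x. cmod (\<xi> x)) A"
  unfolding l2_def L2_set_def using assms by (intro arg_cong[where f = sqrt] sum.mono_neutral_left) auto

lemma l2_add:
  assumes "fin_supp \<xi>" "fin_supp \<eta>" shows "l2 (\<lambda>x. \<xi> x + \<eta> x) \<le> l2 \<xi> + l2 \<eta>"
proof -
  let ?A = "{x. \<xi> x \<noteq> 0} \<union> {x. \<eta> x \<noteq> 0}"
  have A: "finite ?A" using assms by (simp add: fin_supp_def)
  have "l2 (\<lambda>x. \<xi> x + \<eta> x) = L2_set (\<lambda>x. cmod (\<xi> x + \<eta> x)) ?A" by (rule l2_eq[OF A]) auto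
  also have "\<dots> \<le> L2_set (\<lambda>x. cmod (\<xi> x) + cmod (\<eta> x)) ?A"
    by (rule L2_set_mono) (auto simp: norm_triangle_ineq)
  also have "\<dots> \<le> L2_set (\<lambda>x. cmod (\<xi> x)) ?A + L2_set (\<lambda>x. cmod (\<eta> x)) ?A" by (rule L2_set_triangle_ineq)
  also have "\<dots> = l2 \<xi> + l2 \<eta>" using l2_eq[OF A, of \<xi>] l2_eq[OF A, of \<eta>] by auto
  finally show ?thesis .
qed

lemma l2_scale: "l2 (\<lambda>x. c * \<xi> x) = cmod c * l2 \<xi>"
proof (cases "c = 0")
  case False
  then show ?thesis by (simp add: l2_def norm_mult L2_set_right_distrib)
qed (simp add: l2_def)

lemma cmod_pairing_le:
  assumes "fin_supp \<xi>" "fin_supp \<eta>" shows "cmod (pairing \<xi> \<eta>) \<le> l2 \<xi> * l2 \<eta>"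
proof -
  let ?A = "{x. \<xi> x \<noteq> 0} \<union> {x. \<eta> x \<noteq> 0}"
  have A: "finite ?A" using assms by (simp add: fin_supp_def)
  have "pairing \<xi> \<eta> = (\<Sum>x\<in>?A. \<xi> x * cnj (\<eta> x))"
    unfolding pairing_def by (rule sum.mono_neutral_left[OF A]) auto
  also have "cmod \<dots> \<le> (\<Sum>x\<in>?A. \<bar>cmod (\<xi> x)\<bar> * \<bar>cmod (\<eta> x)\<bar>)"
    by (rule order_trans[OF norm_sum]) (simp add: norm_mult)
  also have "\<dots> \<le> L2_set (\<lambda>x. cmod (\<xi> x)) ?A * L2_set (\<lambda>x. cmod (\<eta> x)) ?A" by (rule L2_set_mult_ineq)
  also have "\<dots> = l2 \<xi> * l2 \<eta>" using l2_eq[OF A, of \<xi>] l2_eq[OF A, of \<eta>] by auto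
  finally show ?thesis .
qed

lemma pairing_self: "pairing \<xi> \<xi> = complex_of_real ((l2 \<xi>)\<^sup>2)"
  by (simp add: pairing_def l2_def L2_set_def sum_nonneg complex_norm_square flip: of_real_power)

section \<open>The convolution algebra acting on vectors over the units\<close>

context compact_etale_groupoid begin

text \<open>Makes the sums over range and source fibres finite; it holds on all of
  \<open>C_groupoid G\<close>.\<close>

definition fibre_finite :: "('g \<Rightarrow> complex) \<Rightarrow> bool"
  where "fibre_finite f \<longleftrightarrow> (\<forall>h. f h \<noteq> 0 \<longrightarrow> h \<in> arrows G) \<and>
    (\<forall>x. finite {h. f h \<noteq> 0 \<and> rng G h = x} \<and> finite {h. f h \<noteq> 0 \<and> src G h = x})"

text \<open>The operator sending the point mass at y to the sum of f h times the point mass at rng h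
  over arrows h with source y. Orbits of units are invariant. Vectors are functions on the whole
  type, but only their values at units matter when \<open>f\<close> lives on arrows.\<close>

definition orbit_op :: "('g \<Rightarrow> complex) \<Rightarrow> ('g \<Rightarrow> complex) \<Rightarrow> 'g \<Rightarrow> complex"
  where "orbit_op f \<xi> x = (\<Sum>h | f h \<noteq> 0 \<and> rng G h = x. f h * \<xi> (src G h))"

definition orbit_bounded :: "('g \<Rightarrow> complex) \<Rightarrow> bool"
  where "orbit_bounded f \<longleftrightarrow> (\<exists>C\<ge>0. \<forall>\<xi>. fin_supp \<xi> \<longrightarrow> l2 (orbit_op f \<xi>) \<le> C * l2 \<xi>)"

text \<open>The operator norm, computed on finitely supported vectors so that no completion has to
  be formed; the supremum is meaningful for \<open>orbit_bounded\<close> functions.\<close>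

definition orbit_norm :: "('g \<Rightarrow> complex) \<Rightarrow> real"
  where "orbit_norm f = Sup {l2 (orbit_op f \<xi>) | \<xi>. fin_supp \<xi> \<and> l2 \<xi> \<le> 1}"

lemma orbit_op_scale_vector: "orbit_op f (\<lambda>x. c * \<xi> x) = (\<lambda>x. c * orbit_op f \<xi> x)"
  by (simp add: orbit_op_def sum_distrib_left fun_eq_iff mult.left_commute)

lemma orbit_op_add:
  assumes "fibre_finite f" "fibre_finite f'"
  shows "orbit_op (\<lambda>x. f x + f' x) \<xi> = (\<lambda>x. orbit_op f \<xi> x + orbit_op f' \<xi> x)"
proof
  fix x
  let ?A = "{h. f h \<noteq> 0 \<and> rng G h = x} \<union> {h. f' h \<noteq> 0 \<and> rng G h = x}"
  have A: "finite ?A" using assms by (simp add: fibre_finite_def)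
  have *: "orbit_op k \<xi> x = (\<Sum>h\<in>?A. k h * \<xi> (src G h))"
    if "{h. k h \<noteq> 0 \<and> rng G h = x} \<subseteq> ?A" for k
    unfolding orbit_op_def by (rule sum.mono_neutral_left[OF A that]) auto
  have "orbit_op (\<lambda>x. f x + f' x) \<xi> x = (\<Sum>h\<in>?A. (f h + f' h) * \<xi> (src G h))" by (rule *) auto
  also have "\<dots> = (\<Sum>h\<in>?A. f h * \<xi> (src G h)) + (\<Sum>h\<in>?A. f' h * \<xi> (src G h))"
    by (simp only: distrib_right sum.distrib)
  also have "\<dots> = orbit_op f \<xi> x + orbit_op f' \<xi> x" using *[of f] *[of f'] by simp
  finally show "orbit_op (\<lambda>x. f x + f' x) \<xi> x = orbit_op f \<xi> x + orbit_op f' \<xi> x" .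
qed

lemma orbit_op_scale: "orbit_op (\<lambda>x. c * f x) \<xi> = (\<lambda>x. c * orbit_op f \<xi> x)"
  by (cases "c = 0") (simp_all add: orbit_op_def sum_distrib_left mult.assoc fun_eq_iff)

lemma finite_src_in:
  assumes "fibre_finite f" "finite Y"
  shows "finite {h. f h \<noteq> 0 \<and> src G h \<in> Y}" "finite {h. f h \<noteq> 0 \<and> rng G h \<in> Y}"
proof -
  have "{h. f h \<noteq> 0 \<and> src G h \<in> Y} = (\<Union>y\<in>Y. {h. f h \<noteq> 0 \<and> src G h = y})"
    "{h. f h \<noteq> 0 \<and> rng G h \<in> Y} = (\<Union>y\<in>Y. {h. f h \<noteq> 0 \<and> rng G h = y})" by auto
  then show "finite {h. f h \<noteq> 0 \<and> src G h \<in> Y}" "finite {h. f h \<noteq> 0 \<and> rng G h \<in> Y}"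
    using assms by (simp_all add: fibre_finite_def)
qed

lemma fin_supp_orbit_op:
  assumes f: "fibre_finite f" and \<xi>: "fin_supp \<xi>" shows "fin_supp (orbit_op f \<xi>)"
proof -
  have "{x. orbit_op f \<xi> x \<noteq> 0} \<subseteq> rng G ` {h. f h \<noteq> 0 \<and> src G h \<in> {x. \<xi> x \<noteq> 0}}"
  proof
    fix x assume "x \<in> {x. orbit_op f \<xi> x \<noteq> 0}"
    then have "orbit_op f \<xi> x \<noteq> 0" by simp
    then obtain h where "h \<in> {h. f h \<noteq> 0 \<and> rng G h = x}" "f h * \<xi> (src G h) \<noteq> 0"
      unfolding orbit_op_def by (meson sum.neutral)
    then show "x \<in> rng G ` {h. f h \<noteq> 0 \<and> src G h \<in> {x. \<xi> x \<noteq> 0}}" by auto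
  qed
  then show ?thesis
    using finite_src_in(1)[OF f, of "{x. \<xi> x \<noteq> 0}"] \<xi> finite_surj unfolding fin_supp_def by blast
qed

text \<open>Applying the two operators in turn sums over composable pairs; grouping the pairs by
  their product recovers the convolution.\<close>

lemma orbit_op_convolution:
  assumes f: "fibre_finite f" and f': "fibre_finite f'"
  shows "orbit_op (convolution G f f') \<xi> = orbit_op f (orbit_op f' \<xi>)"
proof
  fix x
  let ?B = "\<lambda>g. {h. f' h \<noteq> 0 \<and> rng G h = src G g}"
  let ?Q = "SIGMA g:{g. f g \<noteq> 0 \<and> rng G g = x}. ?B g"
  let ?m = "\<lambda>(g, h). gcomp G g h"
  let ?t = "\<lambda>(g, h). f g * f' h * \<xi> (src G h)"
  have arr: "f h \<noteq> 0 \<Longrightarrow> h \<in> arrows G" "f' h \<noteq> 0 \<Longrightarrow> h \<in> arrows G" for h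
    using f f' by (auto simp: fibre_finite_def)
  have fin: "finite {g. f g \<noteq> 0 \<and> rng G g = x}" "\<And>g. finite (?B g)"
    using f f' by (auto simp: fibre_finite_def)
  then have finQ: "finite ?Q" by blast
  have "orbit_op f (orbit_op f' \<xi>) x = (\<Sum>g | f g \<noteq> 0 \<and> rng G g = x. \<Sum>h\<in>?B g. ?t (g, h))"
    by (simp add: orbit_op_def sum_distrib_left mult.assoc)
  also have "\<dots> = sum ?t ?Q" using sum.Sigma[of "{g. f g \<noteq> 0 \<and> rng G g = x}" ?B "\<lambda>g h. ?t (g, h)"] fin by simp
  also have "\<dots> = (\<Sum>l\<in>?m ` ?Q. sum ?t {q \<in> ?Q. ?m q = l})"
    by (rule sum.image_gen[OF finQ])
  also have "\<dots> = (\<Sum>l\<in>?m ` ?Q. convolution G f f' l * \<xi> (src G l))"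
  proof (rule sum.cong[OF refl])
    fix l assume "l \<in> ?m ` ?Q"
    then obtain g h where l: "l = gcomp G g h" "f g \<noteq> 0" "f' h \<noteq> 0" "rng G g = x" "rng G h = src G g" by auto
    then have la: "l \<in> arrows G" "rng G l = x" "src G l = src G h" using arr by auto
    have eq: "{q \<in> ?Q. ?m q = l}
        = {(g, h). (g, h) \<in> composable G \<and> gcomp G g h = l \<and> f g \<noteq> 0 \<and> f' h \<noteq> 0}"
      using arr la(2) by auto
    have "sum ?t {q \<in> ?Q. ?m q = l} = (\<Sum>(g, h)\<in>{q \<in> ?Q. ?m q = l}. f g * f' h) * \<xi> (src G l)"
      unfolding sum_distrib_right
    proof (rule sum.cong[OF refl])
      fix q assume "q \<in> {q \<in> ?Q. ?m q = l}"
      then obtain g' h' where "q = (g', h')" "l = gcomp G g' h'" "f g' \<noteq> 0" "f' h' \<noteq> 0" "rng G h' = src G g'"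
        by auto
      then show "?t q = (case q of (g, h) \<Rightarrow> f g * f' h) * \<xi> (src G l)" using arr by simp
    qed
    then show "sum ?t {q \<in> ?Q. ?m q = l} = convolution G f f' l * \<xi> (src G l)"
      unfolding eq convolution_def using la by simp
  qed
  \<comment> \<open>Products at which the convolution cancels to 0 are in the left index set but not
    in the right one; their terms vanish.\<close>
  also have "\<dots> = orbit_op (convolution G f f') \<xi> x"
    unfolding orbit_op_def
  proof (rule sum.mono_neutral_right)
    show "finite (?m ` ?Q)" using finQ by simp
    show "{h. convolution G f f' h \<noteq> 0 \<and> rng G h = x} \<subseteq> ?m ` ?Q"
    proof clarify
      fix l assume l: "convolution G f f' l \<noteq> 0" "x = rng G l"
      then have "(\<Sum>(g, h) | (g, h) \<in> composable G \<and> gcomp G g h = l \<and> f g \<noteq> 0 \<and> f' h \<noteq> 0. f g * f' h) \<noteq> 0"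
        by (simp add: convolution_def split: if_splits)
      then have "{(g, h). (g, h) \<in> composable G \<and> gcomp G g h = l \<and> f g \<noteq> 0 \<and> f' h \<noteq> 0} \<noteq> {}"
        by (metis (no_types, lifting) sum.empty)
      then obtain g h where "(g, h) \<in> composable G" "gcomp G g h = l" "f g \<noteq> 0" "f' h \<noteq> 0" by auto
      then show "l \<in> ?m ` (SIGMA g:{g. f g \<noteq> 0 \<and> rng G g = rng G l}. ?B g)"
        by (intro image_eqI[of _ _ "(g, h)"]) auto
    qed
    show "\<forall>l\<in>?m ` ?Q - {h. convolution G f f' h \<noteq> 0 \<and> rng G h = x}. convolution G f f' l * \<xi> (src G l) = 0"
      using arr by auto
  qed
  finally show "orbit_op (convolution G f f') \<xi> x = orbit_op f (orbit_op f' \<xi>) x" by simp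
qed

text \<open>A sum over arrows that treats source and range symmetrically, so that the adjoint is
  found by inverting arrows.\<close>

lemma pairing_orbit_op:
  assumes f: "fibre_finite f" and \<xi>: "fin_supp \<xi>" and \<eta>: "fin_supp \<eta>"
  shows "pairing (orbit_op f \<xi>) \<eta>
    = (\<Sum>h | f h \<noteq> 0 \<and> \<xi> (src G h) \<noteq> 0 \<and> \<eta> (rng G h) \<noteq> 0. f h * \<xi> (src G h) * cnj (\<eta> (rng G h)))"
proof -
  let ?H = "{h. f h \<noteq> 0 \<and> rng G h \<in> {x. \<eta> x \<noteq> 0}}"
  let ?t = "\<lambda>h. f h * \<xi> (src G h) * cnj (\<eta> (rng G h))"
  have H: "finite ?H" using \<eta> unfolding fin_supp_def by (rule finite_src_in(2)[OF f])
  have "pairing (orbit_op f \<xi>) \<eta> = (\<Sum>x | \<eta> x \<noteq> 0. sum ?t {h \<in> ?H. rng G h = x})"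
    unfolding pairing_def orbit_op_def sum_distrib_right
    by (intro sum.cong refl) auto
  also have "\<dots> = sum ?t ?H"
    using \<eta> by (intro sum.group[OF H]) (auto simp: fin_supp_def)
  also have "\<dots> = (\<Sum>h | f h \<noteq> 0 \<and> \<xi> (src G h) \<noteq> 0 \<and> \<eta> (rng G h) \<noteq> 0. ?t h)"
    by (rule sum.mono_neutral_right[OF H]) auto
  finally show ?thesis .
qed

lemma fibre_finite_involution:
  assumes f: "fibre_finite f" shows "fibre_finite (involution G f)"
proof -
  have arr: "f h \<noteq> 0 \<Longrightarrow> h \<in> arrows G" for h using f by (auto simp: fibre_finite_def)
  have "{h. involution G f h \<noteq> 0 \<and> rng G h = x} \<subseteq> ginv G ` {h. f h \<noteq> 0 \<and> src G h = x}"
    "{h. involution G f h \<noteq> 0 \<and> src G h = x} \<subseteq> ginv G ` {h. f h \<noteq> 0 \<and> rng G h = x}" for x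
    by (auto simp: involution_def split: if_splits intro!: image_eqI[of _ "ginv G" "ginv G _"])
  then have "finite {h. involution G f h \<noteq> 0 \<and> rng G h = x}" "finite {h. involution G f h \<noteq> 0 \<and> src G h = x}" for x
    using f unfolding fibre_finite_def by (meson finite_imageI finite_subset)+
  moreover have "involution G f h \<noteq> 0 \<Longrightarrow> h \<in> arrows G" for h by (simp add: involution_def split: if_splits)
  ultimately show ?thesis unfolding fibre_finite_def by blast
qed

text \<open>Substitute \<open>ginv G h\<close> for \<open>h\<close>, which exchanges the roles of
  source and range.\<close>

lemma orbit_op_adjoint:
  assumes f: "fibre_finite f" and \<xi>: "fin_supp \<xi>" and \<eta>: "fin_supp \<eta>"
  shows "pairing (orbit_op f \<xi>) \<eta> = cnj (pairing (orbit_op (involution G f) \<eta>) \<xi>)"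
proof -
  have arr: "f h \<noteq> 0 \<Longrightarrow> h \<in> arrows G" for h using f by (auto simp: fibre_finite_def)
  have "(\<Sum>h | f h \<noteq> 0 \<and> \<xi> (src G h) \<noteq> 0 \<and> \<eta> (rng G h) \<noteq> 0. f h * \<xi> (src G h) * cnj (\<eta> (rng G h)))
    = (\<Sum>h | involution G f h \<noteq> 0 \<and> \<eta> (src G h) \<noteq> 0 \<and> \<xi> (rng G h) \<noteq> 0.
        cnj (involution G f h * \<eta> (src G h) * cnj (\<xi> (rng G h))))"
    by (rule sum.reindex_bij_witness[where i = "ginv G" and j = "ginv G"])
       (auto simp: involution_def arr split: if_splits)
  then show ?thesis
    unfolding pairing_orbit_op[OF f \<xi> \<eta>] pairing_orbit_op[OF fibre_finite_involution[OF f] \<eta> \<xi>] by simp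
qed

lemma bdd_above_orbit:
  assumes "orbit_bounded f" shows "bdd_above {l2 (orbit_op f \<xi>) | \<xi>. fin_supp \<xi> \<and> l2 \<xi> \<le> 1}"
proof -
  obtain C where C: "C \<ge> 0" "\<And>\<xi>. fin_supp \<xi> \<Longrightarrow> l2 (orbit_op f \<xi>) \<le> C * l2 \<xi>"
    using assms(1) by (auto simp: orbit_bounded_def)
  show ?thesis
    using C(2) mult_left_mono[OF _ C(1), of _ 1] by (intro bdd_aboveI[of _ C]) force
qed

lemma orbit_norm_upper:
  assumes "orbit_bounded f" "fin_supp \<xi>" shows "l2 (orbit_op f \<xi>) \<le> orbit_norm f * l2 \<xi>"
proof -
  obtain C where C: "C \<ge> 0" "\<And>\<xi>. fin_supp \<xi> \<Longrightarrow> l2 (orbit_op f \<xi>) \<le> C * l2 \<xi>"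
    using assms(1) by (auto simp: orbit_bounded_def)
  show ?thesis
  proof (cases "l2 \<xi> = 0")
    case True
    then show ?thesis using C(2)[OF assms(2)] by simp
  next
    case False
    then have pos: "l2 \<xi> > 0" using l2_nonneg[of \<xi>] by simp
    let ?c = "complex_of_real (1 / l2 \<xi>)"
    have c: "cmod ?c = 1 / l2 \<xi>" using pos by (simp only: norm_of_real) simp
    have "l2 (\<lambda>x. ?c * \<xi> x) \<le> 1" unfolding l2_scale c using pos by simp
    moreover have "fin_supp (\<lambda>x. ?c * \<xi> x)" using assms(2) pos by (simp add: fin_supp_def)
    ultimately have "l2 (orbit_op f (\<lambda>x. ?c * \<xi> x)) \<le> orbit_norm f"
      unfolding orbit_norm_def by (intro cSup_upper[OF _ bdd_above_orbit[OF assms(1)]]) blast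
    then have "(1 / l2 \<xi>) * l2 (orbit_op f \<xi>) \<le> orbit_norm f" by (simp only: orbit_op_scale_vector l2_scale c)
    then show ?thesis using pos by (simp add: divide_simps)
  qed
qed

lemma orbit_norm_least:
  assumes "C \<ge> 0" "\<And>\<xi>. fin_supp \<xi> \<Longrightarrow> l2 (orbit_op f \<xi>) \<le> C * l2 \<xi>" shows "orbit_norm f \<le> C"
  unfolding orbit_norm_def
proof (rule cSup_least)
  show "{l2 (orbit_op f \<xi>) | \<xi>. fin_supp \<xi> \<and> l2 \<xi> \<le> 1} \<noteq> {}"
    by (auto intro!: exI[of _ "\<lambda>_. 0"] simp: fin_supp_def l2_def)
  fix r assume "r \<in> {l2 (orbit_op f \<xi>) | \<xi>. fin_supp \<xi> \<and> l2 \<xi> \<le> 1}"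
  then obtain \<xi> where "r = l2 (orbit_op f \<xi>)" "fin_supp \<xi>" "l2 \<xi> \<le> 1" by blast
  then show "r \<le> C" using assms(2)[of \<xi>] mult_left_mono[of "l2 \<xi>" 1 C] assms(1) by simp
qed

lemma orbit_norm_nonneg: assumes "orbit_bounded f" shows "0 \<le> orbit_norm f"
proof -
  have "l2 (orbit_op f (\<lambda>_. 0)) \<le> orbit_norm f"
    unfolding orbit_norm_def by (rule cSup_upper[OF _ bdd_above_orbit[OF assms]]) (auto simp: fin_supp_def l2_def intro!: exI[of _ "\<lambda>_. 0"])
  then show ?thesis using l2_nonneg order_trans by blast
qed

lemma Cc_fibre_finite:
  assumes U: "U \<in> bisections G" and F: "F \<in> Cc G U" shows "fibre_finite F"
proof -
  have zero: "x \<in> U" if "F x \<noteq> 0" for x using F that by (auto simp: Cc_def)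
  have "{h. F h \<noteq> 0 \<and> rng G h = x} \<subseteq> {inv_into U (rng G) x}"
    "{h. F h \<noteq> 0 \<and> src G h = x} \<subseteq> {inv_into U (src G) x}" for x
    using zero bisection_rng_inv[OF U] bisection_src_inv[OF U] by auto
  then have "finite {h. F h \<noteq> 0 \<and> rng G h = x}" "finite {h. F h \<noteq> 0 \<and> src G h = x}" for x
    by (meson finite.emptyI finite.insertI finite_subset)+
  then show ?thesis using zero bisectionD(2)[OF U] by (auto simp: fibre_finite_def)
qed

text \<open>A function on a bisection acts as a weighted partial permutation: the value at rng g is
  F g times the value of the vector at src g. The supremum of the weights therefore bounds the
  operator.\<close>

lemma Cc_orbit_bounded:
  assumes U: "U \<in> bisections G" and F: "F \<in> Cc G U" shows "orbit_bounded F"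
proof -
  obtain b where b: "b \<in> Cc G (supp G U)" "F = src_lift G U b" using Cc_eq_src_lift[OF U F] .
  have "b \<in> C_unit G" using b(1) Cc_units_iff[OF bisectionD(5)[OF U]] by simp
  then obtain M where M: "\<And>x. norm (b x) \<le> M" "M > 0" using C_unit_bounded by blast
  have zero: "x \<in> U" if "F x \<noteq> 0" for x using F that by (auto simp: Cc_def)
  have op: "orbit_op F \<xi> (rng G g) = F g * \<xi> (src G g)" if g: "g \<in> U" for \<xi> g
  proof -
    have "{h. F h \<noteq> 0 \<and> rng G h = rng G g} = (if F g \<noteq> 0 then {g} else {})"
      using zero g rng_eq_in_bisection[OF U] by auto
    then show ?thesis by (simp add: orbit_op_def)
  qed
  have op0: "orbit_op F \<xi> x = 0" if "x \<notin> im G U" for \<xi> x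
  proof -
    have "{h. F h \<noteq> 0 \<and> rng G h = x} = {}" using zero that by auto
    then show ?thesis unfolding orbit_op_def by (simp only: sum.empty)
  qed
  have "l2 (orbit_op F \<xi>) \<le> M * l2 \<xi>" if \<xi>: "fin_supp \<xi>" for \<xi>
  proof -
    let ?S = "{x. orbit_op F \<xi> x \<noteq> 0}" and ?\<tau> = "\<lambda>x. src G (inv_into U (rng G) x)"
    have S: "?S \<subseteq> im G U" using op0 by blast
    have le: "cmod (orbit_op F \<xi> x) \<le> M * cmod (\<xi> (?\<tau> x))" if x: "x \<in> ?S" for x
    proof -
      obtain g where g: "g \<in> U" "x = rng G g" using subsetD[OF S x] by blast
      then show ?thesis
        using op[OF g(1), of \<xi>] M(1)[of "src G g"] bisection_rng_inv[OF U g(1)]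
        by (simp add: b(2) src_lift_apply norm_mult mult_right_mono)
    qed
    \<comment> \<open>Injectivity lets the sum be reindexed, so each entry of \<open>\<xi>\<close>
      is counted at most once.\<close>
    have inj: "inj_on ?\<tau> ?S"
    proof (rule inj_onI)
      fix x y assume xy: "x \<in> ?S" "y \<in> ?S" "?\<tau> x = ?\<tau> y"
      obtain g where g: "g \<in> U" "x = rng G g" using subsetD[OF S xy(1)] by blast
      obtain h where h: "h \<in> U" "y = rng G h" using subsetD[OF S xy(2)] by blast
      have "src G g = src G h" using xy(3) unfolding g(2) h(2) bisection_rng_inv[OF U g(1)] bisection_rng_inv[OF U h(1)] .
      then show "x = y" using src_eq_in_bisection[OF U g(1) h(1)] g(2) h(2) by simp
    qed
    have sub: "?\<tau> ` ?S \<subseteq> {x. \<xi> x \<noteq> 0}" using le by force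
    have "l2 (orbit_op F \<xi>) \<le> L2_set (\<lambda>x. M * cmod (\<xi> (?\<tau> x))) ?S"
      unfolding l2_def by (rule L2_set_mono) (use le in auto)
    also have "\<dots> = M * L2_set (\<lambda>x. cmod (\<xi> (?\<tau> x))) ?S"
      using M(2) by (simp add: L2_set_right_distrib)
    also have "L2_set (\<lambda>x. cmod (\<xi> (?\<tau> x))) ?S = L2_set (\<lambda>y. cmod (\<xi> y)) (?\<tau> ` ?S)"
      unfolding L2_set_def sum.reindex[OF inj] by (simp add: o_def)
    also have "\<dots> \<le> l2 \<xi>"
      unfolding l2_def L2_set_def using \<xi> sub
      by (intro real_sqrt_le_mono sum_mono2) (auto simp: fin_supp_def)
    finally show ?thesis using M(2) by simp
  qed
  then show ?thesis unfolding orbit_bounded_def using M(2) less_imp_le by blast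
qed

lemma C_groupoid_orbit:
  assumes "f \<in> C_groupoid G" shows "fibre_finite f" "orbit_bounded f"
proof -
  have "fibre_finite f \<and> orbit_bounded f"
    using assms
  proof (induction rule: C_groupoid_induct)
    case zero
    show ?case
      by (auto simp: fibre_finite_def orbit_bounded_def orbit_op_def l2_def intro!: exI[of _ 0])
  next
    case (add f U F)
    then have f: "fibre_finite f" "orbit_bounded f" by auto
    note F = Cc_fibre_finite[OF add.hyps(2,3)] Cc_orbit_bounded[OF add.hyps(2,3)]
    have "{h. f h + F h \<noteq> 0 \<and> rng G h = x} \<subseteq> {h. f h \<noteq> 0 \<and> rng G h = x} \<union> {h. F h \<noteq> 0 \<and> rng G h = x}"
      "{h. f h + F h \<noteq> 0 \<and> src G h = x} \<subseteq> {h. f h \<noteq> 0 \<and> src G h = x} \<union> {h. F h \<noteq> 0 \<and> src G h = x}" for x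
      by auto
    then have "finite {h. f h + F h \<noteq> 0 \<and> rng G h = x}" "finite {h. f h + F h \<noteq> 0 \<and> src G h = x}" for x
      using f(1) F(1) unfolding fibre_finite_def by (meson finite_UnI finite_subset)+
    moreover have "h \<in> arrows G" if "f h + F h \<noteq> 0" for h
      using that f(1) F(1) unfolding fibre_finite_def by (cases "f h = 0") auto
    ultimately have 1: "fibre_finite (\<lambda>x. f x + F x)" by (auto simp: fibre_finite_def)
    have "l2 (orbit_op (\<lambda>x. f x + F x) \<xi>) \<le> (orbit_norm f + orbit_norm F) * l2 \<xi>" if "fin_supp \<xi>" for \<xi>
      unfolding orbit_op_add[OF f(1) F(1)]
      using l2_add[OF fin_supp_orbit_op[OF f(1) that] fin_supp_orbit_op[OF F(1) that]]
        orbit_norm_upper[OF f(2) that] orbit_norm_upper[OF F(2) that] by (simp add: distrib_right)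
    then have "orbit_bounded (\<lambda>x. f x + F x)"
      unfolding orbit_bounded_def using orbit_norm_nonneg f(2) F(2)
      by (intro exI[of _ "orbit_norm f + orbit_norm F"]) auto
    with 1 show ?case by blast
  qed
  then show "fibre_finite f" "orbit_bounded f" by auto
qed

text \<open>Write T for the operator of \<open>f\<close>. The squared norm of T* \<eta> is the
  pairing of T T* \<eta> with \<eta>, hence at most the norm of T times those of T* \<eta> and
  \<eta>; cancel one factor.\<close>

lemma l2_orbit_involution_le:
  assumes f: "fibre_finite f" "orbit_bounded f" and \<eta>: "fin_supp \<eta>"
  shows "l2 (orbit_op (involution G f) \<eta>) \<le> orbit_norm f * l2 \<eta>"
proof -
  let ?\<zeta> = "orbit_op (involution G f) \<eta>"
  have \<zeta>: "fin_supp ?\<zeta>" by (rule fin_supp_orbit_op[OF fibre_finite_involution[OF f(1)] \<eta>])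
  have "(l2 ?\<zeta>)\<^sup>2 = cmod (pairing ?\<zeta> ?\<zeta>)" unfolding pairing_self by (simp only: norm_of_real) simp
  also have "\<dots> = cmod (pairing (orbit_op f ?\<zeta>) \<eta>)" using orbit_op_adjoint[OF f(1) \<zeta> \<eta>] by simp
  also have "\<dots> \<le> l2 (orbit_op f ?\<zeta>) * l2 \<eta>" by (rule cmod_pairing_le[OF fin_supp_orbit_op[OF f(1) \<zeta>] \<eta>])
  also have "\<dots> \<le> (orbit_norm f * l2 ?\<zeta>) * l2 \<eta>"
    by (rule mult_right_mono[OF orbit_norm_upper[OF f(2) \<zeta>] l2_nonneg])
  finally have "l2 ?\<zeta> * l2 ?\<zeta> \<le> l2 ?\<zeta> * (orbit_norm f * l2 \<eta>)" by (simp add: power2_eq_square mult_ac)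
  then show ?thesis
    using l2_nonneg[of ?\<zeta>] orbit_norm_nonneg[OF f(2)] l2_nonneg[of \<eta>] by (cases "l2 ?\<zeta> = 0") auto
qed

lemma cstar_seminorm_orbit_norm: "cstar_seminorm G orbit_norm"
  unfolding cstar_seminorm_def
proof (intro conjI ballI allI)
  fix f assume "f \<in> C_groupoid G"
  note f = C_groupoid_orbit[OF this]
  show nn: "0 \<le> orbit_norm f" by (rule orbit_norm_nonneg[OF f(2)])
  {
    fix f' assume "f' \<in> C_groupoid G"
    note f' = C_groupoid_orbit[OF this]
    note nn' = orbit_norm_nonneg[OF f'(2)]
    show "orbit_norm (\<lambda>x. f x + f' x) \<le> orbit_norm f + orbit_norm f'"
    proof (rule orbit_norm_least)
      fix \<xi> :: "'g \<Rightarrow> complex" assume \<xi>: "fin_supp \<xi>"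
      show "l2 (orbit_op (\<lambda>x. f x + f' x) \<xi>) \<le> (orbit_norm f + orbit_norm f') * l2 \<xi>"
        unfolding orbit_op_add[OF f(1) f'(1)]
        using l2_add[OF fin_supp_orbit_op[OF f(1) \<xi>] fin_supp_orbit_op[OF f'(1) \<xi>]]
          orbit_norm_upper[OF f(2) \<xi>] orbit_norm_upper[OF f'(2) \<xi>] by (simp add: distrib_right)
    qed (use nn nn' in simp)
    show "orbit_norm (convolution G f f') \<le> orbit_norm f * orbit_norm f'"
    proof (rule orbit_norm_least)
      fix \<xi> :: "'g \<Rightarrow> complex" assume \<xi>: "fin_supp \<xi>"
      have "l2 (orbit_op (convolution G f f') \<xi>) \<le> orbit_norm f * l2 (orbit_op f' \<xi>)"
        unfolding orbit_op_convolution[OF f(1) f'(1)]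
        by (rule orbit_norm_upper[OF f(2) fin_supp_orbit_op[OF f'(1) \<xi>]])
      also have "\<dots> \<le> orbit_norm f * (orbit_norm f' * l2 \<xi>)"
        by (rule mult_left_mono[OF orbit_norm_upper[OF f'(2) \<xi>] nn])
      finally show "l2 (orbit_op (convolution G f f') \<xi>) \<le> orbit_norm f * orbit_norm f' * l2 \<xi>"
        by (simp add: mult.assoc)
    qed (use nn nn' in simp)
  }
  have scale_le: "orbit_norm (\<lambda>x. c * f x) \<le> cmod c * orbit_norm f" if "orbit_bounded f" for c f
    using orbit_norm_nonneg[OF that] orbit_norm_upper[OF that]
    by (intro orbit_norm_least) (auto simp: orbit_op_scale l2_scale mult.assoc mult_left_mono)
  show "orbit_norm (\<lambda>x. c * f x) = cmod c * orbit_norm f" for c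
  proof (cases "c = 0")
    case True
    have "orbit_bounded (\<lambda>x. 0 * f x)"
      by (auto simp: orbit_bounded_def orbit_op_def l2_def intro!: exI[of _ 0])
    then show ?thesis using scale_le[OF f(2), of c] orbit_norm_nonneg True by fastforce
  next
    case False
    have "orbit_bounded (\<lambda>x. c * f x)"
      unfolding orbit_bounded_def orbit_op_scale l2_scale
      using orbit_norm_upper[OF f(2)] nn
      by (intro exI[of _ "cmod c * orbit_norm f"]) (auto simp: mult.assoc mult_left_mono)
    \<comment> \<open>The reverse inequality is the upper estimate applied to
      \<open>inverse c\<close>.\<close>
    then have "orbit_norm (\<lambda>x. inverse c * (c * f x)) \<le> cmod (inverse c) * orbit_norm (\<lambda>x. c * f x)"
      by (rule scale_le)
    moreover have "(\<lambda>x. inverse c * (c * f x)) = f" using False by (simp add: mult.assoc[symmetric])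
    ultimately have "cmod c * orbit_norm f \<le> orbit_norm (\<lambda>x. c * f x)"
      using False by (simp add: norm_divide divide_simps mult.commute)
    then show ?thesis using scale_le[OF f(2), of c] by simp
  qed
  let ?c = "convolution G (involution G f) f"
  note fi = fibre_finite_involution[OF f(1)]
  have le: "l2 (orbit_op ?c \<xi>) \<le> (orbit_norm f)\<^sup>2 * l2 \<xi>" if \<xi>: "fin_supp \<xi>" for \<xi>
  proof -
    have "l2 (orbit_op ?c \<xi>) \<le> orbit_norm f * l2 (orbit_op f \<xi>)"
      unfolding orbit_op_convolution[OF fi f(1)]
      by (rule l2_orbit_involution_le[OF f fin_supp_orbit_op[OF f(1) \<xi>]])
    also have "\<dots> \<le> orbit_norm f * (orbit_norm f * l2 \<xi>)"
      by (rule mult_left_mono[OF orbit_norm_upper[OF f(2) \<xi>] nn])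
    finally show ?thesis by (simp add: power2_eq_square mult.assoc)
  qed
  have bc: "orbit_bounded ?c"
    unfolding orbit_bounded_def using le by (intro exI[of _ "(orbit_norm f)\<^sup>2"]) auto
  \<comment> \<open>The nontrivial half of the C*-identity: the squared length of the image of
    \<open>\<xi>\<close> is a pairing of \<open>orbit_op ?c \<xi>\<close> with
    \<open>\<xi>\<close>.\<close>
  have "orbit_norm f \<le> sqrt (orbit_norm ?c)"
  proof (rule orbit_norm_least)
    fix \<xi> :: "'g \<Rightarrow> complex" assume \<xi>: "fin_supp \<xi>"
    let ?\<eta> = "orbit_op f \<xi>"
    have \<eta>: "fin_supp ?\<eta>" by (rule fin_supp_orbit_op[OF f(1) \<xi>])
    have "(l2 ?\<eta>)\<^sup>2 = cmod (pairing ?\<eta> ?\<eta>)" unfolding pairing_self by (simp only: norm_of_real) simp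
    also have "\<dots> = cmod (pairing (orbit_op ?c \<xi>) \<xi>)"
      using orbit_op_adjoint[OF f(1) \<xi> \<eta>] by (simp add: orbit_op_convolution[OF fi f(1)])
    also have "\<dots> \<le> l2 (orbit_op ?c \<xi>) * l2 \<xi>"
      unfolding orbit_op_convolution[OF fi f(1)]
      by (rule cmod_pairing_le[OF fin_supp_orbit_op[OF fi \<eta>] \<xi>])
    also have "\<dots> \<le> (orbit_norm ?c * l2 \<xi>) * l2 \<xi>"
      by (rule mult_right_mono[OF orbit_norm_upper[OF bc \<xi>] l2_nonneg])
    also have "\<dots> = (sqrt (orbit_norm ?c) * l2 \<xi>)\<^sup>2"
      using orbit_norm_nonneg[OF bc] by (simp add: power_mult_distrib power2_eq_square)
    finally show "l2 ?\<eta> \<le> sqrt (orbit_norm ?c) * l2 \<xi>"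
      by (rule power2_le_imp_le) (intro mult_nonneg_nonneg real_sqrt_ge_zero orbit_norm_nonneg[OF bc] l2_nonneg)
  qed (use orbit_norm_nonneg[OF bc] in simp)
  then have "(orbit_norm f)\<^sup>2 \<le> (sqrt (orbit_norm ?c))\<^sup>2" using nn by (rule power_mono)
  then have "(orbit_norm f)\<^sup>2 \<le> orbit_norm ?c" using orbit_norm_nonneg[OF bc] by simp
  moreover have "orbit_norm ?c \<le> (orbit_norm f)\<^sup>2" by (rule orbit_norm_least[OF _ le]) simp
  ultimately show "orbit_norm ?c = (orbit_norm f)\<^sup>2" by simp
qed

text \<open>Functions on the units act by multiplication, so the point mass at \<open>x\<close> is
  an eigenvector with eigenvalue \<open>f x\<close>.\<close>

lemma orbit_norm_ge:
  assumes f: "f \<in> C_unit G" shows "cmod (f x) \<le> orbit_norm f"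
proof (cases "f x = 0")
  case True
  then show ?thesis using orbit_norm_nonneg[OF C_groupoid_orbit(2)] f C_unit_subset_C_groupoid by auto
next
  case False
  then have x: "x \<in> units G" using C_unit_zero[OF f] by blast
  let ?\<xi> = "\<lambda>y. if y = x then 1 else 0 :: complex"
  have s: "{y. ?\<xi> y \<noteq> 0} = {x}" by auto
  have fs: "fin_supp ?\<xi>" unfolding fin_supp_def s by simp
  have "l2 ?\<xi> = 1" unfolding l2_def s by simp
  moreover have "orbit_op f ?\<xi> y = (if y = x then f x else 0)" for y
  proof -
    have "{h. f h \<noteq> 0 \<and> rng G h = y} = (if f y \<noteq> 0 then {y} else {})"
      using C_unit_zero[OF f] unitsD by force
    moreover have "f y \<noteq> 0 \<Longrightarrow> src G y = y" using C_unit_zero[OF f] unitsD by blast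
    ultimately show ?thesis by (auto simp: orbit_op_def)
  qed
  then have "orbit_op f ?\<xi> = (\<lambda>y. f x * ?\<xi> y)" by auto
  then have "l2 (orbit_op f ?\<xi>) = cmod (f x) * l2 ?\<xi>" by (simp only: l2_scale)
  ultimately show ?thesis
    using orbit_norm_upper[OF C_groupoid_orbit(2) fs, of f] f C_unit_subset_C_groupoid by auto
qed

end

section \<open>Representations of the convolution algebra\<close>

lemma ex_tendsto_closure:
  fixes T :: "'e \<Rightarrow> 'a::real_normed_vector \<Rightarrow> 'b::banach"
  assumes F: "F \<noteq> bot" and diff: "\<And>e x y. T e (x - y) = T e x - T e y"
    and bound: "eventually (\<lambda>e. \<forall>x. norm (T e x) \<le> C * norm x) F" and C: "C \<ge> 0"
    and lim: "\<And>x. x \<in> D \<Longrightarrow> ((\<lambda>e. T e x) \<longlongrightarrow> L x) F" and a: "a \<in> closure D"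
  shows "\<exists>b\<in>closure (L ` D). ((\<lambda>e. T e a) \<longlongrightarrow> b) F"
proof -
  obtain u where u: "\<And>n. u n \<in> D" "u \<longlonglongrightarrow> a" using a by (auto simp: closure_sequential)
  have le: "norm (L x - L y) \<le> C * norm (x - y)" if "x \<in> D" "y \<in> D" for x y
  proof (rule tendsto_upperbound[OF _ _ F])
    show "((\<lambda>e. norm (T e x - T e y)) \<longlongrightarrow> norm (L x - L y)) F"
      by (intro tendsto_norm tendsto_diff lim that)
    show "eventually (\<lambda>e. norm (T e x - T e y) \<le> C * norm (x - y)) F"
      using bound by eventually_elim (metis diff)
  qed
  have "Cauchy (\<lambda>n. L (u n))"
  proof (rule metric_CauchyI)
    fix \<epsilon> :: real assume \<epsilon>: "\<epsilon> > 0"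
    \<comment> \<open>\<open>C + 1\<close> in place of \<open>C\<close> because \<open>C\<close> may
      be 0.\<close>
    then have "\<epsilon> / (C + 1) > 0" using C by simp
    then obtain N where N: "\<And>m n. m \<ge> N \<Longrightarrow> n \<ge> N \<Longrightarrow> dist (u m) (u n) < \<epsilon> / (C + 1)"
      using metric_CauchyD[OF LIMSEQ_imp_Cauchy[OF u(2)]] by meson
    have "dist (L (u m)) (L (u n)) < \<epsilon>" if "m \<ge> N" "n \<ge> N" for m n
    proof -
      have "dist (L (u m)) (L (u n)) \<le> C * norm (u m - u n)" using le u(1) by (simp add: dist_norm)
      also have "\<dots> \<le> (C + 1) * norm (u m - u n)" by (simp add: mult_right_mono)
      also have "\<dots> < \<epsilon>" using N[OF that] C by (simp add: dist_norm pos_less_divide_eq mult.commute)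
      finally show ?thesis .
    qed
    then show "\<exists>N. \<forall>m\<ge>N. \<forall>n\<ge>N. dist (L (u m)) (L (u n)) < \<epsilon>" by blast
  qed
  then obtain b where b: "(\<lambda>n. L (u n)) \<longlonglongrightarrow> b" using Cauchy_convergent convergent_def by blast
  have "((\<lambda>e. T e a) \<longlongrightarrow> b) F"
  proof (rule tendstoI)
    fix \<epsilon> :: real assume \<epsilon>: "\<epsilon> > 0"
    have "(\<lambda>n. C * norm (a - u n) + dist (L (u n)) b) \<longlonglongrightarrow> C * norm (a - a) + dist b b"
      by (intro tendsto_intros u(2) b)
    then have "eventually (\<lambda>n. C * norm (a - u n) + dist (L (u n)) b < \<epsilon> / 2) sequentially"
      using \<epsilon> by (intro order_tendstoD(2)) auto
    then obtain n where n: "C * norm (a - u n) + dist (L (u n)) b < \<epsilon> / 2"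
      by (auto dest: eventually_happens'[OF sequentially_bot])
    have "eventually (\<lambda>e. dist (T e (u n)) (L (u n)) < \<epsilon> / 2) F"
      using tendstoD[OF lim[OF u(1)]] half_gt_zero[OF \<epsilon>] by blast
    then show "eventually (\<lambda>e. dist (T e a) b < \<epsilon>) F"
      using bound
    proof eventually_elim
      case (elim e)
      have "dist (T e a) (T e (u n)) \<le> C * norm (a - u n)"
        using elim(2) by (metis diff dist_norm)
      then show ?case
        using elim(1) n dist_triangle[of "T e a" b "T e (u n)"] dist_triangle[of "T e (u n)" b "L (u n)"]
        by linarith
    qed
  qed
  moreover have "b \<in> closure (L ` D)"
    unfolding closure_sequential using b u(1) by (intro exI[of _ "\<lambda>n. L (u n)"]) auto
  ultimately show ?thesis by blast
qed

text \<open>The operators T e - id have bound 2 and tend to 0 on the span, hence on its closure by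
  the preceding extension result. Applied to left and right multiplication by cutoffs.\<close>

lemma closure_span_tendsto_id:
  fixes T :: "'e \<Rightarrow> 'a::banach \<Rightarrow> 'a"
  assumes F: "F \<noteq> bot" and lin: "\<And>e. linear (T e)"
    and bound: "eventually (\<lambda>e. \<forall>x. norm (T e x) \<le> norm x) F"
    and gen: "\<And>x. x \<in> S \<Longrightarrow> ((\<lambda>e. T e x) \<longlongrightarrow> x) F" and a: "a \<in> closure (span S)"
  shows "((\<lambda>e. T e a) \<longlongrightarrow> a) F"
proof -
  have "subspace {x. ((\<lambda>e. T e x) \<longlongrightarrow> x) F}"
    unfolding subspace_def
    by (auto simp: linear_0[OF lin] linear_add[OF lin] linear_scale[OF lin] intro!: tendsto_intros)
  then have sp: "((\<lambda>e. T e x) \<longlongrightarrow> x) F" if "x \<in> span S" for x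
    using span_minimal[of S "{x. ((\<lambda>e. T e x) \<longlongrightarrow> x) F}"] gen that by auto
  have "\<exists>b\<in>closure ((\<lambda>_. 0) ` span S). ((\<lambda>e. T e a - a) \<longlongrightarrow> b) F"
  proof (rule ex_tendsto_closure[OF F _ _ _ _ a, where C = 2])
    show "eventually (\<lambda>e. \<forall>x. norm (T e x - x) \<le> 2 * norm x) F"
      using bound
    proof eventually_elim
      case (elim e)
      show ?case
      proof
        fix x show "norm (T e x - x) \<le> 2 * norm x"
          using norm_triangle_ineq4[of "T e x" x] elim[rule_format, of x] by simp
      qed
    qed
  qed (auto simp: linear_diff[OF lin] LIM_zero sp)
  then have "((\<lambda>e. T e a - a) \<longlongrightarrow> 0) F"
    using closure_mono[of "(\<lambda>_. 0) ` span S" "{0 :: 'a}"] by force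
  then show ?thesis by (rule LIM_zero_cancel)
qed

lemma mult_left_le_norm: "norm (u::'a::real_normed_algebra) \<le> 1 \<Longrightarrow> norm (u * x) \<le> norm x"
  by (rule order_trans[OF norm_mult_ineq]) (simp add: mult_left_le_one_le)

lemma mult_right_le_norm: "norm (u::'a::real_normed_algebra) \<le> 1 \<Longrightarrow> norm (x * u) \<le> norm x"
  by (rule order_trans[OF norm_mult_ineq]) (simp add: mult_right_le_one_le)

lemma contractions_agree_on_closure:
  fixes f g :: "'a::real_normed_vector \<Rightarrow> 'b::real_normed_vector"
  assumes "\<And>x y. x \<in> S \<Longrightarrow> y \<in> S \<Longrightarrow> norm (f x - f y) \<le> norm (x - y)"
    and "\<And>x y. x \<in> S \<Longrightarrow> y \<in> S \<Longrightarrow> norm (g x - g y) \<le> norm (x - y)"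
    and "D \<subseteq> S" "\<And>x. x \<in> D \<Longrightarrow> f x = g x" "a \<in> S" "a \<in> closure D"
  shows "f a = g a"
proof -
  have "norm (f a - g a) \<le> 0"
  proof (rule field_le_epsilon)
    fix \<epsilon> :: real assume "\<epsilon> > 0"
    then obtain d where d: "d \<in> D" "norm (d - a) < \<epsilon> / 2"
      using assms(6) closure_approachable[of a D] by (metis dist_norm half_gt_zero)
    have "norm (f a - f d) \<le> norm (a - d)" "norm (g a - g d) \<le> norm (a - d)" "f d = g d"
      using assms d by blast+
    then have "norm (f a - g a) \<le> norm (a - d) + norm (a - d)"
      using norm_triangle_le_diff[of "f a - f d" "g a - g d" "norm (a - d) + norm (a - d)"] by simp
    then show "norm (f a - g a) \<le> 0 + \<epsilon>" using d(2) by (simp add: norm_minus_commute)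
  qed
  then show ?thesis by simp
qed

lemma star_hom_on_diff:
  assumes S: "closed_star_subalgebra S" and \<phi>: "star_hom_on S (+) scaleC (*) star \<phi>" and x: "x \<in> S" "y \<in> S"
  shows "\<phi> (x - y) = \<phi> x - \<phi> y"
proof -
  have "\<phi> (x - y + y) = \<phi> (x - y) + \<phi> y"
    using \<phi> x closed_star_subalgebra_diff[OF S x] unfolding star_hom_on_def by blast
  then show ?thesis by simp
qed

lemma star_hom_on_scaleR:
  assumes "star_hom_on S (+) scaleC (*) star \<phi>" "x \<in> S" shows "\<phi> (t *\<^sub>R x) = t *\<^sub>R \<phi> x"
  using assms by (metis star_hom_on_def scaleC_of_real)

lemma star_hom_contraction:
  assumes S: "closed_star_subalgebra S" and \<phi>: "star_hom_on S (+) scaleC (*) star \<phi>" and x: "x \<in> S" "y \<in> S"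
  shows "norm (\<phi> x - \<phi> y) \<le> norm (x - y)"
  using star_hom_contractive[OF S \<phi> closed_star_subalgebra_diff[OF S x]] star_hom_on_diff[OF S \<phi> x] by simp

text \<open>The set of agreement is a real subspace, and contractivity carries agreement from the
  span to its closure. Uniqueness and equivariance are all reduced to generators in this
  way.\<close>

lemma star_homs_agree:
  assumes S: "closed_star_subalgebra S" and \<phi>: "star_hom_on S (+) scaleC (*) star \<phi>"
    and \<psi>: "star_hom_on S (+) scaleC (*) star \<psi>"
    and D: "D \<subseteq> S" "S \<subseteq> closure (span D)" "\<And>x. x \<in> D \<Longrightarrow> \<phi> x = \<psi> x" and a: "a \<in> S"
  shows "\<phi> a = \<psi> a"
proof -
  have subS: "subspace S"
    using S closed_star_subalgebra_scaleR[OF S] by (auto simp: subspace_def closed_star_subalgebra_def)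
  have "subspace {x \<in> S. \<phi> x = \<psi> x}"
    unfolding subspace_def
  proof (intro conjI ballI allI)
    have "\<phi> 0 = 0" "\<psi> 0 = 0"
      using S star_hom_on_diff[OF S \<phi>, of 0 0] star_hom_on_diff[OF S \<psi>, of 0 0]
      by (simp_all add: closed_star_subalgebra_def)
    then show "0 \<in> {x \<in> S. \<phi> x = \<psi> x}" using S by (simp add: closed_star_subalgebra_def)
    fix x assume x: "x \<in> {x \<in> S. \<phi> x = \<psi> x}"
    { fix y assume "y \<in> {x \<in> S. \<phi> x = \<psi> x}"
      then show "x + y \<in> {x \<in> S. \<phi> x = \<psi> x}"
        using x \<phi> \<psi> S by (auto simp: star_hom_on_def closed_star_subalgebra_def) }
    fix c :: real
    show "c *\<^sub>R x \<in> {x \<in> S. \<phi> x = \<psi> x}"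
      using x closed_star_subalgebra_scaleR[OF S] star_hom_on_scaleR[OF \<phi>] star_hom_on_scaleR[OF \<psi>] by auto
  qed
  then have "span D \<subseteq> {x \<in> S. \<phi> x = \<psi> x}" using D by (intro span_minimal) auto
  then show ?thesis
    using contractions_agree_on_closure[of S \<phi> \<psi> "span D" a, OF star_hom_contraction[OF S \<phi>]
        star_hom_contraction[OF S \<psi>]] D(2) a by blast
qed

lemma star_hom_on_compose:
  assumes "star_hom_on S (+) scaleC (*) star \<phi>" "\<phi> ` S \<subseteq> T" "star_hom_on T (+) scaleC (*) star \<psi>"
  shows "star_hom_on S (+) scaleC (*) star (\<lambda>x. \<psi> (\<phi> x))"
  using assms unfolding star_hom_on_def by (auto simp: image_subset_iff)

text \<open>Convergence along cutoffs that are 1 on larger and larger compact sets. No countable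
  exhaustion of \<open>V\<close> by compact sets is available in general.\<close>

definition cutoff_filter :: "'g groupoid \<Rightarrow> 'g set \<Rightarrow> ('g \<Rightarrow> complex) filter"
  where "cutoff_filter G V = (INF K\<in>{K. compactin (unit_space G) K \<and> K \<subseteq> V}. principal (cutoffs G V K))"

section \<open>Manipulating cutoffs\<close>

context compact_etale_groupoid begin

lemma eventually_cutoff_filter:
  "eventually P (cutoff_filter G V) \<longleftrightarrow>
    (\<exists>K. compactin (unit_space G) K \<and> K \<subseteq> V \<and> (\<forall>e\<in>cutoffs G V K. P e))"
proof -
  have "{K. compactin (unit_space G) K \<and> K \<subseteq> V} \<noteq> {}" by (auto intro: exI[of _ "{}"])
  then have "eventually P (cutoff_filter G V) \<longleftrightarrow>
      (\<exists>K\<in>{K. compactin (unit_space G) K \<and> K \<subseteq> V}. eventually P (principal (cutoffs G V K)))"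
    unfolding cutoff_filter_def
  proof (rule eventually_INF_base)
    fix K L assume "K \<in> {K. compactin (unit_space G) K \<and> K \<subseteq> V}" "L \<in> {K. compactin (unit_space G) K \<and> K \<subseteq> V}"
    then show "\<exists>x\<in>{K. compactin (unit_space G) K \<and> K \<subseteq> V}.
        principal (cutoffs G V x) \<le> inf (principal (cutoffs G V K)) (principal (cutoffs G V L))"
      \<comment> \<open>The basis is directed because prescribing 1 on a union meets both
        prescriptions.\<close>
      by (intro bexI[of _ "K \<union> L"]) (auto simp: cutoffs_def intro: compactin_Un)
  qed
  then show ?thesis by (auto simp: eventually_principal)
qed

lemma eventually_cutoffI:
  assumes "compactin (unit_space G) K" "K \<subseteq> V" "\<And>e. e \<in> cutoffs G V K \<Longrightarrow> P e"
  shows "eventually P (cutoff_filter G V)"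
  using assms unfolding eventually_cutoff_filter by blast

lemma eventually_cutoffs: "eventually (\<lambda>e. e \<in> cutoffs G V {}) (cutoff_filter G V)"
  by (rule eventually_cutoffI[of "{}"]) auto

lemma cutoff_filter_nontrivial: "openin (unit_space G) V \<Longrightarrow> cutoff_filter G V \<noteq> bot"
  unfolding trivial_limit_def eventually_cutoff_filter using ex_cutoff by blast

lemma cutoffsD:
  assumes "openin (unit_space G) V" "e \<in> cutoffs G V K"
  shows "e \<in> Cc G V" "e \<in> C0 G V" "e \<in> C_unit G"
  using assms Cc_subset_C0[of V] by (auto simp: cutoffs_def C0_def)

lemma ex_larger_cutoff:
  assumes V: "openin (unit_space G) V" and f: "f \<in> Cc G V"
  obtains K where "compactin (unit_space G) K" "K \<subseteq> V" "\<And>e x. e \<in> cutoffs G V K \<Longrightarrow> e x * f x = f x"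
proof -
  obtain K where K: "compactin (unit_space G) K" "K \<subseteq> V" "\<forall>x. x \<notin> K \<longrightarrow> f x = 0"
    using f unfolding Cc_units_iff[OF V] by blast
  show ?thesis
  proof (rule that[OF K(1,2)])
    fix e x assume "e \<in> cutoffs G V K"
    then show "e x * f x = f x" using K(3) by (cases "x \<in> K") (auto simp: cutoffs_def)
  qed
qed

lemma in_groupoid: "f \<in> C_unit G \<Longrightarrow> f \<in> C_groupoid G"
  using C_unit_subset_C_groupoid by blast

lemma Cc_in_groupoid: "U \<in> bisections G \<Longrightarrow> f \<in> Cc G U \<Longrightarrow> f \<in> C_groupoid G"
  using Cc_subset_C_groupoid by blast

lemma cutoffs_empty: "e \<in> cutoffs G V K \<Longrightarrow> e \<in> cutoffs G V {}"
  by (simp add: cutoffs_def)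

lemma ex_unit_cutoff:
  assumes V: "openin (unit_space G) V" and f: "f \<in> Cc G V"
  obtains e where "e \<in> cutoffs G V {}" "\<And>x. e x * f x = f x"
  using ex_larger_cutoff[OF V f] ex_cutoff[OF V] cutoffs_empty by (metis all_not_in_conv)

lemma psi_push_pull: "\<gamma> \<in> bisections G \<Longrightarrow> x \<in> supp G \<gamma> \<Longrightarrow> psi_push G (set_inv G \<gamma>) (psi_push G \<gamma> f) x = f x"
  by (auto simp: psi_push_inv_apply psi_push_apply)

lemma src_lift_in_groupoid:
  "\<gamma> \<in> bisections G \<Longrightarrow> k \<in> Cc G (supp G \<gamma>) \<Longrightarrow> src_lift G \<gamma> k \<in> C_groupoid G"
  using src_lift_Cc Cc_in_groupoid by blast

lemma push_cutoff:
  assumes \<gamma>: "\<gamma> \<in> bisections G" and W: "openin (unit_space G) W" "W \<subseteq> supp G \<gamma>"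
    and V: "openin (unit_space G) V" "\<And>g. g \<in> \<gamma> \<Longrightarrow> src G g \<in> W \<Longrightarrow> rng G g \<in> V"
    and e: "e \<in> cutoffs G W K"
  shows "psi_push G \<gamma> e \<in> cutoffs G V {}"
proof -
  have "psi_push G \<gamma> e \<in> Cc G V"
    by (rule psi_push_Cc_into[OF \<gamma> W V]) (use e in \<open>simp_all add: cutoffs_def\<close>)
  moreover have "psi_push G \<gamma> e x \<in> complex_of_real ` {0..1}" for x
  proof (cases "x \<in> im G \<gamma>")
    case True
    then show ?thesis using e by (auto simp: psi_push_apply[OF \<gamma>] cutoffs_def)
  next
    case False
    then show ?thesis by (auto simp: psi_push_outside intro!: image_eqI[of _ _ "0::real"])
  qed
  ultimately show ?thesis by (auto simp: cutoffs_def)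
qed

lemma psi_push_diff: "psi_push G \<gamma> f x - psi_push G \<gamma> f' x = psi_push G \<gamma> (\<lambda>y. f y - f' y) x"
  by (simp add: psi_push_def)

text \<open>If \<open>K\<close> carries \<open>b\<close>, the lift of \<open>b\<close> lives on
  arrows with source in \<open>K\<close> and range in the image of \<open>K\<close> under psi.
  Requiring the value 1 on both compact sets gives a local unit from the left and from the
  right.\<close>

lemma ex_two_sided_unit:
  assumes V: "openin (unit_space G) V" and U: "U \<in> bisections G" "supp G U \<subseteq> V" "im G U \<subseteq> V"
    and b: "b \<in> Cc G (supp G U)"
  obtains e where "e \<in> cutoffs G V {}" "\<And>h. h \<in> U \<Longrightarrow> b (src G h) \<noteq> 0 \<Longrightarrow> e (src G h) = 1 \<and> e (rng G h) = 1"
proof -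
  obtain K where K: "compactin (unit_space G) K" "K \<subseteq> supp G U" "\<forall>x. x \<notin> K \<longrightarrow> b x = 0"
    using b unfolding Cc_units_iff[OF bisectionD(5)[OF U(1)]] by blast
  let ?L = "K \<union> rng G ` inv_into U (src G) ` K"
  have "compactin (unit_space G) ?L" by (rule compactin_Un[OF K(1) psi_push_support(1)[OF U(1) K(1,2)]])
  moreover have "?L \<subseteq> V" using K(2) U(2,3) psi_push_support(2)[OF U(1) K(1,2)] by blast
  ultimately obtain e where e: "e \<in> cutoffs G V ?L" using ex_cutoff[OF V] by blast
  show ?thesis
  proof (rule that[OF cutoffs_empty[OF e]])
    fix h assume h: "h \<in> U" "b (src G h) \<noteq> 0"
    then have "src G h \<in> K" using K(3) by blast
    moreover have "rng G h \<in> rng G ` inv_into U (src G) ` K"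
      using calculation bisection_src_inv[OF U(1) h(1)] by (metis imageI)
    ultimately show "e (src G h) = 1 \<and> e (rng G h) = 1" using e by (auto simp: cutoffs_def)
  qed
qed

end

text \<open>No bound on \<open>\<rho>\<close> is assumed; the norm estimates below are derived from
  the C*-identity.\<close>

locale groupoid_representation = compact_etale_groupoid G for G :: "'g groupoid" +
  fixes \<rho> :: "('g \<Rightarrow> complex) \<Rightarrow> 'a::cstar_algebra"
  assumes hom: "star_hom_on (C_groupoid G) (\<lambda>f f' x. f x + f' x) (\<lambda>c f x. c * f x)
      (convolution G) (involution G) \<rho>"
    and unital: "\<rho> (indicator (units G)) = 1"
begin

lemma rho_add: "f \<in> C_groupoid G \<Longrightarrow> f' \<in> C_groupoid G \<Longrightarrow> \<rho> (\<lambda>x. f x + f' x) = \<rho> f + \<rho> f'"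
  using hom by (simp add: star_hom_on_def)

lemma rho_scale: "f \<in> C_groupoid G \<Longrightarrow> \<rho> (\<lambda>x. c * f x) = c *\<^sub>C \<rho> f"
  using hom by (simp add: star_hom_on_def)

lemma rho_convolution: "f \<in> C_groupoid G \<Longrightarrow> f' \<in> C_groupoid G \<Longrightarrow> \<rho> (convolution G f f') = \<rho> f * \<rho> f'"
  using hom by (simp add: star_hom_on_def)

lemma rho_involution: "f \<in> C_groupoid G \<Longrightarrow> \<rho> (involution G f) = star (\<rho> f)"
  using hom by (simp add: star_hom_on_def)

lemma rho_zero: "\<rho> (\<lambda>x. 0) = 0"
  using rho_scale[OF C_groupoid_zero, of 0] by simp

lemma rho_mult: "f \<in> C_unit G \<Longrightarrow> f' \<in> C_unit G \<Longrightarrow> \<rho> (\<lambda>x. f x * f' x) = \<rho> f * \<rho> f'"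
  using rho_convolution[of f f'] in_groupoid by (simp add: convolution_C_unit)

lemma rho_cnj: "f \<in> C_unit G \<Longrightarrow> \<rho> (\<lambda>x. cnj (f x)) = star (\<rho> f)"
  using rho_involution[of f] in_groupoid by (simp add: involution_C_unit)

lemma rho_diff: "f \<in> C_unit G \<Longrightarrow> f' \<in> C_unit G \<Longrightarrow> \<rho> (\<lambda>x. f x - f' x) = \<rho> f - \<rho> f'"
  using rho_add[of f "\<lambda>x. - 1 * f' x"] rho_scale[of f' "-1"] C_unit_scale[of f' "-1"] in_groupoid
  by (simp add: scaleC_minus_left)

lemma norm_rho_real:
  assumes f: "f \<in> C_unit G" and real: "\<And>x. cnj (f x) = f x" and le: "\<And>x. norm (f x) \<le> 1"
  shows "norm (\<rho> f) \<le> 1"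
proof -
  \<comment> \<open>Chosen so that f^2 + t^2 is the unit of \<open>C_unit G\<close>. The images of
    \<open>f\<close> and \<open>t\<close> then fit the sum-of-squares criterion.\<close>
  define t where "t x = (if x \<in> units G then complex_of_real (sqrt (1 - (Re (f x))\<^sup>2)) else 0)" for x
  have t: "t \<in> C_unit G"
    unfolding t_def by (rule C_unit_compose[OF f]) (intro continuous_intros)
  have "star (\<rho> f) = \<rho> f" using rho_cnj[OF f] unfolding real by (rule sym)
  moreover have t_real: "cnj (t x) = t x" for x by (simp add: t_def)
  have "star (\<rho> t) = \<rho> t" using rho_cnj[OF t] unfolding t_real by (rule sym)
  moreover have "\<rho> f * \<rho> t = \<rho> t * \<rho> f"
    using rho_mult[OF f t] rho_mult[OF t f] by (simp add: mult.commute)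
  moreover have "f x * f x + t x * t x = indicator (units G) x" for x
  proof (cases "x \<in> units G")
    case True
    have fx: "f x = complex_of_real (Re (f x))" using real[of x] by (simp add: complex_eq_iff)
    then have "\<bar>Re (f x)\<bar> \<le> 1" using le[of x] by (metis norm_of_real)
    then have "(Re (f x))\<^sup>2 \<le> 1" by (simp add: abs_square_le_1)
    then have "t x * t x = complex_of_real (1 - (Re (f x))\<^sup>2)"
      using True by (simp add: t_def del: of_real_diff flip: of_real_mult)
    moreover have "f x * f x = complex_of_real ((Re (f x))\<^sup>2)"
      by (subst (1 2) fx) (simp add: power2_eq_square)
    ultimately show ?thesis using True by simp
  qed (simp add: t_def C_unit_zero[OF f])
  then have "\<rho> f * \<rho> f + \<rho> t * \<rho> t = 1"
    using rho_add[of "\<lambda>x. f x * f x" "\<lambda>x. t x * t x"] in_groupoid C_unit_mult[OF f f] C_unit_mult[OF t t]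
      rho_mult[OF f f] rho_mult[OF t t] unital by simp
  ultimately show ?thesis by (rule norm_le_1_of_sum_squares)
qed

text \<open>The function |f|^2 / M^2 is real and bounded by 1; the C*-identity turns the bound on
  its image into one for \<open>f\<close>.\<close>

lemma norm_rho_le:
  assumes f: "f \<in> C_unit G" and M: "M > 0" and le: "\<And>x. norm (f x) \<le> M"
  shows "norm (\<rho> f) \<le> M"
proof -
  define g where "g x = complex_of_real (1 / M\<^sup>2) * (cnj (f x) * f x)" for x
  have g: "g \<in> C_unit G" unfolding g_def by (intro C_unit_scale C_unit_mult C_unit_cnj f)
  have "norm (g x) \<le> 1" for x
    using power_mono[OF le[of x], of 2] M
    by (simp add: g_def norm_mult norm_divide norm_power power2_eq_square divide_simps)
  moreover have "cnj (g x) = g x" for x by (simp add: g_def)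
  ultimately have "norm (\<rho> g) \<le> 1" using norm_rho_real[OF g] by blast
  moreover have "\<rho> g = complex_of_real (1 / M\<^sup>2) *\<^sub>C (star (\<rho> f) * \<rho> f)"
    unfolding g_def
    by (simp only: rho_scale[OF in_groupoid[OF C_unit_mult[OF C_unit_cnj[OF f] f]]]
        rho_mult[OF C_unit_cnj[OF f] f] rho_cnj[OF f])
  then have "norm (\<rho> g) = (1 / M\<^sup>2) * (norm (\<rho> f))\<^sup>2"
    by (simp only: norm_scaleC cstar_identity) (simp add: norm_divide norm_power)
  ultimately have "(norm (\<rho> f))\<^sup>2 \<le> M\<^sup>2" using M by (simp add: divide_simps)
  then show ?thesis by (rule power2_le_imp_le) (use M in simp)
qed

lemma cutoff_rho:
  assumes "openin (unit_space G) V" "e \<in> cutoffs G V K"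
  shows "norm (\<rho> e) \<le> 1" "star (\<rho> e) = \<rho> e"
  using norm_rho_le[of e 1] cutoff_norm[OF assms(2)] cutoffsD[OF assms] rho_cnj[of e] by auto

section \<open>Corners described by the approximate unit of cutoffs\<close>

lemma corner_gen:
  "f \<in> C0 G V \<Longrightarrow> f' \<in> C0 G V \<Longrightarrow> \<rho> f * a * \<rho> f' \<in> corner G \<rho> V"
  unfolding corner_def by (intro subsetD[OF closure_subset] span_base) blast

text \<open>A cutoff that is 1 where |f| >= \<epsilon> / 2 changes \<open>f\<close> by at most
  \<epsilon> / 2 everywhere.\<close>

lemma cutoff_mult_tendsto:
  assumes V: "openin (unit_space G) V" and f: "f \<in> C0 G V"
  shows "((\<lambda>e. \<rho> e * \<rho> f) \<longlongrightarrow> \<rho> f) (cutoff_filter G V)"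
proof (rule tendstoI)
  fix \<epsilon> :: real assume \<epsilon>: "\<epsilon> > 0"
  then have \<epsilon>2: "\<epsilon> / 2 > 0" by simp
  have fu: "f \<in> C_unit G" using f by (simp add: C0_def)
  show "eventually (\<lambda>e. dist (\<rho> e * \<rho> f) (\<rho> f) < \<epsilon>) (cutoff_filter G V)"
  proof (rule eventually_cutoffI[OF compactin_superlevel[OF f \<epsilon>2]])
    fix e assume e: "e \<in> cutoffs G V {x. \<epsilon> / 2 \<le> norm (f x)}"
    note eu = cutoffsD(3)[OF V e]
    have "norm (e x * f x - f x) \<le> \<epsilon> / 2" for x
    proof (cases "\<epsilon> / 2 \<le> norm (f x)")
      case True
      then show ?thesis using e \<epsilon> by (auto simp: cutoffs_def)
    next
      case False
      have "norm (e x * f x - f x) = norm (1 - e x) * norm (f x)"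
        by (metis left_diff_distrib mult_1 norm_minus_commute norm_mult)
      also have "\<dots> \<le> 1 * norm (f x)" using cutoff_norm(2)[OF e] by (intro mult_right_mono) auto
      finally show ?thesis using False by simp
    qed
    then have "norm (\<rho> (\<lambda>x. e x * f x - f x)) \<le> \<epsilon> / 2"
      by (intro norm_rho_le[OF C_unit_diff[OF C_unit_mult[OF eu fu] fu] \<epsilon>2])
    then show "dist (\<rho> e * \<rho> f) (\<rho> f) < \<epsilon>"
      using \<epsilon> rho_diff[OF C_unit_mult[OF eu fu] fu] rho_mult[OF eu fu] by (simp add: dist_norm)
  qed
qed

lemma rho_commute: "f \<in> C_unit G \<Longrightarrow> f' \<in> C_unit G \<Longrightarrow> \<rho> f * \<rho> f' = \<rho> f' * \<rho> f"
  using rho_mult[of f f'] rho_mult[of f' f] by (simp add: mult.commute)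

lemma eventually_norm_rho_le:
  assumes "openin (unit_space G) V"
  shows "eventually (\<lambda>e. norm (\<rho> e) \<le> 1) (cutoff_filter G V)"
  using eventually_cutoffs by eventually_elim (rule cutoff_rho(1)[OF assms])

lemma corner_tendsto_left:
  assumes V: "openin (unit_space G) V" and a: "a \<in> corner G \<rho> V"
  shows "((\<lambda>e. \<rho> e * a) \<longlongrightarrow> a) (cutoff_filter G V)"
proof (rule closure_span_tendsto_id[OF cutoff_filter_nontrivial[OF V] _ _ _ a[unfolded corner_def]])
  show "linear (\<lambda>x. \<rho> e * x)" for e by (simp add: linear_iff distrib_left)
  show "eventually (\<lambda>e. \<forall>x. norm (\<rho> e * x) \<le> norm x) (cutoff_filter G V)"
    using eventually_norm_rho_le[OF V] by eventually_elim (simp add: mult_left_le_norm)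
  fix x assume "x \<in> {\<rho> f * a * \<rho> f' |f a f'. f \<in> C0 G V \<and> f' \<in> C0 G V}"
  then obtain f b f' where x: "x = \<rho> f * b * \<rho> f'" "f \<in> C0 G V" by blast
  have "((\<lambda>e. (\<rho> e * \<rho> f) * b * \<rho> f') \<longlongrightarrow> \<rho> f * b * \<rho> f') (cutoff_filter G V)"
    by (intro tendsto_intros cutoff_mult_tendsto[OF V x(2)])
  then show "((\<lambda>e. \<rho> e * x) \<longlongrightarrow> x) (cutoff_filter G V)" by (simp add: x(1) mult.assoc)
qed

lemma corner_tendsto_right:
  assumes V: "openin (unit_space G) V" and a: "a \<in> corner G \<rho> V"
  shows "((\<lambda>e. a * \<rho> e) \<longlongrightarrow> a) (cutoff_filter G V)"
proof (rule closure_span_tendsto_id[OF cutoff_filter_nontrivial[OF V] _ _ _ a[unfolded corner_def]])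
  show "linear (\<lambda>x. x * \<rho> e)" for e by (simp add: linear_iff distrib_right)
  show "eventually (\<lambda>e. \<forall>x. norm (x * \<rho> e) \<le> norm x) (cutoff_filter G V)"
    using eventually_norm_rho_le[OF V] by eventually_elim (simp add: mult_right_le_norm)
  fix x assume "x \<in> {\<rho> f * a * \<rho> f' |f a f'. f \<in> C0 G V \<and> f' \<in> C0 G V}"
  then obtain f b f' where x: "x = \<rho> f * b * \<rho> f'" "f' \<in> C0 G V" by blast
  have "((\<lambda>e. \<rho> f * b * (\<rho> e * \<rho> f')) \<longlongrightarrow> \<rho> f * b * \<rho> f') (cutoff_filter G V)"
    by (intro tendsto_intros cutoff_mult_tendsto[OF V x(2)])
  moreover have "eventually (\<lambda>e. \<rho> f * b * (\<rho> e * \<rho> f') = x * \<rho> e) (cutoff_filter G V)"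
    using eventually_cutoffs
  proof eventually_elim
    case (elim e)
    then have "\<rho> e * \<rho> f' = \<rho> f' * \<rho> e"
      using rho_commute cutoffsD(3)[OF V] x(2) by (auto simp: C0_def)
    then show ?case by (simp add: x(1) mult.assoc)
  qed
  ultimately show "((\<lambda>e. x * \<rho> e) \<longlongrightarrow> x) (cutoff_filter G V)"
    using x(1) tendsto_cong by force
qed

lemma tendsto_both_sides:
  assumes V: "openin (unit_space G) V"
    and "((\<lambda>e. \<rho> e * a) \<longlongrightarrow> a) (cutoff_filter G V)" "((\<lambda>e. a * \<rho> e) \<longlongrightarrow> a) (cutoff_filter G V)"
  shows "((\<lambda>e. \<rho> e * a * \<rho> e) \<longlongrightarrow> a) (cutoff_filter G V)"
proof (rule LIM_zero_cancel, rule Lim_null_comparison)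
  show "eventually (\<lambda>e. norm (\<rho> e * a * \<rho> e - a) \<le> norm (\<rho> e * a - a) + norm (a * \<rho> e - a)) (cutoff_filter G V)"
    using eventually_norm_rho_le[OF V]
  proof eventually_elim
    case (elim e)
    have "\<rho> e * a * \<rho> e - a = (\<rho> e * a - a) * \<rho> e + (a * \<rho> e - a)" by (simp add: algebra_simps)
    then have "norm (\<rho> e * a * \<rho> e - a) \<le> norm ((\<rho> e * a - a) * \<rho> e) + norm (a * \<rho> e - a)"
      by (metis norm_triangle_ineq)
    then show ?case using mult_right_le_norm[OF elim, of "\<rho> e * a - a"] by linarith
  qed
  have "((\<lambda>e. norm (\<rho> e * a - a) + norm (a * \<rho> e - a)) \<longlongrightarrow> norm (a - a) + norm (a - a)) (cutoff_filter G V)"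
    by (intro tendsto_intros assms)
  then show "((\<lambda>e. norm (\<rho> e * a - a) + norm (a * \<rho> e - a)) \<longlongrightarrow> 0) (cutoff_filter G V)" by simp
qed

lemma closed_corner: "closed (corner G \<rho> V)"
  by (simp add: corner_def)

text \<open>Turns a closed span into a limit condition. The algebraic closure properties of the
  corner, and the fact that \<pi> maps corners into corners, then follow from limit rules.\<close>

lemma corner_iff:
  assumes V: "openin (unit_space G) V"
  shows "a \<in> corner G \<rho> V \<longleftrightarrow>
    ((\<lambda>e. \<rho> e * a) \<longlongrightarrow> a) (cutoff_filter G V) \<and> ((\<lambda>e. a * \<rho> e) \<longlongrightarrow> a) (cutoff_filter G V)"
proof
  assume "((\<lambda>e. \<rho> e * a) \<longlongrightarrow> a) (cutoff_filter G V) \<and> ((\<lambda>e. a * \<rho> e) \<longlongrightarrow> a) (cutoff_filter G V)"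
  then have "((\<lambda>e. \<rho> e * a * \<rho> e) \<longlongrightarrow> a) (cutoff_filter G V)"
    using tendsto_both_sides[OF V] by blast
  moreover have "eventually (\<lambda>e. \<rho> e * a * \<rho> e \<in> corner G \<rho> V) (cutoff_filter G V)"
    using eventually_cutoffs by eventually_elim (intro corner_gen cutoffsD(2)[OF V])
  ultimately show "a \<in> corner G \<rho> V"
    by (rule Lim_in_closed_set[OF closed_corner _ cutoff_filter_nontrivial[OF V], rotated])
qed (use corner_tendsto_left[OF V] corner_tendsto_right[OF V] in blast)

lemma corner_star_subalgebra:
  assumes V: "openin (unit_space G) V"
  shows "closed_star_subalgebra (corner G \<rho> V)"
  unfolding closed_star_subalgebra_def
proof (intro conjI ballI allI)
  show "closed (corner G \<rho> V)" by (rule closed_corner)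
  show "0 \<in> corner G \<rho> V" unfolding corner_iff[OF V] by simp
  fix x assume x: "x \<in> corner G \<rho> V"
  then have xl: "((\<lambda>e. \<rho> e * x) \<longlongrightarrow> x) (cutoff_filter G V)"
    and xr: "((\<lambda>e. x * \<rho> e) \<longlongrightarrow> x) (cutoff_filter G V)" unfolding corner_iff[OF V] by auto
  {
    fix y assume y: "y \<in> corner G \<rho> V"
    then have yl: "((\<lambda>e. \<rho> e * y) \<longlongrightarrow> y) (cutoff_filter G V)"
      and yr: "((\<lambda>e. y * \<rho> e) \<longlongrightarrow> y) (cutoff_filter G V)" unfolding corner_iff[OF V] by auto
    show "x + y \<in> corner G \<rho> V"
      unfolding corner_iff[OF V] using tendsto_add[OF xl yl] tendsto_add[OF xr yr]
      by (simp add: distrib_left distrib_right)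
    show "x * y \<in> corner G \<rho> V"
      unfolding corner_iff[OF V]
      using tendsto_mult[OF xl tendsto_const[of y]] tendsto_mult[OF tendsto_const[of x] yr]
      by (simp add: mult.assoc)
  }
  show "c *\<^sub>C x \<in> corner G \<rho> V" for c
    unfolding corner_iff[OF V] using tendsto_scaleC[OF xl, of c] tendsto_scaleC[OF xr, of c]
    by (simp add: mult_scaleC_left mult_scaleC_right)
  have ev: "eventually (\<lambda>e. star (\<rho> e) = \<rho> e) (cutoff_filter G V)"
    using eventually_cutoffs by eventually_elim (rule cutoff_rho(2)[OF V])
  have "((\<lambda>e. \<rho> e * star x) \<longlongrightarrow> star x) (cutoff_filter G V)"
    using tendsto_star[OF xr] by (rule tendsto_cong[THEN iffD1, rotated]) (use ev in eventually_elim, simp add: star_mult)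
  moreover have "((\<lambda>e. star x * \<rho> e) \<longlongrightarrow> star x) (cutoff_filter G V)"
    using tendsto_star[OF xl] by (rule tendsto_cong[THEN iffD1, rotated]) (use ev in eventually_elim, simp add: star_mult)
  ultimately show "star x \<in> corner G \<rho> V" unfolding corner_iff[OF V] by blast
qed

text \<open>The dense part of the corner where some cutoff acts as a two-sided unit; conjugation by
  lifts becomes eventually constant there.\<close>

definition compact_corner :: "'g set \<Rightarrow> 'a set"
  where "compact_corner V = {a. \<exists>e\<in>cutoffs G V {}. \<rho> e * a = a \<and> a * \<rho> e = a}"

lemma compact_corner_subset:
  assumes V: "openin (unit_space G) V" shows "compact_corner V \<subseteq> corner G \<rho> V"
proof
  fix a assume "a \<in> compact_corner V"
  then obtain e where e: "e \<in> cutoffs G V {}" "\<rho> e * a = a" "a * \<rho> e = a"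
    by (auto simp: compact_corner_def)
  then have "\<rho> e * a * \<rho> e \<in> corner G \<rho> V" by (intro corner_gen cutoffsD(2)[OF V])
  then show "a \<in> corner G \<rho> V" using e by simp
qed

lemma compact_corner_dense:
  assumes V: "openin (unit_space G) V" shows "corner G \<rho> V \<subseteq> closure (compact_corner V)"
proof
  fix a assume a: "a \<in> corner G \<rho> V"
  have "eventually (\<lambda>e. \<rho> e * a * \<rho> e \<in> closure (compact_corner V)) (cutoff_filter G V)"
    using eventually_cutoffs
  proof eventually_elim
    case (elim e)
    note eD = cutoffsD[OF V elim]
    \<comment> \<open>A cutoff equal to 1 on the support of \<open>e\<close> fixes every element of
      the form \<rho> e a \<rho> e.\<close>
    obtain e' where e': "e' \<in> cutoffs G V {}" "\<And>x. e' x * e x = e x" using ex_unit_cutoff[OF V eD(1)] by blast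
    have l: "\<rho> e' * \<rho> e = \<rho> e"
      using rho_mult[OF cutoffsD(3)[OF V e'(1)] eD(3)] unfolding e'(2) by (rule sym)
    have r: "\<rho> e * \<rho> e' = \<rho> e"
      using rho_commute[OF cutoffsD(3)[OF V e'(1)] eD(3)] unfolding l by (rule sym)
    have "\<rho> e' * (\<rho> e * a * \<rho> e) = \<rho> e * a * \<rho> e" by (simp only: mult.assoc[symmetric] l)
    moreover have "\<rho> e * a * \<rho> e * \<rho> e' = \<rho> e * a * \<rho> e" by (simp only: mult.assoc r)
    ultimately have "\<rho> e * a * \<rho> e \<in> compact_corner V"
      unfolding compact_corner_def using e'(1) by blast
    then show ?case using closure_subset by blast
  qed
  then show "a \<in> closure (compact_corner V)"
    using Lim_in_closed_set[OF closed_closure _ cutoff_filter_nontrivial[OF V] tendsto_both_sides[OF V]]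
      a corner_tendsto_left[OF V] corner_tendsto_right[OF V] by blast
qed

section \<open>Products of lifted functions\<close>

lemma star_rho_lift:
  assumes \<gamma>: "\<gamma> \<in> bisections G" and k: "k \<in> Cc G (supp G \<gamma>)"
  shows "star (\<rho> (src_lift G \<gamma> k)) = \<rho> (src_lift G (set_inv G \<gamma>) (psi_push G \<gamma> (\<lambda>x. cnj (k x))))"
    "src_lift G (set_inv G \<gamma>) (psi_push G \<gamma> (\<lambda>x. cnj (k x))) \<in> C_groupoid G"
proof -
  show "star (\<rho> (src_lift G \<gamma> k)) = \<rho> (src_lift G (set_inv G \<gamma>) (psi_push G \<gamma> (\<lambda>x. cnj (k x))))"
    using rho_involution[OF src_lift_in_groupoid[OF \<gamma> k]] by (simp add: involution_src_lift[OF \<gamma>])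
  show "src_lift G (set_inv G \<gamma>) (psi_push G \<gamma> (\<lambda>x. cnj (k x))) \<in> C_groupoid G"
    using involution_Cc[OF \<gamma> src_lift_Cc[OF \<gamma> k]] Cc_in_groupoid[OF set_inv_bisection(1)[OF \<gamma>]]
    by (simp add: involution_src_lift[OF \<gamma>])
qed

text \<open>The inverse of \<open>\<gamma>\<close> times \<open>\<gamma>\<close> is its support, so
  the product is a function on the units. For a cutoff this is x_e* x_e = e^2.\<close>

lemma star_lift_mult_lift:
  assumes \<gamma>: "\<gamma> \<in> bisections G" and k: "k \<in> Cc G (supp G \<gamma>)" "k' \<in> Cc G (supp G \<gamma>)"
  shows "star (\<rho> (src_lift G \<gamma> k)) * \<rho> (src_lift G \<gamma> k') = \<rho> (\<lambda>x. cnj (k x) * k' x)"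
proof -
  note \<gamma>' = set_inv_bisection(1)[OF \<gamma>]
  have "star (\<rho> (src_lift G \<gamma> k)) * \<rho> (src_lift G \<gamma> k')
      = \<rho> (src_lift G (supp G \<gamma>) (\<lambda>x. psi_push G (set_inv G \<gamma>) (psi_push G \<gamma> (\<lambda>x. cnj (k x))) x * k' x))"
    using rho_convolution[OF star_rho_lift(2)[OF \<gamma> k(1)] src_lift_in_groupoid[OF \<gamma> k(2)]]
    by (simp add: star_rho_lift(1)[OF \<gamma> k(1)] convolution_src_lift[OF \<gamma>' \<gamma>] set_comp_set_inv_left[OF \<gamma>])
  also have "src_lift G (supp G \<gamma>) (\<lambda>x. psi_push G (set_inv G \<gamma>) (psi_push G \<gamma> (\<lambda>x. cnj (k x))) x * k' x)
      = src_lift G (supp G \<gamma>) (\<lambda>x. cnj (k x) * k' x)"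
    using open_units_bisection(2)[OF bisectionD(5)[OF \<gamma>]]
    by (intro src_lift_cong) (metis (no_types, lifting) psi_push_pull[OF \<gamma>] imageI)
  also have "\<dots> = (\<lambda>x. cnj (k x) * k' x)"
    using k by (intro src_lift_units[OF bisectionD(5)[OF \<gamma>]]) (simp add: Cc_def)
  finally show ?thesis .
qed

lemma norm_rho_lift_le:
  assumes \<gamma>: "\<gamma> \<in> bisections G" and k: "k \<in> Cc G (supp G \<gamma>)" and le: "\<And>x. norm (k x) \<le> 1"
  shows "norm (\<rho> (src_lift G \<gamma> k)) \<le> 1"
proof -
  have ku: "k \<in> C_unit G" using k Cc_units_iff[OF bisectionD(5)[OF \<gamma>]] by simp
  have "norm (\<rho> (\<lambda>x. cnj (k x) * k x)) \<le> 1"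
    using le by (intro norm_rho_le C_unit_mult C_unit_cnj ku) (auto simp: norm_mult mult_le_one)
  then have "(norm (\<rho> (src_lift G \<gamma> k)))\<^sup>2 \<le> 1\<^sup>2"
    using star_lift_mult_lift[OF \<gamma> k k] cstar_identity[of "\<rho> (src_lift G \<gamma> k)"] by simp
  then show ?thesis by (rule power2_le_imp_le) simp
qed

lemma rho_lift_mult_unit:
  assumes \<gamma>: "\<gamma> \<in> bisections G" and k: "k \<in> Cc G (supp G \<gamma>)" and f: "f \<in> C_unit G"
  shows "\<rho> (src_lift G \<gamma> k) * \<rho> f = \<rho> (src_lift G \<gamma> (\<lambda>x. k x * f x))"
  using rho_convolution[OF src_lift_in_groupoid[OF \<gamma> k] in_groupoid[OF f]]
  by (simp add: convolution_C_unit_right[OF f \<gamma>])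

lemma rho_push_mult_lift:
  assumes \<gamma>: "\<gamma> \<in> bisections G" and k: "k \<in> Cc G (supp G \<gamma>)" and f: "f \<in> C0 G (supp G \<gamma>)"
  shows "\<rho> (psi_push G \<gamma> f) * \<rho> (src_lift G \<gamma> k) = \<rho> (src_lift G \<gamma> (\<lambda>x. f x * k x))"
proof -
  have pf: "psi_push G \<gamma> f \<in> C_unit G" using psi_push_C0[OF \<gamma> f] by (simp add: C0_def)
  have "src_lift G \<gamma> (\<lambda>x. psi_push G (set_inv G \<gamma>) (psi_push G \<gamma> f) x * k x) = src_lift G \<gamma> (\<lambda>x. f x * k x)"
    by (rule src_lift_cong) (simp add: psi_push_pull[OF \<gamma>])
  then show ?thesis
    using rho_convolution[OF in_groupoid[OF pf] src_lift_in_groupoid[OF \<gamma> k]]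
    by (simp add: convolution_C_unit_left[OF pf \<gamma>])
qed

text \<open>The identity behind the composition law: pushing \<open>k\<close> along
  \<open>\<delta>\<close> before lifting to \<open>\<gamma>\<close> is undone by the convolution
  with a function on \<open>\<delta>\<close>.\<close>

lemma rho_lift_mult_lift:
  assumes g: "\<gamma> \<in> bisections G" and d: "\<delta> \<in> bisections G"
    and p: "psi_push G \<delta> k \<in> Cc G (supp G \<gamma>)" and k': "k' \<in> Cc G (supp G \<delta>)"
  shows "\<rho> (src_lift G \<gamma> (psi_push G \<delta> k)) * \<rho> (src_lift G \<delta> k')
    = \<rho> (src_lift G (set_comp G \<gamma> \<delta>) (\<lambda>x. k x * k' x))"
proof -
  have "src_lift G (set_comp G \<gamma> \<delta>) (\<lambda>x. psi_push G (set_inv G \<delta>) (psi_push G \<delta> k) x * k' x)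
      = src_lift G (set_comp G \<gamma> \<delta>) (\<lambda>x. k x * k' x)"
    using supp_set_comp_subset[OF g d] by (intro src_lift_cong) (simp add: psi_push_pull[OF d] image_subset_iff)
  then show ?thesis
    using rho_convolution[OF src_lift_in_groupoid[OF g p] src_lift_in_groupoid[OF d k']]
    by (simp add: convolution_src_lift[OF g d])
qed

lemma rho_lift_mult_star_lift:
  assumes \<gamma>: "\<gamma> \<in> bisections G" and k: "k \<in> Cc G (supp G \<gamma>)" "k' \<in> Cc G (supp G \<gamma>)"
  shows "\<rho> (src_lift G \<gamma> k) * star (\<rho> (src_lift G \<gamma> k')) = \<rho> (psi_push G \<gamma> (\<lambda>x. k x * cnj (k' x)))"
proof -
  note \<gamma>' = set_inv_bisection(1)[OF \<gamma>]
  have "\<rho> (src_lift G \<gamma> k) * star (\<rho> (src_lift G \<gamma> k'))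
      = \<rho> (src_lift G (im G \<gamma>) (\<lambda>x. psi_push G \<gamma> k x * psi_push G \<gamma> (\<lambda>x. cnj (k' x)) x))"
    using rho_convolution[OF src_lift_in_groupoid[OF \<gamma> k(1)] star_rho_lift(2)[OF \<gamma> k(2)]]
    by (simp add: star_rho_lift(1)[OF \<gamma> k(2)] convolution_src_lift[OF \<gamma> \<gamma>'] set_comp_set_inv_right[OF \<gamma>]
        set_inv_set_inv[OF \<gamma>])
  also have "(\<lambda>x. psi_push G \<gamma> k x * psi_push G \<gamma> (\<lambda>x. cnj (k' x)) x) = psi_push G \<gamma> (\<lambda>x. k x * cnj (k' x))"
    by (auto simp: psi_push_def)
  also have "src_lift G (im G \<gamma>) (psi_push G \<gamma> (\<lambda>x. k x * cnj (k' x))) = psi_push G \<gamma> (\<lambda>x. k x * cnj (k' x))"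
    by (rule src_lift_units[OF bisectionD(6)[OF \<gamma>] psi_push_outside])
  finally show ?thesis .
qed

section \<open>Conjugation by a bisection\<close>

text \<open>These are \<open>x\<^sub>e a x\<^sub>e*\<close> and its limit; \<open>Lim\<close> is meaningful only if the limit exists, that is on the
  corner of \<open>supp \<gamma>\<close>.\<close>

definition sandwich :: "'g set \<Rightarrow> ('g \<Rightarrow> complex) \<Rightarrow> 'a \<Rightarrow> 'a"
  where "sandwich \<gamma> e a = \<rho> (src_lift G \<gamma> e) * a * star (\<rho> (src_lift G \<gamma> e))"

definition transport :: "'g set \<Rightarrow> 'a \<Rightarrow> 'a"
  where "transport \<gamma> a = Lim (cutoff_filter G (supp G \<gamma>)) (\<lambda>e. sandwich \<gamma> e a)"

lemma sandwich_add: "sandwich \<gamma> e (x + y) = sandwich \<gamma> e x + sandwich \<gamma> e y"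
  and sandwich_diff: "sandwich \<gamma> e (x - y) = sandwich \<gamma> e x - sandwich \<gamma> e y"
  and sandwich_scaleC: "sandwich \<gamma> e (c *\<^sub>C x) = c *\<^sub>C sandwich \<gamma> e x"
  and sandwich_star: "sandwich \<gamma> e (star x) = star (sandwich \<gamma> e x)"
  by (simp_all add: sandwich_def algebra_simps mult_scaleC_left mult_scaleC_right star_mult star_star)

lemma norm_lift_cutoff:
  assumes \<gamma>: "\<gamma> \<in> bisections G" and e: "e \<in> cutoffs G (supp G \<gamma>) K"
  shows "norm (\<rho> (src_lift G \<gamma> e)) \<le> 1"
  using norm_rho_lift_le[OF \<gamma> cutoffsD(1)[OF bisectionD(5)[OF \<gamma>] e]] cutoff_norm(1)[OF e] by blast

lemma norm_sandwich_le:
  assumes \<gamma>: "\<gamma> \<in> bisections G" and e: "e \<in> cutoffs G (supp G \<gamma>) K"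
  shows "norm (sandwich \<gamma> e a) \<le> norm a"
  unfolding sandwich_def
  using mult_right_le_norm[of "star (\<rho> (src_lift G \<gamma> e))" "\<rho> (src_lift G \<gamma> e) * a"]
    mult_left_le_norm[OF norm_lift_cutoff[OF \<gamma> e], of a] norm_lift_cutoff[OF \<gamma> e] by simp

lemma star_rho_cutoff_lift:
  assumes \<gamma>: "\<gamma> \<in> bisections G" and k: "k \<in> Cc G (supp G \<gamma>)" and e: "e \<in> cutoffs G (supp G \<gamma>) K"
    and absorb: "\<And>x. k x * e x = e x"
  shows "\<rho> (src_lift G \<gamma> k) * \<rho> e = \<rho> (src_lift G \<gamma> e)"
    "\<rho> e * star (\<rho> (src_lift G \<gamma> k)) = star (\<rho> (src_lift G \<gamma> e))"
proof -
  note eD = cutoffsD[OF bisectionD(5)[OF \<gamma>] e]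
  show *: "\<rho> (src_lift G \<gamma> k) * \<rho> e = \<rho> (src_lift G \<gamma> e)"
    using rho_lift_mult_unit[OF \<gamma> k eD(3)] unfolding absorb .
  show "\<rho> e * star (\<rho> (src_lift G \<gamma> k)) = star (\<rho> (src_lift G \<gamma> e))"
    using star_mult[of "\<rho> (src_lift G \<gamma> k)" "\<rho> e"]
    unfolding * cutoff_rho(2)[OF bisectionD(5)[OF \<gamma>] e] by (rule sym)
qed

text \<open>Insert \<rho> e on both sides of \<open>a\<close>; multiplied by the lift of
  \<open>k\<close> it gives the lift of k e = e.\<close>

lemma sandwich_absorb:
  assumes \<gamma>: "\<gamma> \<in> bisections G" and k: "k \<in> Cc G (supp G \<gamma>)" and e: "e \<in> cutoffs G (supp G \<gamma>) K"
    and absorb: "\<And>x. k x * e x = e x" and a: "\<rho> e * a = a" "a * \<rho> e = a"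
  shows "sandwich \<gamma> k a = sandwich \<gamma> e a"
proof -
  note * = star_rho_cutoff_lift[OF \<gamma> k e absorb]
  have "sandwich \<gamma> k a = \<rho> (src_lift G \<gamma> k) * (\<rho> e * (a * \<rho> e)) * star (\<rho> (src_lift G \<gamma> k))"
    by (simp add: sandwich_def a)
  also have "\<dots> = (\<rho> (src_lift G \<gamma> k) * \<rho> e) * a * (\<rho> e * star (\<rho> (src_lift G \<gamma> k)))"
    by (simp only: mult.assoc)
  finally show ?thesis by (simp only: * sandwich_def)
qed

text \<open>The pushed cutoff acts as a unit on conjugated elements, which places them in a compact
  corner. \<open>W\<close> may be smaller than the support of \<open>\<gamma>\<close>, as happens
  for products of bisections.\<close>

lemma push_absorb:
  assumes \<gamma>: "\<gamma> \<in> bisections G" and W: "openin (unit_space G) W" "W \<subseteq> supp G \<gamma>"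
    and e: "e \<in> cutoffs G W K" and e': "e' \<in> cutoffs G W L" "\<And>x. e' x * e x = e x"
  shows "\<rho> (psi_push G \<gamma> e') * sandwich \<gamma> e a = sandwich \<gamma> e a"
    "sandwich \<gamma> e a * \<rho> (psi_push G \<gamma> e') = sandwich \<gamma> e a"
proof -
  note su = bisectionD(5)[OF \<gamma>]
  have c: "e \<in> Cc G (supp G \<gamma>)" using Cc_mono[OF W(1) su W(2)] e by (auto simp: cutoffs_def)
  have c0: "e' \<in> C0 G (supp G \<gamma>)" using C0_mono[OF W(2)] cutoffsD(2)[OF W(1) e'(1)] by blast
  have l: "\<rho> (psi_push G \<gamma> e') * \<rho> (src_lift G \<gamma> e) = \<rho> (src_lift G \<gamma> e)"
    using rho_push_mult_lift[OF \<gamma> c c0] unfolding e'(2) .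
  have pim: "psi_push G \<gamma> e' \<in> cutoffs G (im G \<gamma>) {}"
    by (rule push_cutoff[OF \<gamma> W bisectionD(6)[OF \<gamma>] _ e'(1)]) blast
  have r: "star (\<rho> (src_lift G \<gamma> e)) * \<rho> (psi_push G \<gamma> e') = star (\<rho> (src_lift G \<gamma> e))"
    using star_mult[of "\<rho> (psi_push G \<gamma> e')" "\<rho> (src_lift G \<gamma> e)"]
    unfolding l cutoff_rho(2)[OF bisectionD(6)[OF \<gamma>] pim] by (rule sym)
  show "\<rho> (psi_push G \<gamma> e') * sandwich \<gamma> e a = sandwich \<gamma> e a"
    unfolding sandwich_def by (simp only: mult.assoc[symmetric] l)
  show "sandwich \<gamma> e a * \<rho> (psi_push G \<gamma> e') = sandwich \<gamma> e a"
    unfolding sandwich_def by (simp only: mult.assoc r)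
qed

lemma sandwich_corner:
  assumes \<gamma>: "\<gamma> \<in> bisections G" and e: "e \<in> cutoffs G (supp G \<gamma>) K"
  shows "sandwich \<gamma> e a \<in> corner G \<rho> (im G \<gamma>)"
proof -
  note su = bisectionD(5)[OF \<gamma>]
  obtain e' where e': "e' \<in> cutoffs G (supp G \<gamma>) {}" "\<And>x. e' x * e x = e x"
    using ex_unit_cutoff[OF su cutoffsD(1)[OF su e]] by blast
  have "psi_push G \<gamma> e' \<in> cutoffs G (im G \<gamma>) {}"
    by (rule push_cutoff[OF \<gamma> su _ bisectionD(6)[OF \<gamma>] _ e'(1)]) auto
  then have "sandwich \<gamma> e a \<in> compact_corner (im G \<gamma>)"
    unfolding compact_corner_def using push_absorb[OF \<gamma> su _ e e'] by blast
  then show ?thesis using compact_corner_subset[OF bisectionD(6)[OF \<gamma>]] by blast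
qed

lemma sandwich_tendsto_compact:
  assumes \<gamma>: "\<gamma> \<in> bisections G" and e: "e \<in> cutoffs G (supp G \<gamma>) K" and a: "\<rho> e * a = a" "a * \<rho> e = a"
  shows "((\<lambda>k. sandwich \<gamma> k a) \<longlongrightarrow> sandwich \<gamma> e a) (cutoff_filter G (supp G \<gamma>))"
proof (rule tendsto_eventually)
  note su = bisectionD(5)[OF \<gamma>]
  obtain L where L: "compactin (unit_space G) L" "L \<subseteq> supp G \<gamma>"
    "\<And>k x. k \<in> cutoffs G (supp G \<gamma>) L \<Longrightarrow> k x * e x = e x"
    using ex_larger_cutoff[OF su cutoffsD(1)[OF su e]] by blast
  show "eventually (\<lambda>k. sandwich \<gamma> k a = sandwich \<gamma> e a) (cutoff_filter G (supp G \<gamma>))"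
    by (rule eventually_cutoffI[OF L(1,2)]) (rule sandwich_absorb[OF \<gamma> cutoffsD(1)[OF su] e L(3) a])
qed

lemma transport_compact:
  assumes \<gamma>: "\<gamma> \<in> bisections G" and e: "e \<in> cutoffs G (supp G \<gamma>) K" and a: "\<rho> e * a = a" "a * \<rho> e = a"
  shows "transport \<gamma> a = sandwich \<gamma> e a"
  unfolding transport_def
  by (rule tendsto_Lim[OF cutoff_filter_nontrivial[OF bisectionD(5)[OF \<gamma>]] sandwich_tendsto_compact[OF \<gamma> e a]])

text \<open>On the compact corner the family is eventually constant; its norm bound 1 extends
  convergence to the closure, and the limit stays in the closed target corner.\<close>

lemma transport_tendsto_corner:
  assumes \<gamma>: "\<gamma> \<in> bisections G" and a: "a \<in> corner G \<rho> (supp G \<gamma>)"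
  shows "((\<lambda>e. sandwich \<gamma> e a) \<longlongrightarrow> transport \<gamma> a) (cutoff_filter G (supp G \<gamma>)) \<and>
    transport \<gamma> a \<in> corner G \<rho> (im G \<gamma>)"
proof -
  note su = bisectionD(5)[OF \<gamma>] and nt = cutoff_filter_nontrivial[OF bisectionD(5)[OF \<gamma>]]
  have D: "((\<lambda>e. sandwich \<gamma> e x) \<longlongrightarrow> transport \<gamma> x) (cutoff_filter G (supp G \<gamma>)) \<and>
      transport \<gamma> x \<in> corner G \<rho> (im G \<gamma>)" if x: "x \<in> compact_corner (supp G \<gamma>)" for x
  proof -
    obtain e where e: "e \<in> cutoffs G (supp G \<gamma>) {}" "\<rho> e * x = x" "x * \<rho> e = x"
      using x by (auto simp: compact_corner_def)
    show ?thesis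
      unfolding transport_compact[OF \<gamma> e]
      using sandwich_tendsto_compact[OF \<gamma> e] sandwich_corner[OF \<gamma> e(1)] by blast
  qed
  have "\<exists>b\<in>closure (transport \<gamma> ` compact_corner (supp G \<gamma>)).
      ((\<lambda>e. sandwich \<gamma> e a) \<longlongrightarrow> b) (cutoff_filter G (supp G \<gamma>))"
  proof (rule ex_tendsto_closure[OF nt sandwich_diff, where C = 1])
    show "eventually (\<lambda>e. \<forall>x. norm (sandwich \<gamma> e x) \<le> 1 * norm x) (cutoff_filter G (supp G \<gamma>))"
      using eventually_cutoffs by eventually_elim (simp add: norm_sandwich_le[OF \<gamma>])
    show "a \<in> closure (compact_corner (supp G \<gamma>))" using compact_corner_dense[OF su] a by blast
  qed (use D in auto)
  then obtain b where b: "b \<in> closure (transport \<gamma> ` compact_corner (supp G \<gamma>))"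
    "((\<lambda>e. sandwich \<gamma> e a) \<longlongrightarrow> b) (cutoff_filter G (supp G \<gamma>))" by blast
  have "transport \<gamma> a = b" unfolding transport_def by (rule tendsto_Lim[OF nt b(2)])
  moreover have "closure (transport \<gamma> ` compact_corner (supp G \<gamma>)) \<subseteq> corner G \<rho> (im G \<gamma>)"
    by (rule closure_minimal[OF _ closed_corner]) (use D in blast)
  ultimately show ?thesis using b by blast
qed

lemmas transport_tendsto = transport_tendsto_corner[THEN conjunct1]
lemmas transport_in_corner = transport_tendsto_corner[THEN conjunct2]

lemma transport_eqI:
  assumes \<gamma>: "\<gamma> \<in> bisections G" and "((\<lambda>e. sandwich \<gamma> e a) \<longlongrightarrow> b) (cutoff_filter G (supp G \<gamma>))"
  shows "transport \<gamma> a = b"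
  unfolding transport_def by (rule tendsto_Lim[OF cutoff_filter_nontrivial[OF bisectionD(5)[OF \<gamma>]] assms(2)])

text \<open>Since x_e* x_e = e^2, the product of the conjugates is the conjugate of a e^2 b. The
  error e^2 b - b splits as e (e b - b) + (e b - b), whence the factor 2.\<close>

lemma sandwich_mult_tendsto:
  assumes \<gamma>: "\<gamma> \<in> bisections G" and a: "a \<in> corner G \<rho> (supp G \<gamma>)" and b: "b \<in> corner G \<rho> (supp G \<gamma>)"
  shows "((\<lambda>e. sandwich \<gamma> e a * sandwich \<gamma> e b - sandwich \<gamma> e (a * b)) \<longlongrightarrow> 0) (cutoff_filter G (supp G \<gamma>))"
proof (rule Lim_null_comparison)
  note su = bisectionD(5)[OF \<gamma>]
  show "eventually (\<lambda>e. norm (sandwich \<gamma> e a * sandwich \<gamma> e b - sandwich \<gamma> e (a * b))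
      \<le> norm a * (2 * norm (\<rho> e * b - b))) (cutoff_filter G (supp G \<gamma>))"
    using eventually_cutoffs
  proof eventually_elim
    case (elim e)
    note eD = cutoffsD[OF su elim]
    let ?x = "\<rho> (src_lift G \<gamma> e)"
    have xx: "star ?x * ?x = \<rho> e * \<rho> e"
      using star_lift_mult_lift[OF \<gamma> eD(1) eD(1)] rho_mult[OF eD(3) eD(3)] cutoff_norm(3)[OF elim] by simp
    have "sandwich \<gamma> e a * sandwich \<gamma> e b = ?x * (a * ((star ?x * ?x) * b)) * star ?x"
      by (simp only: sandwich_def mult.assoc)
    then have "sandwich \<gamma> e a * sandwich \<gamma> e b - sandwich \<gamma> e (a * b)
        = sandwich \<gamma> e (a * (\<rho> e * (\<rho> e * b - b) + (\<rho> e * b - b)))"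
      unfolding xx by (simp add: sandwich_def algebra_simps)
    then have "norm (sandwich \<gamma> e a * sandwich \<gamma> e b - sandwich \<gamma> e (a * b))
        \<le> norm (a * (\<rho> e * (\<rho> e * b - b) + (\<rho> e * b - b)))"
      using norm_sandwich_le[OF \<gamma> elim] by simp
    also have "\<dots> \<le> norm a * norm (\<rho> e * (\<rho> e * b - b) + (\<rho> e * b - b))" by (rule norm_mult_ineq)
    also have "\<dots> \<le> norm a * (2 * norm (\<rho> e * b - b))"
      using norm_triangle_ineq[of "\<rho> e * (\<rho> e * b - b)" "\<rho> e * b - b"]
        mult_left_le_norm[OF cutoff_rho(1)[OF su elim], of "\<rho> e * b - b"]
      by (intro mult_left_mono) auto
    finally show ?case .
  qed
  have "((\<lambda>e. norm a * (2 * norm (\<rho> e * b - b))) \<longlongrightarrow> norm a * (2 * norm (b - b))) (cutoff_filter G (supp G \<gamma>))"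
    by (intro tendsto_intros corner_tendsto_left[OF su b])
  then show "((\<lambda>e. norm a * (2 * norm (\<rho> e * b - b))) \<longlongrightarrow> 0) (cutoff_filter G (supp G \<gamma>))" by simp
qed

lemma transport_star_hom:
  assumes \<gamma>: "\<gamma> \<in> bisections G"
  shows "star_hom_on (corner G \<rho> (supp G \<gamma>)) (+) scaleC (*) star (transport \<gamma>)"
  unfolding star_hom_on_def
proof (intro conjI ballI allI)
  fix a assume a: "a \<in> corner G \<rho> (supp G \<gamma>)"
  note la = transport_tendsto[OF \<gamma> a]
  {
    fix b assume b: "b \<in> corner G \<rho> (supp G \<gamma>)"
    note lb = transport_tendsto[OF \<gamma> b]
    show "transport \<gamma> (a + b) = transport \<gamma> a + transport \<gamma> b"
      by (rule transport_eqI[OF \<gamma>]) (simp only: sandwich_add tendsto_add[OF la lb])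
    have "((\<lambda>e. sandwich \<gamma> e a * sandwich \<gamma> e b - (sandwich \<gamma> e a * sandwich \<gamma> e b - sandwich \<gamma> e (a * b)))
        \<longlongrightarrow> transport \<gamma> a * transport \<gamma> b - 0) (cutoff_filter G (supp G \<gamma>))"
      by (intro tendsto_diff tendsto_mult la lb sandwich_mult_tendsto[OF \<gamma> a b])
    then show "transport \<gamma> (a * b) = transport \<gamma> a * transport \<gamma> b"
      by (intro transport_eqI[OF \<gamma>]) simp
  }
  show "transport \<gamma> (c *\<^sub>C a) = c *\<^sub>C transport \<gamma> a" for c
    by (rule transport_eqI[OF \<gamma>]) (simp only: sandwich_scaleC tendsto_scaleC[OF la])
  show "transport \<gamma> (star a) = star (transport \<gamma> a)"
    by (rule transport_eqI[OF \<gamma>]) (simp only: sandwich_star tendsto_star[OF la])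
qed

lemma transport_contraction:
  assumes \<gamma>: "\<gamma> \<in> bisections G" and "a \<in> corner G \<rho> (supp G \<gamma>)" "b \<in> corner G \<rho> (supp G \<gamma>)"
  shows "norm (transport \<gamma> a - transport \<gamma> b) \<le> norm (a - b)"
  by (rule star_hom_contraction[OF corner_star_subalgebra[OF bisectionD(5)[OF \<gamma>]] transport_star_hom[OF \<gamma>] assms(2,3)])

lemma corner_mono: "V \<subseteq> W \<Longrightarrow> corner G \<rho> V \<subseteq> corner G \<rho> W"
  unfolding corner_def using C0_mono[of V W] by (intro closure_mono span_mono) blast

lemma transport_comp:
  assumes g: "\<gamma> \<in> bisections G" and d: "\<delta> \<in> bisections G"
    and a: "a \<in> corner G \<rho> (supp G (set_comp G \<gamma> \<delta>))"
  shows "transport \<gamma> (transport \<delta> a) = transport (set_comp G \<gamma> \<delta>) a"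
    "transport \<delta> a \<in> corner G \<rho> (supp G \<gamma>)"
proof -
  let ?W = "supp G (set_comp G \<gamma> \<delta>)"
  note gd = set_comp_bisection[OF g d]
  note W = bisectionD(5)[OF gd] and Wd = supp_set_comp_subset[OF g d]
  \<comment> \<open>The arrow of \<open>\<delta>\<close> over a point of \<open>?W\<close> is
    unique, so it is the one that composes with an arrow of \<open>\<gamma>\<close>.\<close>
  have rng_W: "rng G h \<in> supp G \<gamma>" if h: "h \<in> \<delta>" "src G h \<in> ?W" for h
  proof -
    obtain x where x: "x \<in> set_comp G \<gamma> \<delta>" "src G h = src G x" using h(2) by blast
    then obtain g' h' where *: "g' \<in> \<gamma>" "h' \<in> \<delta>" "rng G h' = src G g'" "src G x = src G h'"
      using set_compE[OF g d x(1)] by metis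
    then have "h = h'" using src_eq_in_bisection[OF d h(1)] x(2) by simp
    then show ?thesis using * by auto
  qed
  have cpt: "transport \<delta> x \<in> compact_corner (supp G \<gamma>) \<and>
      transport \<gamma> (transport \<delta> x) = transport (set_comp G \<gamma> \<delta>) x" if x: "x \<in> compact_corner ?W" for x
  proof -
    obtain e where e: "e \<in> cutoffs G ?W {}" "\<rho> e * x = x" "x * \<rho> e = x"
      using x by (auto simp: compact_corner_def)
    obtain e' where e': "e' \<in> cutoffs G ?W {}" "\<And>x. e' x * e x = e x"
      using ex_unit_cutoff[OF W cutoffsD(1)[OF W e(1)]] by blast
    have ed: "e \<in> cutoffs G (supp G \<delta>) {}"
      using e(1) Cc_mono[OF W bisectionD(5)[OF d] Wd] by (auto simp: cutoffs_def)
    let ?p = "psi_push G \<delta> e'"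
    have p: "?p \<in> cutoffs G (supp G \<gamma>) {}"
      by (rule push_cutoff[OF d W Wd bisectionD(5)[OF g] rng_W e'(1)])
    have td: "transport \<delta> x = sandwich \<delta> e x" by (rule transport_compact[OF d ed e(2,3)])
    note absorb = push_absorb[OF d W Wd e(1) e', of x]
    \<comment> \<open>With e' e = e, the two implementing elements multiply to the one of the
      product bisection.\<close>
    have "\<rho> (src_lift G \<gamma> ?p) * \<rho> (src_lift G \<delta> e) = \<rho> (src_lift G (set_comp G \<gamma> \<delta>) e)"
      using rho_lift_mult_lift[OF g d cutoffsD(1)[OF bisectionD(5)[OF g] p] cutoffsD(1)[OF bisectionD(5)[OF d] ed]]
      unfolding e'(2) .
    then have "sandwich \<gamma> ?p (sandwich \<delta> e x) = sandwich (set_comp G \<gamma> \<delta>) e x"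
      unfolding sandwich_def by (metis mult.assoc star_mult)
    then have "transport \<gamma> (transport \<delta> x) = transport (set_comp G \<gamma> \<delta>) x"
      unfolding td transport_compact[OF gd e] using transport_compact[OF g p absorb] by simp
    then show ?thesis unfolding td compact_corner_def using p absorb by blast
  qed
  note sub = corner_mono[OF Wd]
  have closed: "a \<in> closure (compact_corner ?W)" using compact_corner_dense[OF W] a by blast
  \<comment> \<open>Needed before the contractivity of \<open>transport \<gamma>\<close> may be
    applied to values of \<open>transport \<delta>\<close>; obtained from the compact corner by
    continuity.\<close>
  have "transport \<delta> ` corner G \<rho> ?W \<subseteq> corner G \<rho> (supp G \<gamma>)"
  proof clarify
    fix x assume x: "x \<in> corner G \<rho> ?W"
    then obtain u where u: "\<And>n. u n \<in> compact_corner ?W" "u \<longlonglongrightarrow> x"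
      using compact_corner_dense[OF W] by (auto simp: closure_sequential subset_iff)
    have un: "u n \<in> corner G \<rho> (supp G \<delta>)" for n
      using u(1) compact_corner_subset[OF W] sub by blast
    have "(\<lambda>n. transport \<delta> (u n)) \<longlonglongrightarrow> transport \<delta> x"
    proof (rule LIM_zero_cancel, rule Lim_null_comparison)
      show "eventually (\<lambda>n. norm (transport \<delta> (u n) - transport \<delta> x) \<le> norm (u n - x)) sequentially"
        using transport_contraction[OF d un] x sub by (intro always_eventually) blast
      show "(\<lambda>n. norm (u n - x)) \<longlonglongrightarrow> 0" using u(2) by (simp add: LIM_zero tendsto_norm_zero)
    qed
    moreover have "transport \<delta> (u n) \<in> corner G \<rho> (supp G \<gamma>)" for n
      using cpt[OF u(1)] compact_corner_subset[OF bisectionD(5)[OF g]] by blast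
    ultimately show "transport \<delta> x \<in> corner G \<rho> (supp G \<gamma>)"
      by (rule closed_sequentially[OF closed_corner, rotated])
  qed
  then have into: "transport \<delta> x \<in> corner G \<rho> (supp G \<gamma>)" if "x \<in> corner G \<rho> ?W" for x using that by blast
  show "transport \<delta> a \<in> corner G \<rho> (supp G \<gamma>)" by (rule into[OF a])
  show "transport \<gamma> (transport \<delta> a) = transport (set_comp G \<gamma> \<delta>) a"
  proof (rule contractions_agree_on_closure[OF _ transport_contraction[OF gd] compact_corner_subset[OF W] _ a closed])
    fix x y assume xy: "x \<in> corner G \<rho> ?W" "y \<in> corner G \<rho> ?W"
    have "norm (transport \<gamma> (transport \<delta> x) - transport \<gamma> (transport \<delta> y)) \<le> norm (transport \<delta> x - transport \<delta> y)"
      by (rule transport_contraction[OF g into[OF xy(1)] into[OF xy(2)]])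
    also have "\<dots> \<le> norm (x - y)" using transport_contraction[OF d] xy sub by blast
    finally show "norm (transport \<gamma> (transport \<delta> x) - transport \<gamma> (transport \<delta> y)) \<le> norm (x - y)" .
  qed (use cpt in auto)
qed

text \<open>On a set of units the lift of a cutoff is the cutoff itself, so the conjugates are e a
  e. With \<open>transport_comp\<close> this makes inverse bisections give inverse maps.\<close>

lemma transport_units:
  assumes V: "openin (unit_space G) V" and a: "a \<in> corner G \<rho> V" shows "transport V a = a"
proof (rule transport_eqI[OF open_units_bisection(1)[OF V]])
  have "((\<lambda>e. \<rho> e * a * \<rho> e) \<longlongrightarrow> a) (cutoff_filter G V)"
    using tendsto_both_sides[OF V] corner_tendsto_left[OF V a] corner_tendsto_right[OF V a] by blast
  moreover have "eventually (\<lambda>e. \<rho> e * a * \<rho> e = sandwich V e a) (cutoff_filter G V)"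
    using eventually_cutoffs
  proof eventually_elim
    case (elim e)
    have "src_lift G V e = e"
      using elim by (intro src_lift_units[OF V]) (simp add: cutoffs_def Cc_def)
    then show ?case using cutoff_rho(2)[OF V elim] by (simp add: sandwich_def)
  qed
  ultimately show "((\<lambda>e. sandwich V e a) \<longlongrightarrow> a) (cutoff_filter G (supp G V))"
    unfolding open_units_bisection(2)[OF V] by (rule Lim_transform_eventually)
qed

lemma transport_inverse:
  assumes \<gamma>: "\<gamma> \<in> bisections G" and a: "a \<in> corner G \<rho> (supp G \<gamma>)"
  shows "transport (set_inv G \<gamma>) (transport \<gamma> a) = a"
proof -
  note su = bisectionD(5)[OF \<gamma>]
  have "transport (set_inv G \<gamma>) (transport \<gamma> a) = transport (set_comp G (set_inv G \<gamma>) \<gamma>) a"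
    using a by (intro transport_comp(1)[OF set_inv_bisection(1)[OF \<gamma>] \<gamma>])
      (simp only: set_comp_set_inv_left[OF \<gamma>] open_units_bisection(2)[OF su])
  then show ?thesis unfolding set_comp_set_inv_left[OF \<gamma>] using transport_units[OF su a] by simp
qed

lemma transport_iso:
  assumes \<gamma>: "\<gamma> \<in> bisections G"
  shows "star_iso_betw (corner G \<rho> (supp G \<gamma>)) (corner G \<rho> (im G \<gamma>)) (transport \<gamma>)"
proof -
  note \<gamma>' = set_inv_bisection[OF \<gamma>]
  have "bij_betw (transport \<gamma>) (corner G \<rho> (supp G \<gamma>)) (corner G \<rho> (im G \<gamma>))"
  proof (rule bij_betw_byWitness[where f' = "transport (set_inv G \<gamma>)"])
    show "\<forall>a\<in>corner G \<rho> (supp G \<gamma>). transport (set_inv G \<gamma>) (transport \<gamma> a) = a"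
      using transport_inverse[OF \<gamma>] by blast
    show "\<forall>a\<in>corner G \<rho> (im G \<gamma>). transport \<gamma> (transport (set_inv G \<gamma>) a) = a"
      using transport_inverse[OF \<gamma>'(1)] unfolding \<gamma>'(2) set_inv_set_inv[OF \<gamma>] by blast
    show "transport \<gamma> ` corner G \<rho> (supp G \<gamma>) \<subseteq> corner G \<rho> (im G \<gamma>)"
      using transport_in_corner[OF \<gamma>] by blast
    show "transport (set_inv G \<gamma>) ` corner G \<rho> (im G \<gamma>) \<subseteq> corner G \<rho> (supp G \<gamma>)"
      using transport_in_corner[OF \<gamma>'(1)] unfolding \<gamma>'(2,3) by blast
  qed
  then show ?thesis using transport_star_hom[OF \<gamma>] by (simp add: star_iso_betw_def)
qed

text \<open>Conjugating \<rho> f by x_e gives the pushforward of e^2 f. With e = 1 on a superlevel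
  set of \<open>f\<close> this is uniformly close to the pushforward of \<open>f\<close>.\<close>

lemma transport_C0:
  assumes \<gamma>: "\<gamma> \<in> bisections G" and f: "f \<in> C0 G (supp G \<gamma>)"
  shows "transport \<gamma> (\<rho> f) = \<rho> (psi_push G \<gamma> f)"
proof (rule transport_eqI[OF \<gamma>], rule tendstoI)
  fix \<epsilon> :: real assume \<epsilon>: "\<epsilon> > 0"
  then have \<epsilon>2: "\<epsilon> / 2 > 0" by simp
  note su = bisectionD(5)[OF \<gamma>]
  have fu: "f \<in> C_unit G" using f by (simp add: C0_def)
  show "eventually (\<lambda>e. dist (sandwich \<gamma> e (\<rho> f)) (\<rho> (psi_push G \<gamma> f)) < \<epsilon>) (cutoff_filter G (supp G \<gamma>))"
  \<comment> \<open>Half of \<open>\<epsilon>\<close> is used because the norm estimate is not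
    strict while convergence asks for a strict one.\<close>
  proof (rule eventually_cutoffI[OF compactin_superlevel[OF f \<epsilon>2]])
    fix e assume e: "e \<in> cutoffs G (supp G \<gamma>) {x. \<epsilon> / 2 \<le> norm (f x)}"
    note eD = cutoffsD[OF su e]
    let ?h = "\<lambda>x. e x * f x * cnj (e x)"
    have "sandwich \<gamma> e (\<rho> f) = \<rho> (psi_push G \<gamma> ?h)"
      unfolding sandwich_def rho_lift_mult_unit[OF \<gamma> eD(1) fu]
      by (rule rho_lift_mult_star_lift[OF \<gamma> Cc_mult_C_unit[OF su eD(1) fu] eD(1)])
    moreover have h0: "?h \<in> C0 G (supp G \<gamma>)"
      using Cc_mult_C_unit[OF su Cc_mult_C_unit[OF su eD(1) fu] C_unit_cnj[OF eD(3)]] Cc_subset_C0[OF su] by blast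
    note hp = psi_push_C0[OF \<gamma> h0] and fp = psi_push_C0[OF \<gamma> f]
    have "norm (psi_push G \<gamma> ?h x - psi_push G \<gamma> f x) \<le> \<epsilon> / 2" for x
    proof -
      have "norm (?h y - f y) \<le> \<epsilon> / 2" for y
      proof (cases "\<epsilon> / 2 \<le> norm (f y)")
        case True
        then show ?thesis using e \<epsilon> by (auto simp: cutoffs_def)
      next
        case False
        obtain t where t: "e y = complex_of_real t" "0 \<le> t" "t \<le> 1" using e by (force simp: cutoffs_def)
        have "?h y - f y = - (complex_of_real (1 - t * t) * f y)" by (simp add: t algebra_simps)
        then have "norm (?h y - f y) = \<bar>1 - t * t\<bar> * norm (f y)"
          by (simp only: norm_minus_cancel norm_mult norm_of_real)
        also have "\<dots> \<le> 1 * norm (f y)"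
          using t mult_le_one[of t t] by (intro mult_right_mono) auto
        finally show ?thesis using False by simp
      qed
      then show ?thesis unfolding psi_push_diff psi_push_def using \<epsilon>2 by simp
    qed
    then have "norm (\<rho> (\<lambda>x. psi_push G \<gamma> ?h x - psi_push G \<gamma> f x)) \<le> \<epsilon> / 2"
      using hp fp by (intro norm_rho_le[OF C_unit_diff \<epsilon>2]) (auto simp: C0_def)
    then have "norm (\<rho> (psi_push G \<gamma> ?h) - \<rho> (psi_push G \<gamma> f)) \<le> \<epsilon> / 2"
      using rho_diff[of "psi_push G \<gamma> ?h" "psi_push G \<gamma> f"] hp fp by (simp add: C0_def)
    ultimately show "dist (sandwich \<gamma> e (\<rho> f)) (\<rho> (psi_push G \<gamma> f)) < \<epsilon>" using \<epsilon> by (simp add: dist_norm)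
  qed
qed

lemma G_cstar_algebra_transport:
  assumes "inj_on \<rho> (C_unit G)" shows "G_cstar_algebra G \<rho> transport"
  unfolding G_cstar_algebra_def
proof (intro conjI ballI)
  show "unit_embedding G \<rho>"
    unfolding unit_embedding_def star_hom_on_def
    using assms unital rho_mult rho_cnj rho_add in_groupoid rho_scale by auto
next
  fix \<gamma>\<^sub>1 \<gamma>\<^sub>2 a
  assume *: "\<gamma>\<^sub>1 \<in> bisections G" "\<gamma>\<^sub>2 \<in> bisections G"
    "a \<in> corner G \<rho> (psi G (set_inv G \<gamma>\<^sub>2) ` (supp G \<gamma>\<^sub>1 \<inter> im G \<gamma>\<^sub>2))"
  then show "transport \<gamma>\<^sub>1 (transport \<gamma>\<^sub>2 a) = transport (set_comp G \<gamma>\<^sub>1 \<gamma>\<^sub>2) a"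
    by (intro transport_comp(1)) (simp_all only: supp_set_comp)
qed (use transport_iso transport_C0 in blast)+

lemma Cc_absorb:
  assumes V: "openin (unit_space G) V" and U: "U \<in> bisections G"
    and b: "b \<in> Cc G (supp G U)" and e: "e \<in> cutoffs G V {}"
    and eU: "\<And>h. h \<in> U \<Longrightarrow> b (src G h) \<noteq> 0 \<Longrightarrow> e (src G h) = 1 \<and> e (rng G h) = 1"
  shows "\<rho> e * \<rho> (src_lift G U b) = \<rho> (src_lift G U b)" "\<rho> (src_lift G U b) * \<rho> e = \<rho> (src_lift G U b)"
proof -
  note eu = cutoffsD(3)[OF V e] and bg = src_lift_in_groupoid[OF U b]
  have "convolution G e (src_lift G U b) = src_lift G U b"
    unfolding convolution_C_unit_left[OF eu U]
    by (rule src_lift_cong) (use eU psi_push_inv_apply[OF U, of _ e] in fastforce)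
  then show "\<rho> e * \<rho> (src_lift G U b) = \<rho> (src_lift G U b)"
    using rho_convolution[OF in_groupoid[OF eu] bg] by (simp only:)
  have "convolution G (src_lift G U b) e = src_lift G U b"
    unfolding convolution_C_unit_right[OF eu U] by (rule src_lift_cong) (use eU in fastforce)
  then show "\<rho> (src_lift G U b) * \<rho> e = \<rho> (src_lift G U b)"
    using rho_convolution[OF bg in_groupoid[OF eu]] by (simp only:)
qed

text \<open>The image of \<open>f\<close> lies in the compact corner, so the limit is attained at
  one cutoff and the exact convolution formula applies.\<close>

lemma transport_Cc:
  assumes \<gamma>: "\<gamma> \<in> bisections G" and U: "U \<in> bisections G" "supp G U \<subseteq> supp G \<gamma>" "im G U \<subseteq> supp G \<gamma>"
    and f: "f \<in> Cc G U"
  shows "transport \<gamma> (\<rho> f) = \<rho> (conj_push G \<gamma> U f)"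
proof -
  note su = bisectionD(5)[OF \<gamma>]
  obtain b where b: "b \<in> Cc G (supp G U)" "f = src_lift G U b" using Cc_eq_src_lift[OF U(1) f] .
  obtain e where e: "e \<in> cutoffs G (supp G \<gamma>) {}"
    "\<And>h. h \<in> U \<Longrightarrow> b (src G h) \<noteq> 0 \<Longrightarrow> e (src G h) = 1 \<and> e (rng G h) = 1"
    using ex_two_sided_unit[OF su U b(1)] by blast
  let ?x = "src_lift G \<gamma> e"
  have x: "?x \<in> Cc G \<gamma>" by (rule src_lift_Cc[OF \<gamma> cutoffsD(1)[OF su e(1)]])
  have x1: "?x \<in> C_groupoid G" and f1: "f \<in> C_groupoid G"
    using Cc_in_groupoid[OF \<gamma> x] Cc_in_groupoid[OF U(1) f] .
  have x2: "involution G ?x \<in> C_groupoid G"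
    by (rule Cc_in_groupoid[OF set_inv_bisection(1)[OF \<gamma>] involution_Cc[OF \<gamma> x]])
  have xf: "convolution G ?x f \<in> C_groupoid G"
    by (rule Cc_in_groupoid[OF set_comp_bisection[OF \<gamma> U(1)] convolution_Cc[OF \<gamma> U(1) x f]])
  have "transport \<gamma> (\<rho> f) = sandwich \<gamma> e (\<rho> f)"
    unfolding b(2) by (rule transport_compact[OF \<gamma> e(1) Cc_absorb[OF su U(1) b(1) e]])
  also have "\<dots> = \<rho> (convolution G (convolution G ?x f) (involution G ?x))"
    unfolding sandwich_def rho_convolution[OF xf x2] rho_convolution[OF x1 f1] rho_involution[OF x1] ..
  also have "\<dots> = \<rho> (conj_push G \<gamma> U f)"
    unfolding b(2) using convolution_conj_push[OF \<gamma> U(1,2,3), of b e] e(2) by simp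
  finally show ?thesis .
qed

text \<open>The elements on which the conjugation formula prescribes the value of the structure
  maps.\<close>

definition corner_generators :: "'g set \<Rightarrow> 'a set"
  where "corner_generators V = {\<rho> f | f U. U \<in> bisections G \<and> supp G U \<subseteq> V \<and> im G U \<subseteq> V \<and> f \<in> Cc G U}"

lemma corner_generators_subset:
  assumes V: "openin (unit_space G) V" shows "corner_generators V \<subseteq> corner G \<rho> V"
proof
  fix a assume "a \<in> corner_generators V"
  then obtain f U where U: "U \<in> bisections G" "supp G U \<subseteq> V" "im G U \<subseteq> V" and f: "f \<in> Cc G U" "a = \<rho> f"
    by (auto simp: corner_generators_def)
  obtain b where b: "b \<in> Cc G (supp G U)" "f = src_lift G U b" using Cc_eq_src_lift[OF U(1) f(1)] .
  obtain e where e: "e \<in> cutoffs G V {}"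
    "\<And>h. h \<in> U \<Longrightarrow> b (src G h) \<noteq> 0 \<Longrightarrow> e (src G h) = 1 \<and> e (rng G h) = 1"
    using ex_two_sided_unit[OF V U b(1)] by blast
  have "a \<in> compact_corner V"
    unfolding f(2) b(2) compact_corner_def using e(1) Cc_absorb[OF V U(1) b(1) e] by blast
  then show "a \<in> corner G \<rho> V" using compact_corner_subset[OF V] by blast
qed

text \<open>Multiplying a function on \<open>U\<close> by a cutoff on both sides moves it to the
  bisection V U V, whose source and range lie in \<open>V\<close>. Density of the image of \<rho>
  and then convergence of e a e to \<open>a\<close> reach the whole corner.\<close>

lemma corner_generators_dense:
  assumes V: "openin (unit_space G) V" and dense: "closure (\<rho> ` C_groupoid G) = UNIV"
  shows "corner G \<rho> V \<subseteq> closure (span (corner_generators V))"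
proof
  note Vb = open_units_bisection[OF V]
  fix a assume a: "a \<in> corner G \<rho> V"
  have gen: "\<rho> e * \<rho> f * \<rho> e \<in> span (corner_generators V)" if e: "e \<in> cutoffs G V {}" and f: "f \<in> C_groupoid G" for e f
    using f
  proof (induction rule: C_groupoid_induct)
    case zero
    show ?case by (simp add: rho_zero span_zero)
  next
    case (add f U F)
    note eD = cutoffsD[OF V e]
    have 1: "convolution G e F \<in> Cc G (set_comp G V U)"
      by (rule convolution_Cc[OF Vb(1) add.hyps(2) eD(1) add.hyps(3)])
    note VU = set_comp_bisection[OF Vb(1) add.hyps(2)]
    note VUV = set_comp_bisection[OF VU Vb(1)]
    have 2: "convolution G (convolution G e F) e \<in> Cc G (set_comp G (set_comp G V U) V)"
      by (rule convolution_Cc[OF VU Vb(1) 1 eD(1)])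
    have "\<rho> e * \<rho> F * \<rho> e = \<rho> (convolution G (convolution G e F) e)"
      using rho_convolution[OF Cc_in_groupoid[OF VU 1] in_groupoid[OF eD(3)]]
        rho_convolution[OF in_groupoid[OF eD(3)] Cc_in_groupoid[OF add.hyps(2,3)]] by simp
    moreover have "supp G (set_comp G (set_comp G V U) V) \<subseteq> V"
      using supp_set_comp_subset[OF VU Vb(1)] Vb(2) by simp
    moreover have "im G (set_comp G (set_comp G V U) V) \<subseteq> V"
      using im_set_comp_subset[OF VU Vb(1)] im_set_comp_subset[OF Vb(1) add.hyps(2)] Vb(3) by blast
    ultimately have "\<rho> e * \<rho> F * \<rho> e \<in> corner_generators V"
      unfolding corner_generators_def using VUV 2 by blast
    then have "\<rho> e * \<rho> f * \<rho> e + \<rho> e * \<rho> F * \<rho> e \<in> span (corner_generators V)"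
      by (intro span_add span_base add.IH)
    then show ?case
      using rho_add[OF add.hyps(1) Cc_in_groupoid[OF add.hyps(2,3)]] by (simp add: distrib_left distrib_right)
  qed
  have "\<rho> e * x * \<rho> e \<in> closure (span (corner_generators V))" if e: "e \<in> cutoffs G V {}" for e x
  proof -
    obtain u where u: "\<And>n. u n \<in> \<rho> ` C_groupoid G" "u \<longlonglongrightarrow> x"
      using dense closure_sequential[of x "\<rho> ` C_groupoid G"] by auto
    have "\<rho> e * u n * \<rho> e \<in> span (corner_generators V)" for n using gen[OF e] u(1)[of n] by auto
    moreover have "(\<lambda>n. \<rho> e * u n * \<rho> e) \<longlonglongrightarrow> \<rho> e * x * \<rho> e" by (intro tendsto_intros u(2))
    ultimately show ?thesis unfolding closure_sequential by (intro exI[of _ "\<lambda>n. \<rho> e * u n * \<rho> e"]) auto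
  qed
  then have "eventually (\<lambda>e. \<rho> e * a * \<rho> e \<in> closure (span (corner_generators V))) (cutoff_filter G V)"
    by (rule eventually_mono[OF eventually_cutoffs])
  then show "a \<in> closure (span (corner_generators V))"
    by (rule Lim_in_closed_set[OF closed_closure _ cutoff_filter_nontrivial[OF V]
          tendsto_both_sides[OF V corner_tendsto_left[OF V a] corner_tendsto_right[OF V a]]])
qed

end

section \<open>The maximal C*-algebra\<close>

context compact_etale_groupoid begin

text \<open>By maximality the norm of \<open>j\<close> dominates the C*-seminorm
  \<open>orbit_norm\<close>, which in turn dominates the absolute value of a function on the units
  at each point.\<close>

lemma cstar_max_inj:
  assumes j: "cstar_max G j" shows "inj_on j (C_unit G)"
proof (rule inj_onI)
  fix f f' assume f: "f \<in> C_unit G" "f' \<in> C_unit G" and eq: "j f = j f'"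
  have d: "(\<lambda>x. f x - f' x) \<in> C_unit G" by (rule C_unit_diff[OF f])
  then have dg: "(\<lambda>x. f x - f' x) \<in> C_groupoid G" using C_unit_subset_C_groupoid by blast
  have g: "f' \<in> C_groupoid G" using f C_unit_subset_C_groupoid by blast
  have "j (\<lambda>x. k x + k' x) = j k + j k'" if "k \<in> C_groupoid G" "k' \<in> C_groupoid G" for k k'
    using j that unfolding cstar_max_def star_hom_on_def by blast
  from this[OF dg g] have "j (\<lambda>x. f x - f' x) = 0" using eq by simp
  then have "orbit_norm (\<lambda>x. f x - f' x) \<le> 0"
    using j dg cstar_seminorm_orbit_norm unfolding cstar_max_def by fastforce
  then have "cmod (f x - f' x) \<le> 0" for x using orbit_norm_ge[OF d, of x] by linarith
  then show "f = f'" by auto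
qed

text \<open>The definition of \<open>cstar_max\<close> does not mention units. The image of the
  indicator is a left unit on a dense set, so on everything, and in particular on 1.\<close>

lemma cstar_max_unital:
  assumes j: "cstar_max G j" shows "j (indicator (units G)) = 1"
proof -
  let ?e = "j (indicator (units G))"
  have j_add: "j (\<lambda>x. f x + f' x) = j f + j f'" and conv: "j (convolution G f f') = j f * j f'"
    if "f \<in> C_groupoid G" "f' \<in> C_groupoid G" for f f'
    using j that unfolding cstar_max_def star_hom_on_def by blast+
  have scale: "j (\<lambda>x. c * f x) = c *\<^sub>C j f" if "f \<in> C_groupoid G" for c f
    using j that unfolding cstar_max_def star_hom_on_def by blast
  have ind: "indicator (units G) \<in> C_groupoid G" using C_unit_indicator C_unit_subset_C_groupoid by blast
  have "?e * j f = j f" if "f \<in> C_groupoid G" for f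
    using that
  proof (induction rule: C_groupoid_induct)
    case zero
    show ?case using scale[OF C_groupoid_zero, of 0] by simp
  next
    case (add f U F)
    obtain b where b: "b \<in> Cc G (supp G U)" "F = src_lift G U b" using Cc_eq_src_lift[OF add.hyps(2,3)] .
    have Fg: "F \<in> C_groupoid G" using Cc_subset_C_groupoid add.hyps by blast
    have "convolution G (indicator (units G)) F = F"
      unfolding b(2) convolution_C_unit_left[OF C_unit_indicator add.hyps(2)]
    proof (rule src_lift_cong)
      fix g assume g: "g \<in> U"
      then have "rng G g \<in> units G" using bisectionD(8)[OF add.hyps(2)] by blast
      then show "psi_push G (set_inv G U) (indicator (units G)) (src G g) * b (src G g) = b (src G g)"
        by (simp add: psi_push_inv_apply[OF add.hyps(2) g])
    qed
    then have "?e * j F = j F" using conv[OF ind Fg] by simp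
    then show ?case using add.IH j_add[OF add.hyps(1) Fg] by (simp add: distrib_left)
  qed
  then have "j ` C_groupoid G \<subseteq> {x. ?e * x = x}" by blast
  moreover have "closed {x. ?e * x = x}" by (intro closed_Collect_eq continuous_intros)
  ultimately have "closure (j ` C_groupoid G) \<subseteq> {x. ?e * x = x}" by (rule closure_minimal)
  then have "?e * 1 = 1" using j unfolding cstar_max_def by blast
  then show ?thesis by simp
qed

end

section \<open>Transfer along a unital homomorphism\<close>

lemma star_iso_betw_hom: "star_iso_betw S T \<phi> \<Longrightarrow> star_hom_on S (+) scaleC (*) star \<phi>"
  by (simp add: star_iso_betw_def)

lemma closed_star_subalgebra_UNIV: "closed_star_subalgebra UNIV"
  by (simp add: closed_star_subalgebra_def)

lemma unital_star_hom_tendsto: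
  assumes \<pi>: "unital_star_hom \<pi>" and f: "(f \<longlongrightarrow> a) F" shows "((\<lambda>x. \<pi> (f x)) \<longlongrightarrow> \<pi> a) F"
proof (rule LIM_zero_cancel, rule Lim_null_comparison)
  show "eventually (\<lambda>x. norm (\<pi> (f x) - \<pi> a) \<le> norm (f x - a)) F"
    using star_hom_contraction[OF closed_star_subalgebra_UNIV] \<pi>
    unfolding unital_star_hom_def by (intro always_eventually) blast
  show "((\<lambda>x. norm (f x - a)) \<longlongrightarrow> 0) F" using f by (simp add: LIM_zero tendsto_norm_zero)
qed

theorem proposition3p7:
  fixes G :: "'g groupoid"
    and j :: "('g \<Rightarrow> complex) \<Rightarrow> 'c::cstar_algebra"
  assumes "etale_groupoid G"
    and "compact_space (unit_space G)"
    and "Hausdorff_space (unit_space G)"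
    and "cstar_max G j"
  shows "(\<exists>\<alpha>. conjugation_structure G j \<alpha>) \<and>
    (\<forall>\<alpha> \<alpha>'. conjugation_structure G j \<alpha> \<and> conjugation_structure G j \<alpha>' \<longrightarrow>
       same_structure G j \<alpha> j \<alpha>') \<and>
    (\<forall>\<alpha> (\<pi> :: 'c \<Rightarrow> 'a::cstar_algebra).
       conjugation_structure G j \<alpha> \<and> unital_star_hom \<pi> \<and> inj_on \<pi> (j ` C_unit G) \<longrightarrow>
         (\<exists>\<iota> \<beta>. G_cstar_algebra G \<iota> \<beta> \<and> equivariant G j \<alpha> \<iota> \<beta> \<pi>) \<and>
         (surj \<pi> \<longrightarrow>
           (\<forall>\<iota> \<beta> \<iota>' \<beta>'.
              G_cstar_algebra G \<iota> \<beta> \<and> equivariant G j \<alpha> \<iota> \<beta> \<pi> \<and>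
              G_cstar_algebra G \<iota>' \<beta>' \<and> equivariant G j \<alpha> \<iota>' \<beta>' \<pi> \<longrightarrow>
              same_structure G \<iota> \<beta> \<iota>' \<beta>')))"
proof -
  interpret compact_etale_groupoid G
    using assms(1-3) by (simp add: compact_etale_groupoid_def compact_etale_groupoid_axioms_def)
  have hom: "star_hom_on (C_groupoid G) (\<lambda>f f' x. f x + f' x) (\<lambda>c f x. c * f x) (convolution G) (involution G) j"
    and dense: "closure (j ` C_groupoid G) = UNIV"
    using assms(4) by (auto simp: cstar_max_def)
  interpret J: groupoid_representation G j
    by unfold_locales (use hom cstar_max_unital[OF assms(4)] in auto)
  have inj: "inj_on j (C_unit G)" by (rule cstar_max_inj[OF assms(4)])
  have hom_of: "star_hom_on (corner G j (supp G \<gamma>)) (+) scaleC (*) star (\<alpha> \<gamma>)"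
    if "conjugation_structure G j \<alpha>" "\<gamma> \<in> bisections G" for \<alpha> \<gamma>
    using that star_iso_betw_hom unfolding conjugation_structure_def G_cstar_algebra_def by blast
  have "conjugation_structure G j J.transport"
    unfolding conjugation_structure_def using J.G_cstar_algebra_transport[OF inj] J.transport_Cc by blast
  moreover have "same_structure G j \<alpha> j \<alpha>'"
    if \<alpha>: "conjugation_structure G j \<alpha>" "conjugation_structure G j \<alpha>'" for \<alpha> \<alpha>'
    unfolding same_structure_def
  proof (intro conjI ballI)
    fix \<gamma> a assume \<gamma>: "\<gamma> \<in> bisections G" and a: "a \<in> corner G j (supp G \<gamma>)"
    note su = bisectionD(5)[OF \<gamma>]
    show "\<alpha> \<gamma> a = \<alpha>' \<gamma> a"
    proof (rule star_homs_agree[OF J.corner_star_subalgebra[OF su] hom_of[OF \<alpha>(1) \<gamma>] hom_of[OF \<alpha>(2) \<gamma>]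
          J.corner_generators_subset[OF su] J.corner_generators_dense[OF su dense] _ a])
      fix x assume "x \<in> J.corner_generators (supp G \<gamma>)"
      then show "\<alpha> \<gamma> x = \<alpha>' \<gamma> x"
        using \<alpha> \<gamma> unfolding conjugation_structure_def J.corner_generators_def by auto
    qed
  qed simp
  moreover have "(\<exists>\<iota> \<beta>. G_cstar_algebra G \<iota> \<beta> \<and> equivariant G j \<alpha> \<iota> \<beta> \<pi>) \<and>
      (surj \<pi> \<longrightarrow> (\<forall>\<iota> \<beta> \<iota>' \<beta>'.
              G_cstar_algebra G \<iota> \<beta> \<and> equivariant G j \<alpha> \<iota> \<beta> \<pi> \<and>
              G_cstar_algebra G \<iota>' \<beta>' \<and> equivariant G j \<alpha> \<iota>' \<beta>' \<pi> \<longrightarrow>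
              same_structure G \<iota> \<beta> \<iota>' \<beta>'))"
    if \<alpha>: "conjugation_structure G j \<alpha>" and \<pi>: "unital_star_hom \<pi>" and inj_\<pi>: "inj_on \<pi> (j ` C_unit G)"
    for \<alpha> and \<pi> :: "'c \<Rightarrow> 'a"
  proof -
    have \<pi>_hom: "star_hom_on UNIV (+) scaleC (*) star \<pi>" and \<pi>_one: "\<pi> 1 = 1"
      using \<pi> by (auto simp: unital_star_hom_def)
    have \<pi>_mult: "\<pi> (x * y) = \<pi> x * \<pi> y" and \<pi>_add: "\<pi> (x + y) = \<pi> x + \<pi> y"
      and \<pi>_scale: "\<pi> (c *\<^sub>C x) = c *\<^sub>C \<pi> x" and \<pi>_star: "\<pi> (star x) = star (\<pi> x)" for x y c
      using \<pi>_hom by (simp_all add: star_hom_on_def)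
    \<comment> \<open>Again a unital representation, so the general construction applies inside the
      target algebra, whether or not \<pi> is surjective.\<close>
    define \<iota> where "\<iota> f = \<pi> (j f)" for f
    have \<iota>_hom: "star_hom_on (C_groupoid G) (\<lambda>f f' x. f x + f' x) (\<lambda>c f x. c * f x) (convolution G) (involution G) \<iota>"
      using hom by (simp add: star_hom_on_def \<iota>_def \<pi>_mult \<pi>_add \<pi>_scale \<pi>_star)
    interpret I: groupoid_representation G \<iota>
      by unfold_locales (use \<iota>_hom J.unital \<pi>_one in \<open>auto simp: \<iota>_def\<close>)
    have \<iota>_inj: "inj_on \<iota> (C_unit G)"
      using comp_inj_on[OF inj inj_\<pi>] by (simp add: \<iota>_def[abs_def] o_def)
    \<comment> \<open>Continuity of \<pi> preserves the limits that characterise corners.\<close>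
    have \<pi>_corner: "\<pi> x \<in> corner G \<iota> V" if V: "openin (unit_space G) V" and x: "x \<in> corner G j V" for V x
      using unital_star_hom_tendsto[OF \<pi> J.corner_tendsto_left[OF V x]]
        unital_star_hom_tendsto[OF \<pi> J.corner_tendsto_right[OF V x]]
      unfolding I.corner_iff[OF V] \<iota>_def \<pi>_mult by blast
    have "equivariant G j \<alpha> \<iota> I.transport \<pi>"
      unfolding equivariant_def
    proof (intro conjI ballI)
      show "\<pi> (j f) = \<iota> f" for f by (simp add: \<iota>_def)
      fix \<gamma> a assume \<gamma>: "\<gamma> \<in> bisections G" and a: "a \<in> corner G j (supp G \<gamma>)"
      note su = bisectionD(5)[OF \<gamma>]
      have \<pi>_sub: "star_hom_on (corner G j (supp G \<gamma>)) (+) scaleC (*) star \<pi>"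
        using \<pi>_hom by (simp add: star_hom_on_def)
      have h1: "star_hom_on (corner G j (supp G \<gamma>)) (+) scaleC (*) star (\<lambda>x. \<pi> (\<alpha> \<gamma> x))"
        by (rule star_hom_on_compose[OF hom_of[OF \<alpha> \<gamma>] subset_UNIV \<pi>_hom])
      have h2: "star_hom_on (corner G j (supp G \<gamma>)) (+) scaleC (*) star (\<lambda>x. I.transport \<gamma> (\<pi> x))"
        by (rule star_hom_on_compose[OF \<pi>_sub _ I.transport_star_hom[OF \<gamma>]]) (use \<pi>_corner[OF su] in blast)
      \<comment> \<open>Both sides are *-homomorphisms in \<open>a\<close>; on generators each
        equals \<pi> applied to the conjugated function.\<close>
      show "\<pi> (\<alpha> \<gamma> a) = I.transport \<gamma> (\<pi> a)"
      proof (rule star_homs_agree[OF J.corner_star_subalgebra[OF su] h1 h2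
            J.corner_generators_subset[OF su] J.corner_generators_dense[OF su dense] _ a])
        fix x assume "x \<in> J.corner_generators (supp G \<gamma>)"
        then obtain f U where U: "U \<in> bisections G" "supp G U \<subseteq> supp G \<gamma>" "im G U \<subseteq> supp G \<gamma>"
          and f: "f \<in> Cc G U" and x: "x = j f" by (auto simp: J.corner_generators_def)
        have "\<alpha> \<gamma> (j f) = j (conj_push G \<gamma> U f)"
          using \<alpha> \<gamma> U f unfolding conjugation_structure_def by blast
        then show "\<pi> (\<alpha> \<gamma> x) = I.transport \<gamma> (\<pi> x)"
          using I.transport_Cc[OF \<gamma> U f] by (simp add: x \<iota>_def)
      qed
    qed
    then have "\<exists>\<iota> \<beta>. G_cstar_algebra G \<iota> \<beta> \<and> equivariant G j \<alpha> \<iota> \<beta> \<pi>"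
      using I.G_cstar_algebra_transport[OF \<iota>_inj] by blast
    moreover have "same_structure G \<kappa> \<beta> \<kappa>' \<beta>'"
      if surj: "surj \<pi>" and \<beta>: "G_cstar_algebra G \<kappa> \<beta>" "equivariant G j \<alpha> \<kappa> \<beta> \<pi>"
        and \<beta>': "G_cstar_algebra G \<kappa>' \<beta>'" "equivariant G j \<alpha> \<kappa>' \<beta>' \<pi>" for \<kappa> \<beta> \<kappa>' \<beta>'
    proof -
      \<comment> \<open>Equivariance fixes the embedding, so the corners of both structures coincide
        with those of \<iota>.\<close>
      have \<kappa>: "\<kappa> f = \<iota> f" "\<kappa>' f = \<iota> f" if "f \<in> C_unit G" for f
        using \<beta>(2) \<beta>'(2) that by (auto simp: equivariant_def \<iota>_def)
      have gens: "{\<kappa> f * a * \<kappa> f' | f a f'. f \<in> C0 G V \<and> f' \<in> C0 G V}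
          = {\<iota> f * a * \<iota> f' | f a f'. f \<in> C0 G V \<and> f' \<in> C0 G V}"
        "{\<kappa>' f * a * \<kappa>' f' | f a f'. f \<in> C0 G V \<and> f' \<in> C0 G V}
          = {\<iota> f * a * \<iota> f' | f a f'. f \<in> C0 G V \<and> f' \<in> C0 G V}" for V
        using \<kappa> unfolding C0_def by (metis (mono_tags, lifting) mem_Collect_eq)+
      then have cor: "corner G \<kappa> V = corner G \<iota> V" "corner G \<kappa>' V = corner G \<iota> V" for V
        by (simp_all add: corner_def)
      show ?thesis
        unfolding same_structure_def
      proof (intro conjI ballI)
        show "\<kappa> f = \<kappa>' f" if "f \<in> C_unit G" for f using \<kappa>[OF that] by simp
        fix \<gamma> a assume \<gamma>: "\<gamma> \<in> bisections G" and "a \<in> corner G \<kappa> (supp G \<gamma>)"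
        then have a: "a \<in> corner G \<iota> (supp G \<gamma>)" by (simp add: cor)
        note su = bisectionD(5)[OF \<gamma>]
        let ?D = "{\<iota> f * a * \<iota> f' | f a f'. f \<in> C0 G (supp G \<gamma>) \<and> f' \<in> C0 G (supp G \<gamma>)}"
        have h: "star_hom_on (corner G \<iota> (supp G \<gamma>)) (+) scaleC (*) star (\<beta> \<gamma>)"
          using \<beta>(1) \<gamma> unfolding G_cstar_algebra_def cor star_iso_betw_def by blast
        have h': "star_hom_on (corner G \<iota> (supp G \<gamma>)) (+) scaleC (*) star (\<beta>' \<gamma>)"
          using \<beta>'(1) \<gamma> unfolding G_cstar_algebra_def cor star_iso_betw_def by blast
        have D: "?D \<subseteq> corner G \<iota> (supp G \<gamma>)" using I.corner_gen by blast
        have D': "corner G \<iota> (supp G \<gamma>) \<subseteq> closure (span ?D)" by (simp add: corner_def)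
        show "\<beta> \<gamma> a = \<beta>' \<gamma> a"
        proof (rule star_homs_agree[OF I.corner_star_subalgebra[OF su] h h' D D' _ a])
          fix x assume "x \<in> ?D"
          then obtain f b f' where x: "x = \<iota> f * b * \<iota> f'" and f: "f \<in> C0 G (supp G \<gamma>)" "f' \<in> C0 G (supp G \<gamma>)"
            by blast
          \<comment> \<open>Surjectivity enters here: the generator is the image of an element of
            the corner upstairs, where equivariance determines both maps.\<close>
          obtain c where c: "b = \<pi> c" using surj by (metis surjD)
          have xc: "x = \<pi> (j f * c * j f')" by (simp add: x \<iota>_def c \<pi>_mult)
          have "j f * c * j f' \<in> corner G j (supp G \<gamma>)" by (rule J.corner_gen[OF f])
          then show "\<beta> \<gamma> x = \<beta>' \<gamma> x"
            using \<beta>(2) \<beta>'(2) \<gamma> unfolding xc equivariant_def by metis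
        qed
      qed
    qed
    ultimately show ?thesis by blast
  qed
  ultimately show ?thesis by blast
qed

end
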